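(* Let $R$ be a commutative noetherian ring, and let $M$ be a finitely generated $R$-module. Let $\boldsymbol{x}=x_1,\dots,x_n$ be a sequence of elements of $R$ such that $M$ is locally free on $D(\boldsymbol{x})$. Then there exists a positive integer $k$ such that the Koszul complex $K(\boldsymbol{x}^k,M)$ is equivalent to a complex of finitely generated $R$-modules $$(0 \to N \to P_{n-1} \to \cdots \to P_0 \to 0),$$ where $P_0,\dots,P_{n-1}$ are projective and $M$ is a direct summand of $N$. In particular, $M$ can be built out of the Koszul homologies $H_0(\boldsymbol{x}^k,M),\dots,H_n(\boldsymbol{x}^k,M)$ by taking $n$ syzygies, $n$ extensions and $1$ direct summand.
   Context: $\boldsymbol{x}^k$ denotes the sequence $x_1^k,\dots,x_n^k$. $V(\boldsymbol{x})$ is the set of prime ideals of $R$ containing $x_1,\dots,x_n$, and $D(\boldsymbol{x})=\operatorname{Spec} R\setminus V(\boldsymbol{x})$. That $M$ is locally free on $D(\boldsymbol{x})$ means that $M_{\mathfrak p}$ is a free $R_{\mathfrak p}$-module for every $\mathfrak p\in D(\boldsymbol{x})$. $K(\boldsymbol{x},M)$ is the Koszul complex of $M$ with respect to $\boldsymbol{x}$, and $H_i(\boldsymbol{x},M)=H_i(K(\boldsymbol{x},M))$ is the $i$-th Koszul homology. Two complexes $X,Y$ are equivalent if there is a finite sequence of complexes $X=X^0,X^1,\dots,X^m=Y$ with a quasi-isomorphism between $X^i$ and $X^{i+1}$ for each $0\le i\le m-1$. A syzygy of a finitely generated module $E$ is the kernel of a surjection from a finitely generated projective module onto $E$ (it is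 determined up to projective summands). An extension of modules $A$ and $B$ is a module $E$ fitting into a short exact sequence with end terms $A$ and $B$. *)

theory Defs
  imports "HOL-Algebra.Ring_Divisibility" "HOL-Algebra.Module"
begin

section \<open>Modules\<close>

text \<open>In the module records constructed below only \<open>carrier\<close>, \<open>add\<close>, \<open>zero\<close> and \<open>smult\<close> matter.
  The fields \<open>mult\<close> and \<open>one\<close>, which the record type inherits from rings, are left undefined.\<close>

definition mod_hom ::
  "('a, 'r) ring_scheme \<Rightarrow> ('a, 'm, 'c) module_scheme \<Rightarrow> ('a, 'n, 'd) module_scheme \<Rightarrow> ('m \<Rightarrow> 'n) set"
  where "mod_hom R M N = {f. f \<in> carrier M \<rightarrow> carrier N \<and>
    (\<forall>x \<in> carrier M. \<forall>y \<in> carrier M. f (x \<oplus>\<^bsub>M\<^esub> y) = f x \<oplus>\<^bsub>N\<^esub> f y) \<and>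
    (\<forall>a \<in> carrier R. \<forall>x \<in> carrier M. f (a \<odot>\<^bsub>M\<^esub> x) = a \<odot>\<^bsub>N\<^esub> f x)}"

definition mod_isomorphic ::
  "('a, 'r) ring_scheme \<Rightarrow> ('a, 'm, 'c) module_scheme \<Rightarrow> ('a, 'n, 'd) module_scheme \<Rightarrow> bool"
  where "mod_isomorphic R M N \<longleftrightarrow> module R M \<and> module R N \<and>
    (\<exists>f \<in> mod_hom R M N. bij_betw f (carrier M) (carrier N))"

definition finitely_generated :: "('a, 'r) ring_scheme \<Rightarrow> ('a, 'm, 'c) module_scheme \<Rightarrow> bool"
  where "finitely_generated R M \<longleftrightarrow> (\<exists>S. finite S \<and> S \<subseteq> carrier M \<and>
    (\<forall>x \<in> carrier M. \<exists>c \<in> S \<rightarrow> carrier R. x = (\<Oplus>\<^bsub>M\<^esub>s\<in>S. c s \<odot>\<^bsub>M\<^esub> s)))"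

definition quot_mod :: "('a, 'm, 'c) module_scheme \<Rightarrow> 'm set \<Rightarrow> ('a, 'm set) module"
  where "quot_mod M H = \<lparr>carrier = a_rcosets\<^bsub>M\<^esub> H, mult = undefined, one = undefined,
    zero = H, add = (\<lambda>X Y. X <+>\<^bsub>M\<^esub> Y),
    smult = (\<lambda>a X. H <+>\<^bsub>M\<^esub> ((\<lambda>x. a \<odot>\<^bsub>M\<^esub> x) ` X))\<rparr>"

text \<open>\<open>dsum M I\<close> is the direct sum of copies of \<open>M\<close> indexed by \<open>I\<close>: finitely supported functions,
  extended by zero outside \<open>I\<close>.\<close>

definition dsum :: "('a, 'm, 'c) module_scheme \<Rightarrow> 'i set \<Rightarrow> ('a, 'i \<Rightarrow> 'm) module"
  where "dsum M I = \<lparr>carrier = {f. (\<forall>i \<in> I. f i \<in> carrier M) \<and> (\<forall>i. i \<notin> I \<longrightarrow> f i = \<zero>\<^bsub>M\<^esub>)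
      \<and> finite {i. f i \<noteq> \<zero>\<^bsub>M\<^esub>}},
    mult = undefined, one = undefined, zero = (\<lambda>_. \<zero>\<^bsub>M\<^esub>),
    add = (\<lambda>f g i. f i \<oplus>\<^bsub>M\<^esub> g i), smult = (\<lambda>a f i. a \<odot>\<^bsub>M\<^esub> f i)\<rparr>"

definition self_module :: "('a, 'r) ring_scheme \<Rightarrow> ('a, 'a) module"
  where "self_module R = \<lparr>carrier = carrier R, mult = mult R, one = one R,
    zero = zero R, add = add R, smult = mult R\<rparr>"

definition is_basis :: "('a, 'r) ring_scheme \<Rightarrow> ('a, 'm, 'c) module_scheme \<Rightarrow> 'm set \<Rightarrow> bool"
  where "is_basis R M B \<longleftrightarrow> B \<subseteq> carrier M \<and>
    bij_betw (\<lambda>f. \<Oplus>\<^bsub>M\<^esub>b\<in>{b \<in> B. f b \<noteq> \<zero>\<^bsub>R\<^esub>}. f b \<odot>\<^bsub>M\<^esub> b)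
      (carrier (dsum (self_module R) B)) (carrier M)"

definition free_module :: "('a, 'r) ring_scheme \<Rightarrow> ('a, 'm, 'c) module_scheme \<Rightarrow> bool"
  where "free_module R M \<longleftrightarrow> module R M \<and> (\<exists>B. is_basis R M B)"

definition direct_summand ::
  "('a, 'r) ring_scheme \<Rightarrow> ('a, 'm, 'c) module_scheme \<Rightarrow> ('a, 'n, 'd) module_scheme \<Rightarrow> bool"
  where "direct_summand R M N \<longleftrightarrow> module R N \<and>
    (\<exists>A B. submodule A R N \<and> submodule B R N \<and> A <+>\<^bsub>N\<^esub> B = carrier N \<and> A \<inter> B = {\<zero>\<^bsub>N\<^esub>} \<and>
      mod_isomorphic R M (N\<lparr>carrier := A\<rparr>))"

text \<open>Projective means direct summand of a free module.  Index sets of the element type of \<open>P\<close>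
  suffice: a projective \<open>P\<close> is a summand of the free module on the set \<open>carrier P\<close>.\<close>

definition projective_module :: "('a, 'r) ring_scheme \<Rightarrow> ('a, 'm, 'c) module_scheme \<Rightarrow> bool"
  where "projective_module R P \<longleftrightarrow>
    module R P \<and> (\<exists>I :: 'm set. direct_summand R P (dsum (self_module R) I))"


section \<open>Localization\<close>

definition loc_rel ::
  "('a, 'm, 'c) module_scheme \<Rightarrow> 'a set \<Rightarrow> (('m \<times> 'a) \<times> ('m \<times> 'a)) set"
  where "loc_rel M S = {((m, s), (m', s')). m \<in> carrier M \<and> m' \<in> carrier M \<and> s \<in> S \<and> s' \<in> S \<and>
    (\<exists>t \<in> S. t \<odot>\<^bsub>M\<^esub> (s' \<odot>\<^bsub>M\<^esub> m) = t \<odot>\<^bsub>M\<^esub> (s \<odot>\<^bsub>M\<^esub> m'))}"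

definition mod_frac :: "('a, 'm, 'c) module_scheme \<Rightarrow> 'a set \<Rightarrow> 'm \<Rightarrow> 'a \<Rightarrow> ('m \<times> 'a) set"
  where "mod_frac M S m s = loc_rel M S `` {(m, s)}"

definition loc_add :: "('a, 'r) ring_scheme \<Rightarrow> ('a, 'm, 'c) module_scheme \<Rightarrow> 'a set \<Rightarrow>
    ('m \<times> 'a) set \<Rightarrow> ('m \<times> 'a) set \<Rightarrow> ('m \<times> 'a) set"
  where "loc_add R M S X Y = (\<Union>(m, s) \<in> X. \<Union>(m', s') \<in> Y.
    mod_frac M S ((s' \<odot>\<^bsub>M\<^esub> m) \<oplus>\<^bsub>M\<^esub> (s \<odot>\<^bsub>M\<^esub> m')) (s \<otimes>\<^bsub>R\<^esub> s'))"

definition loc_smult :: "('a, 'r) ring_scheme \<Rightarrow> ('a, 'm, 'c) module_scheme \<Rightarrow> 'a set \<Rightarrow>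
    ('a \<times> 'a) set \<Rightarrow> ('m \<times> 'a) set \<Rightarrow> ('m \<times> 'a) set"
  where "loc_smult R M S X Y = (\<Union>(a, s) \<in> X. \<Union>(m, t) \<in> Y. mod_frac M S (a \<odot>\<^bsub>M\<^esub> m) (s \<otimes>\<^bsub>R\<^esub> t))"

definition loc_ring :: "('a, 'r) ring_scheme \<Rightarrow> 'a set \<Rightarrow> ('a \<times> 'a) set ring"
  where "loc_ring R S = \<lparr>carrier = (carrier R \<times> S) // loc_rel (self_module R) S,
    mult = loc_smult R (self_module R) S, one = mod_frac (self_module R) S \<one>\<^bsub>R\<^esub> \<one>\<^bsub>R\<^esub>,
    zero = mod_frac (self_module R) S \<zero>\<^bsub>R\<^esub> \<one>\<^bsub>R\<^esub>, add = loc_add R (self_module R) S\<rparr>"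

definition loc_module :: "('a, 'r) ring_scheme \<Rightarrow> ('a, 'm, 'c) module_scheme \<Rightarrow> 'a set \<Rightarrow>
    (('a \<times> 'a) set, ('m \<times> 'a) set) module"
  where "loc_module R M S = \<lparr>carrier = (carrier M \<times> S) // loc_rel M S,
    mult = undefined, one = undefined, zero = mod_frac M S \<zero>\<^bsub>M\<^esub> \<one>\<^bsub>R\<^esub>, add = loc_add R M S,
    smult = loc_smult R M S\<rparr>"

definition Spec :: "('a, 'r) ring_scheme \<Rightarrow> 'a set set"
  where "Spec R = {P. primeideal P R}"

definition V_locus :: "('a, 'r) ring_scheme \<Rightarrow> 'a list \<Rightarrow> 'a set set"
  where "V_locus R xs = {P \<in> Spec R. set xs \<subseteq> P}"

definition D_locus :: "('a, 'r) ring_scheme \<Rightarrow> 'a list \<Rightarrow> 'a set set"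
  where "D_locus R xs = Spec R - V_locus R xs"

definition locally_free_on ::
  "('a, 'r) ring_scheme \<Rightarrow> ('a, 'm, 'c) module_scheme \<Rightarrow> 'a set set \<Rightarrow> bool"
  where "locally_free_on R M D \<longleftrightarrow>
    (\<forall>P \<in> D. free_module (loc_ring R (carrier R - P)) (loc_module R M (carrier R - P)))"


section \<open>Complexes\<close>

record ('a, 'v) mod_cplx =
  obj :: "int \<Rightarrow> ('a, 'v) module"
  diff :: "int \<Rightarrow> 'v \<Rightarrow> 'v"

text \<open>Homological grading: \<open>diff X i\<close> maps \<open>obj X i\<close> to \<open>obj X (i - 1)\<close>.\<close>

definition is_cplx :: "('a, 'r) ring_scheme \<Rightarrow> ('a, 'v) mod_cplx \<Rightarrow> bool"
  where "is_cplx R X \<longleftrightarrow> (\<forall>i. module R (obj X i) \<and>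
    diff X i \<in> mod_hom R (obj X i) (obj X (i - 1)) \<and>
    (\<forall>x \<in> carrier (obj X i). diff X (i - 1) (diff X i x) = \<zero>\<^bsub>obj X (i - 2)\<^esub>))"

definition cycles :: "('a, 'v) mod_cplx \<Rightarrow> int \<Rightarrow> 'v set"
  where "cycles X i = {x \<in> carrier (obj X i). diff X i x = \<zero>\<^bsub>obj X (i - 1)\<^esub>}"

definition boundaries :: "('a, 'v) mod_cplx \<Rightarrow> int \<Rightarrow> 'v set"
  where "boundaries X i = diff X (i + 1) ` carrier (obj X (i + 1))"

definition homology :: "('a, 'v) mod_cplx \<Rightarrow> int \<Rightarrow> ('a, 'v set) module"
  where "homology X i = quot_mod ((obj X i)\<lparr>carrier := cycles X i\<rparr>) (boundaries X i)"

definition chain_map ::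
  "('a, 'r) ring_scheme \<Rightarrow> ('a, 'u) mod_cplx \<Rightarrow> ('a, 'v) mod_cplx \<Rightarrow> (int \<Rightarrow> 'u \<Rightarrow> 'v) \<Rightarrow> bool"
  where "chain_map R X Y f \<longleftrightarrow> (\<forall>i. f i \<in> mod_hom R (obj X i) (obj Y i) \<and>
    (\<forall>x \<in> carrier (obj X i). f (i - 1) (diff X i x) = diff Y i (f i x)))"

text \<open>The map induced on homology sends the class \<open>C\<close> of a cycle \<open>z\<close> to the class of \<open>f i z\<close>,
  which is the coset \<open>boundaries Y i + f i ` C\<close>.\<close>

definition quasi_iso ::
  "('a, 'r) ring_scheme \<Rightarrow> ('a, 'u) mod_cplx \<Rightarrow> ('a, 'v) mod_cplx \<Rightarrow> (int \<Rightarrow> 'u \<Rightarrow> 'v) \<Rightarrow> bool"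
  where "quasi_iso R X Y f \<longleftrightarrow> is_cplx R X \<and> is_cplx R Y \<and> chain_map R X Y f \<and>
    (\<forall>i. bij_betw (\<lambda>C. boundaries Y i <+>\<^bsub>obj Y i\<^esub> (f i ` C))
      (carrier (homology X i)) (carrier (homology Y i)))"

definition qis_linked ::
  "('a, 'r) ring_scheme \<Rightarrow> ('a, 'u) mod_cplx \<Rightarrow> ('a, 'v) mod_cplx \<Rightarrow> bool"
  where "qis_linked R X Y \<longleftrightarrow> (\<exists>f. quasi_iso R X Y f) \<or> (\<exists>g. quasi_iso R Y X g)"

text \<open>A zigzag of quasi-isomorphisms from \<open>X\<close> to \<open>Y\<close>, either of length one or with intermediate
  complexes \<open>Z 0, \<dots>, Z p\<close>.  Since \<open>X\<close> and \<open>Y\<close> may have different element types, the intermediate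
  complexes need a type of their own.  The type \<open>nat \<Rightarrow> 'a \<times> 'u \<times> 'v\<close> loses no generality: equivalent
  \<open>X\<close> and \<open>Y\<close> can be linked through a semi-free resolution of \<open>X\<close>, whose terms can be chosen of
  cardinality at most the maximum of those of \<open>R\<close>, the terms of \<open>X\<close>, and \<open>nat\<close>.\<close>

definition equivalent_cplx ::
  "('a, 'r) ring_scheme \<Rightarrow> ('a, 'u) mod_cplx \<Rightarrow> ('a, 'v) mod_cplx \<Rightarrow> bool"
  where "equivalent_cplx R X Y \<longleftrightarrow> qis_linked R X Y \<or>
    (\<exists>p. \<exists>Z :: nat \<Rightarrow> ('a, nat \<Rightarrow> 'a \<times> 'u \<times> 'v) mod_cplx.
      qis_linked R X (Z 0) \<and> (\<forall>i<p. qis_linked R (Z i) (Z (Suc i))) \<and> qis_linked R (Z p) Y)"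


section \<open>The Koszul complex\<close>

text \<open>\<open>K\<^sub>i\<close> is the \<open>i\<close>-th exterior power of \<open>R\<^sup>n\<close> tensored with \<open>M\<close>.  Its element
  \<open>\<Sum>\<^sub>J f(J) e\<^sub>J\<close>, the sum over \<open>i\<close>-element subsets \<open>J\<close> of \<open>{0..<n}\<close>, is represented by \<open>f\<close>.
  The differential is determined by
  \<open>m e\<^sub>S \<mapsto> \<Sum>\<^bsub>j \<in> S\<^esub> (-1)\<^bsup>card {l \<in> S. l < j}\<^esup> x\<^sub>j m e\<^bsub>S - {j}\<^esub>\<close>; its coefficient at \<open>J\<close>
  collects the terms with \<open>S = J \<union> {j}\<close>, \<open>j \<notin> J\<close>.\<close>

definition index_sets :: "nat \<Rightarrow> int \<Rightarrow> nat set set"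
  where "index_sets n i = {J. J \<subseteq> {..<n} \<and> int (card J) = i}"

definition koszul ::
  "('a, 'r) ring_scheme \<Rightarrow> 'a list \<Rightarrow> ('a, 'm, 'c) module_scheme \<Rightarrow> ('a, nat set \<Rightarrow> 'm) mod_cplx"
  where "koszul R xs M = \<lparr>obj = (\<lambda>i. dsum M (index_sets (length xs) i)),
    diff = (\<lambda>i f J. if J \<in> index_sets (length xs) (i - 1)
      then (\<Oplus>\<^bsub>M\<^esub>j\<in>{..<length xs} - J.
        (((\<ominus>\<^bsub>R\<^esub> \<one>\<^bsub>R\<^esub>) [^]\<^bsub>R\<^esub> card {l \<in> J. l < j}) \<otimes>\<^bsub>R\<^esub> xs ! j) \<odot>\<^bsub>M\<^esub> f (insert j J))
      else \<zero>\<^bsub>M\<^esub>)\<rparr>"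

definition koszul_homology ::
  "('a, 'r) ring_scheme \<Rightarrow> 'a list \<Rightarrow> ('a, 'm, 'c) module_scheme \<Rightarrow> int \<Rightarrow>
    ('a, (nat set \<Rightarrow> 'm) set) module"
  where "koszul_homology R xs M i = homology (koszul R xs M) i"

definition seq_pow :: "('a, 'r) ring_scheme \<Rightarrow> 'a list \<Rightarrow> nat \<Rightarrow> 'a list"
  where "seq_pow R xs k = map (\<lambda>x. x [^]\<^bsub>R\<^esub> k) xs"


section \<open>Syzygies, extensions, and building\<close>

definition short_exact ::
  "('a, 'r) ring_scheme \<Rightarrow> ('a, 'l, 'b) module_scheme \<Rightarrow> ('a, 'm, 'c) module_scheme \<Rightarrow>
    ('a, 'n, 'd) module_scheme \<Rightarrow> ('l \<Rightarrow> 'm) \<Rightarrow> ('m \<Rightarrow> 'n) \<Rightarrow> bool"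
  where "short_exact R A E B f g \<longleftrightarrow> module R A \<and> module R E \<and> module R B \<and>
    f \<in> mod_hom R A E \<and> g \<in> mod_hom R E B \<and>
    inj_on f (carrier A) \<and> g ` carrier E = carrier B \<and> f ` carrier A = a_kernel E B g"

definition is_extension ::
  "('a, 'r) ring_scheme \<Rightarrow> ('a, 'm, 'c) module_scheme \<Rightarrow> ('a, 'l, 'b) module_scheme \<Rightarrow>
    ('a, 'n, 'd) module_scheme \<Rightarrow> bool"
  where "is_extension R E A B \<longleftrightarrow> (\<exists>f g. short_exact R A E B f g)"

text \<open>Every finitely generated \<open>R\<close>-module is isomorphic to one with elements in \<open>nat \<Rightarrow> 'a\<close>: choose
  representatives of the cosets in a quotient of some \<open>R\<^sup>m\<close>.  So this type serves as the universe of
  finitely generated modules.\<close>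

definition is_syzygy ::
  "('a, 'r) ring_scheme \<Rightarrow> ('a, 'm, 'c) module_scheme \<Rightarrow> ('a, 'n, 'd) module_scheme \<Rightarrow> bool"
  where "is_syzygy R Y E \<longleftrightarrow> (\<exists>P :: ('a, nat \<Rightarrow> 'a) module.
    finitely_generated R P \<and> projective_module R P \<and> (\<exists>f g. short_exact R Y P E f g))"

text \<open>\<open>built R \<H> s e d X\<close>: some construction of \<open>X\<close> from the modules in \<open>\<H>\<close> uses, in total,
  \<open>s\<close> syzygies, \<open>e\<close> extensions and \<open>d\<close> passages to a direct summand.\<close>

inductive built ::
  "('a, 'r) ring_scheme \<Rightarrow> ('a, 'h) module set \<Rightarrow> nat \<Rightarrow> nat \<Rightarrow> nat \<Rightarrow> ('a, nat \<Rightarrow> 'a) module \<Rightarrow> bool"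
  for R \<H> where
  start: "H \<in> \<H> \<Longrightarrow> mod_isomorphic R X H \<Longrightarrow> built R \<H> 0 0 0 X"
| syzygy: "built R \<H> s e d X \<Longrightarrow> is_syzygy R Y X \<Longrightarrow> built R \<H> (Suc s) e d Y"
| extension: "built R \<H> s e d A \<Longrightarrow> built R \<H> s' e' d' B \<Longrightarrow> is_extension R E A B \<Longrightarrow>
    built R \<H> (s + s') (Suc (e + e')) (d + d') E"
| summand: "built R \<H> s e d X \<Longrightarrow> direct_summand R Y X \<Longrightarrow> built R \<H> s e (Suc d) Y"

definition built_from :: "('a, 'r) ring_scheme \<Rightarrow> ('a, 'h) module set \<Rightarrow> nat \<Rightarrow> nat \<Rightarrow> nat \<Rightarrow>
    ('a, 'm, 'c) module_scheme \<Rightarrow> bool"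
  where "built_from R \<H> s e d M \<longleftrightarrow> (\<exists>X. mod_isomorphic R M X \<and> built R \<H> s e d X)"

end

theory Submission
  imports Defs
begin

text \<open>Multiplications \<open>a : M \<rightarrow> M\<close> that factor through a finitely generated free module form an ideal.  Where
  \<open>M\<close> is locally free, clearing denominators in a local basis puts an element outside the given prime
  into this ideal, so it contains a power of every \<open>x\<^sub>i\<close>.

  Let \<open>a = \<pi> f\<close> with \<open>\<pi> : F \<rightarrow> M\<close> a free cover.  The pullback \<open>N \<cong> M \<oplus> ker \<pi>\<close> of \<open>\<pi>\<close> along \<open>a\<close>
  yields a quasi-isomorphism from \<open>N \<rightarrow> F\<close> to \<open>a : M \<rightarrow> M\<close>, and the other \<open>x\<^sub>i\<close> still factor through free
  modules on \<open>N\<close>.  As the Koszul complex of \<open>x\<^sub>1, \<dots>, x\<^sub>n\<close> is the cone of \<open>x\<^sub>n\<close> on the one of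
  \<open>x\<^sub>1, \<dots>, x\<^bsub>n-1\<^esub>\<close>, induction on \<open>n\<close> replaces it by a complex of projectives below degree \<open>n\<close>, with
  \<open>M\<close> a summand in degree \<open>n\<close>.\<close>


section \<open>Modules and homomorphisms\<close>

text \<open>The induction on n changes the module: after one element it continues with N, for which
  local freeness would have to be shown anew. The hypothesis carried along is therefore
  \<open>fac\<close>, which is closed under sums and under composition on both sides and mentions no
  primes. For the identity of a module it also expresses that the module is finitely generated
  projective.

  Each pullback lives over a product type. Being finitely generated, it can be renamed into
  \<open>nat => 'a\<close>, so the induction hypothesis concerns one fixed type. Noetherianity keeps
  the pullbacks finitely generated; it also supplies the common denominators for returning from a
  localization to R.

  N sits one degree above F, so after n steps only the term in degree n may fail to be projective,
  and it contains M because each pullback contains the module it came from.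

  For the building statement, the cokernels C_i / B_i cost one syzygy and one extension per step
  from i to i + 1. There are no boundaries in degree n, so the last cokernel is C_n itself, and the
  passage to M is the one direct summand.\<close>

lemma (in abelian_group) a_inv_zero: "\<ominus> \<zero> = \<zero>"
  using r_neg[of \<zero>] by simp

text \<open>Hands the module laws to the \<open>algebra\<close> method, which below settles
  identities between sums, differences and scalar multiples.\<close>

lemmas (in module) module_simprules
  [algebra add: module "zero M" "add M" "a_inv M" "a_minus M" "smult M"] =
  M.a_closed M.zero_closed M.a_inv_closed M.minus_closed smult_closed
  R.a_closed R.zero_closed R.a_inv_closed R.m_closed
  M.a_assoc M.l_zero M.l_neg M.a_comm M.minus_eq M.r_zero M.r_neg M.r_neg2 M.r_neg1
  M.minus_add M.minus_minus M.a_inv_zero M.a_lcomm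
  smult_r_distr smult_l_distr smult_r_minus smult_l_minus smult_l_null smult_r_null

lemma (in module) minus_zero_right: "x \<in> carrier M \<Longrightarrow> x \<ominus>\<^bsub>M\<^esub> \<zero>\<^bsub>M\<^esub> = x"
  and minus_self: "x \<in> carrier M \<Longrightarrow> x \<ominus>\<^bsub>M\<^esub> x = \<zero>\<^bsub>M\<^esub>"
  by (simp_all add: a_minus_def M.a_inv_zero M.r_neg)

lemma (in module) minus_eq_zero_iff:
  assumes "x \<in> carrier M" "y \<in> carrier M" shows "x \<ominus>\<^bsub>M\<^esub> y = \<zero>\<^bsub>M\<^esub> \<longleftrightarrow> x = y"
proof
  assume "x \<ominus>\<^bsub>M\<^esub> y = \<zero>\<^bsub>M\<^esub>"
  moreover have "x = (x \<ominus>\<^bsub>M\<^esub> y) \<oplus>\<^bsub>M\<^esub> y" using assms by algebra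
  ultimately show "x = y" using assms by simp
qed (simp add: assms minus_self)

text \<open>The inverse of \<open>x\<close> is \<open>(\<ominus> \<one>)\<close> times
  \<open>x\<close>, so the records constructed below need no negation of their own; the law
  \<open>zs\<close> makes -1 + 1 act as zero.\<close>

lemma module_fromI:
  fixes R (structure) and M (structure)
  assumes R: "cring R"
    and zc: "\<zero>\<^bsub>M\<^esub> \<in> carrier M"
    and ac: "\<And>x y. x \<in> carrier M \<Longrightarrow> y \<in> carrier M \<Longrightarrow> x \<oplus>\<^bsub>M\<^esub> y \<in> carrier M"
    and assoc: "\<And>x y z. x \<in> carrier M \<Longrightarrow> y \<in> carrier M \<Longrightarrow> z \<in> carrier M \<Longrightarrow>
      (x \<oplus>\<^bsub>M\<^esub> y) \<oplus>\<^bsub>M\<^esub> z = x \<oplus>\<^bsub>M\<^esub> (y \<oplus>\<^bsub>M\<^esub> z)"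
    and comm: "\<And>x y. x \<in> carrier M \<Longrightarrow> y \<in> carrier M \<Longrightarrow> x \<oplus>\<^bsub>M\<^esub> y = y \<oplus>\<^bsub>M\<^esub> x"
    and lz: "\<And>x. x \<in> carrier M \<Longrightarrow> \<zero>\<^bsub>M\<^esub> \<oplus>\<^bsub>M\<^esub> x = x"
    and sc: "\<And>a x. a \<in> carrier R \<Longrightarrow> x \<in> carrier M \<Longrightarrow> a \<odot>\<^bsub>M\<^esub> x \<in> carrier M"
    and ld: "\<And>a b x. a \<in> carrier R \<Longrightarrow> b \<in> carrier R \<Longrightarrow> x \<in> carrier M \<Longrightarrow>
      (a \<oplus> b) \<odot>\<^bsub>M\<^esub> x = (a \<odot>\<^bsub>M\<^esub> x) \<oplus>\<^bsub>M\<^esub> (b \<odot>\<^bsub>M\<^esub> x)"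
    and rd: "\<And>a x y. a \<in> carrier R \<Longrightarrow> x \<in> carrier M \<Longrightarrow> y \<in> carrier M \<Longrightarrow>
      a \<odot>\<^bsub>M\<^esub> (x \<oplus>\<^bsub>M\<^esub> y) = (a \<odot>\<^bsub>M\<^esub> x) \<oplus>\<^bsub>M\<^esub> (a \<odot>\<^bsub>M\<^esub> y)"
    and sa: "\<And>a b x. a \<in> carrier R \<Longrightarrow> b \<in> carrier R \<Longrightarrow> x \<in> carrier M \<Longrightarrow>
      (a \<otimes> b) \<odot>\<^bsub>M\<^esub> x = a \<odot>\<^bsub>M\<^esub> (b \<odot>\<^bsub>M\<^esub> x)"
    and one: "\<And>x. x \<in> carrier M \<Longrightarrow> \<one> \<odot>\<^bsub>M\<^esub> x = x"
    and zs: "\<And>x. x \<in> carrier M \<Longrightarrow> \<zero> \<odot>\<^bsub>M\<^esub> x = \<zero>\<^bsub>M\<^esub>"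
  shows "module R M"
proof (rule moduleI)
  interpret R: cring R by fact
  show "abelian_group M"
  proof (rule abelian_groupI)
    fix x assume x: "x \<in> carrier M"
    have "(\<ominus> \<one>) \<odot>\<^bsub>M\<^esub> x \<oplus>\<^bsub>M\<^esub> x = (\<ominus> \<one> \<oplus> \<one>) \<odot>\<^bsub>M\<^esub> x"
      using x ld[of "\<ominus> \<one>" \<one> x] one by simp
    also have "\<dots> = \<zero>\<^bsub>M\<^esub>" using zs[OF x] by (simp add: R.l_neg)
    finally show "\<exists>y\<in>carrier M. y \<oplus>\<^bsub>M\<^esub> x = \<zero>\<^bsub>M\<^esub>" using sc[of "\<ominus> \<one>" x] x by auto
  qed (simp_all add: zc ac assoc lz, rule comm)
qed (simp_all add: assms)

lemma mod_homI:
  assumes "\<And>x. x \<in> carrier M \<Longrightarrow> f x \<in> carrier N"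
    and "\<And>x y. x \<in> carrier M \<Longrightarrow> y \<in> carrier M \<Longrightarrow> f (x \<oplus>\<^bsub>M\<^esub> y) = f x \<oplus>\<^bsub>N\<^esub> f y"
    and "\<And>a x. a \<in> carrier R \<Longrightarrow> x \<in> carrier M \<Longrightarrow> f (a \<odot>\<^bsub>M\<^esub> x) = a \<odot>\<^bsub>N\<^esub> f x"
  shows "f \<in> mod_hom R M N"
  using assms by (auto simp: mod_hom_def)

lemma mod_hom_closed: "f \<in> mod_hom R M N \<Longrightarrow> x \<in> carrier M \<Longrightarrow> f x \<in> carrier N"
  and mod_hom_add: "f \<in> mod_hom R M N \<Longrightarrow> x \<in> carrier M \<Longrightarrow> y \<in> carrier M \<Longrightarrow>
    f (x \<oplus>\<^bsub>M\<^esub> y) = f x \<oplus>\<^bsub>N\<^esub> f y"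
  and mod_hom_smult: "f \<in> mod_hom R M N \<Longrightarrow> a \<in> carrier R \<Longrightarrow> x \<in> carrier M \<Longrightarrow>
    f (a \<odot>\<^bsub>M\<^esub> x) = a \<odot>\<^bsub>N\<^esub> f x"
  by (auto simp: mod_hom_def)

lemma mod_hom_zero:
  assumes "module R M" "module R N" "f \<in> mod_hom R M N"
  shows "f \<zero>\<^bsub>M\<^esub> = \<zero>\<^bsub>N\<^esub>"
proof -
  interpret M: module R M by fact
  interpret N: module R N by fact
  have "f (\<zero>\<^bsub>R\<^esub> \<odot>\<^bsub>M\<^esub> \<zero>\<^bsub>M\<^esub>) = \<zero>\<^bsub>R\<^esub> \<odot>\<^bsub>N\<^esub> f \<zero>\<^bsub>M\<^esub>"
    using assms(3) by (simp only: mod_hom_smult M.zero_closed M.R.zero_closed)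
  then show ?thesis using mod_hom_closed[OF assms(3) M.zero_closed] by simp
qed

lemma mod_hom_minus:
  assumes "module R M" "module R N" "f \<in> mod_hom R M N" "x \<in> carrier M"
  shows "f (\<ominus>\<^bsub>M\<^esub> x) = \<ominus>\<^bsub>N\<^esub> f x"
proof -
  interpret M: module R M by fact
  interpret N: module R N by fact
  have "f ((\<ominus>\<^bsub>R\<^esub> \<one>\<^bsub>R\<^esub>) \<odot>\<^bsub>M\<^esub> x) = (\<ominus>\<^bsub>R\<^esub> \<one>\<^bsub>R\<^esub>) \<odot>\<^bsub>N\<^esub> f x"
    using assms by (simp add: mod_hom_smult)
  then show ?thesis
    using mod_hom_closed[OF assms(3,4)] assms(4) by (simp add: M.smult_l_minus N.smult_l_minus)
qed

lemma mod_hom_diff: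
  assumes "module R M" "module R N" "f \<in> mod_hom R M N" "x \<in> carrier M" "y \<in> carrier M"
  shows "f (x \<ominus>\<^bsub>M\<^esub> y) = f x \<ominus>\<^bsub>N\<^esub> f y"
proof -
  interpret M: module R M by fact
  interpret N: module R N by fact
  show ?thesis using assms by (simp add: a_minus_def mod_hom_add mod_hom_minus)
qed

lemma mod_hom_comp:
  "f \<in> mod_hom R M N \<Longrightarrow> g \<in> mod_hom R N L \<Longrightarrow> (\<lambda>x. g (f x)) \<in> mod_hom R M L"
  by (rule mod_homI) (simp_all add: mod_hom_closed mod_hom_add mod_hom_smult)

lemma mod_hom_id: "(\<lambda>x. x) \<in> mod_hom R M M"
  by (rule mod_homI) auto

lemma mod_hom_const_zero:
  assumes "module R N" shows "(\<lambda>x. \<zero>\<^bsub>N\<^esub>) \<in> mod_hom R M N"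
proof -
  interpret N: module R N by fact
  show ?thesis by (rule mod_homI) auto
qed

lemma mod_hom_plus:
  assumes "module R N" "f \<in> mod_hom R M N" "g \<in> mod_hom R M N"
  shows "(\<lambda>x. f x \<oplus>\<^bsub>N\<^esub> g x) \<in> mod_hom R M N"
proof -
  interpret N: module R N by fact
  show ?thesis using assms(2,3)
    by (intro mod_homI)
      (simp_all add: mod_hom_closed mod_hom_add mod_hom_smult N.smult_r_distr N.M.a_ac)
qed

lemma mod_hom_scale:
  assumes "module R N" "a \<in> carrier R"
  shows "(\<lambda>x. a \<odot>\<^bsub>N\<^esub> x) \<in> mod_hom R N N"
proof -
  interpret N: module R N by fact
  show ?thesis using assms(2)
    by (intro mod_homI) (simp_all add: N.smult_r_distr N.smult_assoc1[symmetric] N.R.m_comm)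
qed

lemma mod_hom_minus_fun:
  assumes "module R N" "f \<in> mod_hom R M N" "g \<in> mod_hom R M N"
  shows "(\<lambda>x. f x \<ominus>\<^bsub>N\<^esub> g x) \<in> mod_hom R M N"
proof -
  interpret N: module R N by fact
  show ?thesis
  proof (rule mod_homI)
    fix x y assume "x \<in> carrier M" "y \<in> carrier M"
    then have "f x \<in> carrier N" "g x \<in> carrier N" "f y \<in> carrier N" "g y \<in> carrier N"
      using assms by (auto simp: mod_hom_closed)
    then have "f x \<oplus>\<^bsub>N\<^esub> f y \<ominus>\<^bsub>N\<^esub> (g x \<oplus>\<^bsub>N\<^esub> g y) = f x \<ominus>\<^bsub>N\<^esub> g x \<oplus>\<^bsub>N\<^esub> (f y \<ominus>\<^bsub>N\<^esub> g y)"
      by algebra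
    then show "f (x \<oplus>\<^bsub>M\<^esub> y) \<ominus>\<^bsub>N\<^esub> g (x \<oplus>\<^bsub>M\<^esub> y) = f x \<ominus>\<^bsub>N\<^esub> g x \<oplus>\<^bsub>N\<^esub> (f y \<ominus>\<^bsub>N\<^esub> g y)"
      using \<open>x \<in> carrier M\<close> \<open>y \<in> carrier M\<close> assms by (simp add: mod_hom_add)
  next
    fix a x assume *: "a \<in> carrier R" "x \<in> carrier M"
    then have "f x \<in> carrier N" "g x \<in> carrier N"
      using assms by (auto simp: mod_hom_closed)
    then have "a \<odot>\<^bsub>N\<^esub> f x \<ominus>\<^bsub>N\<^esub> a \<odot>\<^bsub>N\<^esub> g x = a \<odot>\<^bsub>N\<^esub> (f x \<ominus>\<^bsub>N\<^esub> g x)"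
      using *(1) by algebra
    then show "f (a \<odot>\<^bsub>M\<^esub> x) \<ominus>\<^bsub>N\<^esub> g (a \<odot>\<^bsub>M\<^esub> x) = a \<odot>\<^bsub>N\<^esub> (f x \<ominus>\<^bsub>N\<^esub> g x)"
      using * assms by (simp add: mod_hom_smult)
  qed (use assms in \<open>auto simp: mod_hom_closed\<close>)
qed

lemma module_restrict:
  "module R M \<Longrightarrow> submodule H R M \<Longrightarrow> module R (M\<lparr>carrier := H\<rparr>)"
  by (rule submodule.submodule_is_module)

lemma submodule_preimage:
  assumes "module R M" "module R N" "h \<in> mod_hom R M N" "submodule H R N"
  shows "submodule {x \<in> carrier M. h x \<in> H} R M"
proof -
  interpret M: module R M by fact
  interpret N: module R N by fact
  note E = N.submoduleE[OF assms(4)]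
  have "\<zero>\<^bsub>N\<^esub> \<in> H" using subgroup.one_closed[OF submodule.axioms(1)[OF assms(4)]] by simp
  then show ?thesis using assms E
    by (intro M.submoduleI)
      (auto simp: mod_hom_zero mod_hom_minus mod_hom_add mod_hom_smult)
qed

lemma submodule_image:
  assumes "module R M" "module R N" "h \<in> mod_hom R M N" "submodule H R M"
  shows "submodule (h ` H) R N"
proof -
  interpret M: module R M by fact
  interpret N: module R N by fact
  note E = M.submoduleE[OF assms(4)]
  have z: "\<zero>\<^bsub>M\<^esub> \<in> H" using subgroup.one_closed[OF submodule.axioms(1)[OF assms(4)]] by simp
  show ?thesis
  proof (rule N.submoduleI)
    show "h ` H \<subseteq> carrier N" using E(1) mod_hom_closed[OF assms(3)] by auto
    show "\<zero>\<^bsub>N\<^esub> \<in> h ` H" using z mod_hom_zero[OF assms(1-3)] by (metis imageI)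
    fix a assume "a \<in> h ` H"
    then obtain x where x: "x \<in> H" "a = h x" by auto
    then show "\<ominus>\<^bsub>N\<^esub> a \<in> h ` H"
      using mod_hom_minus[OF assms(1-3), of x] E(1,3) by (metis imageI subsetD)
    {
      fix b assume "b \<in> h ` H"
      then obtain y where y: "y \<in> H" "b = h y" by auto
      then show "a \<oplus>\<^bsub>N\<^esub> b \<in> h ` H"
        using mod_hom_add[OF assms(3), of x y] x E(1,5) by (metis imageI subsetD)
    next
      fix c assume "c \<in> carrier R"
      then show "c \<odot>\<^bsub>N\<^esub> a \<in> h ` H"
        using mod_hom_smult[OF assms(3), of c x] x E(1,4) by (metis imageI subsetD)
    }
  qed
qed

lemma submodule_zero: assumes "module R M" shows "submodule {\<zero>\<^bsub>M\<^esub>} R M"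
proof -
  interpret module R M by fact
  show ?thesis by (rule submoduleI) auto
qed

lemma submodule_ker:
  assumes "module R M" "module R N" "h \<in> mod_hom R M N"
  shows "submodule {x \<in> carrier M. h x = \<zero>\<^bsub>N\<^esub>} R M"
  using submodule_preimage[OF assms submodule_zero[OF assms(2)]] by simp

lemma submodule_inter:
  assumes "module R M" "submodule H R M" "submodule K R M"
  shows "submodule (H \<inter> K) R M"
proof -
  interpret M: module R M by fact
  note E = M.submoduleE[OF assms(2)] M.submoduleE[OF assms(3)]
  have "\<zero>\<^bsub>M\<^esub> \<in> H" "\<zero>\<^bsub>M\<^esub> \<in> K"
    using subgroup.one_closed[OF submodule.axioms(1)] assms by fastforce+
  then show ?thesis using E by (intro M.submoduleI) auto
qed

section \<open>Constructions of modules\<close>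

lemma self_module_simps [simp]:
  "carrier (self_module R) = carrier R" "add (self_module R) = add R"
  "zero (self_module R) = zero R" "smult (self_module R) = mult R"
  by (simp_all add: self_module_def)

lemma module_self: assumes "cring R" shows "module R (self_module R)"
proof -
  interpret cring R by fact
  show ?thesis by (rule module_fromI) (auto simp: assms a_ac m_assoc l_distr r_distr)
qed

lemma dsum_simps [simp]:
  "carrier (dsum M I) = {f. (\<forall>i \<in> I. f i \<in> carrier M) \<and> (\<forall>i. i \<notin> I \<longrightarrow> f i = \<zero>\<^bsub>M\<^esub>)
      \<and> finite {i. f i \<noteq> \<zero>\<^bsub>M\<^esub>}}"
  "add (dsum M I) = (\<lambda>f g i. f i \<oplus>\<^bsub>M\<^esub> g i)"
  "zero (dsum M I) = (\<lambda>_. \<zero>\<^bsub>M\<^esub>)"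
  "smult (dsum M I) = (\<lambda>a f i. a \<odot>\<^bsub>M\<^esub> f i)"
  by (simp_all add: dsum_def)

lemma carrier_dsum_finite:
  "finite I \<Longrightarrow> f \<in> carrier (dsum M I) \<longleftrightarrow>
    (\<forall>i \<in> I. f i \<in> carrier M) \<and> (\<forall>i. i \<notin> I \<longrightarrow> f i = \<zero>\<^bsub>M\<^esub>)"
  by (auto intro: finite_subset[of _ I])

lemma dsum_closed:
  assumes "module R M" "f \<in> carrier (dsum M I)" shows "f i \<in> carrier M"
proof -
  interpret module R M by fact
  show ?thesis using assms(2) by (cases "i \<in> I") auto
qed

lemma module_dsum: assumes "module R M" shows "module R (dsum M I)"
proof -
  interpret module R M by fact
  note c = dsum_closed[OF assms]
  have fin: "finite {i. f i \<noteq> \<zero>\<^bsub>M\<^esub>}" if "f \<in> carrier (dsum M I)" for f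
    using that by simp
  have add: "(\<lambda>i. x i \<oplus>\<^bsub>M\<^esub> y i) \<in> carrier (dsum M I)"
    if "x \<in> carrier (dsum M I)" "y \<in> carrier (dsum M I)" for x y
  proof -
    have "finite {i. x i \<oplus>\<^bsub>M\<^esub> y i \<noteq> \<zero>\<^bsub>M\<^esub>}"
      by (rule finite_subset[OF _ finite_UnI[OF fin[OF that(1)] fin[OF that(2)]]]) auto
    then show ?thesis using that by auto
  qed
  have smult: "(\<lambda>i. a \<odot>\<^bsub>M\<^esub> x i) \<in> carrier (dsum M I)"
    if "x \<in> carrier (dsum M I)" "a \<in> carrier R" for x a
  proof -
    have "finite {i. a \<odot>\<^bsub>M\<^esub> x i \<noteq> \<zero>\<^bsub>M\<^esub>}"
      by (rule finite_subset[OF _ fin[OF that(1)]]) (use that in auto)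
    then show ?thesis using that by auto
  qed
  show ?thesis
  proof (rule module_fromI)
    show "cring R" by (rule R.is_cring)
  qed (simp_all add: add smult del: dsum_simps(1),
      simp_all add: c smult_assoc1 smult_l_distr smult_r_distr M.a_ac del: dsum_simps(1),
      simp_all)
qed

text \<open>A binary sum whose factors may have different element types, as cones and pullbacks
  need; \<open>dsum\<close> only covers copies of one module.\<close>

definition prod_mod :: "('a, 'm, 'c) module_scheme \<Rightarrow> ('a, 'n, 'd) module_scheme \<Rightarrow> ('a, 'm \<times> 'n) module"
  where "prod_mod M N = \<lparr>carrier = carrier M \<times> carrier N, mult = undefined, one = undefined,
    zero = (\<zero>\<^bsub>M\<^esub>, \<zero>\<^bsub>N\<^esub>), add = (\<lambda>x y. (fst x \<oplus>\<^bsub>M\<^esub> fst y, snd x \<oplus>\<^bsub>N\<^esub> snd y)),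
    smult = (\<lambda>a x. (a \<odot>\<^bsub>M\<^esub> fst x, a \<odot>\<^bsub>N\<^esub> snd x))\<rparr>"

lemma prod_mod_simps [simp]:
  "carrier (prod_mod M N) = carrier M \<times> carrier N"
  "zero (prod_mod M N) = (\<zero>\<^bsub>M\<^esub>, \<zero>\<^bsub>N\<^esub>)"
  "x \<oplus>\<^bsub>prod_mod M N\<^esub> y = (fst x \<oplus>\<^bsub>M\<^esub> fst y, snd x \<oplus>\<^bsub>N\<^esub> snd y)"
  "a \<odot>\<^bsub>prod_mod M N\<^esub> x = (a \<odot>\<^bsub>M\<^esub> fst x, a \<odot>\<^bsub>N\<^esub> snd x)"
  by (simp_all add: prod_mod_def)

lemma module_prod: assumes "module R M" "module R N" shows "module R (prod_mod M N)"
proof -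
  interpret M: module R M by fact
  interpret N: module R N by fact
  show ?thesis
    by (rule module_fromI)
      (auto simp: M.R.is_cring M.M.a_ac N.M.a_ac
        M.smult_l_distr N.smult_l_distr M.smult_r_distr N.smult_r_distr
        M.smult_assoc1 N.smult_assoc1)
qed

lemma mod_hom_fst: "fst \<in> mod_hom R (prod_mod M N) M"
  and mod_hom_snd: "snd \<in> mod_hom R (prod_mod M N) N"
  by (auto intro!: mod_homI)

lemma mod_hom_pair: "f \<in> mod_hom R L M \<Longrightarrow> g \<in> mod_hom R L N \<Longrightarrow>
  (\<lambda>x. (f x, g x)) \<in> mod_hom R L (prod_mod M N)"
  by (auto intro!: mod_homI simp: mod_hom_closed mod_hom_add mod_hom_smult)

lemma mod_hom_coord: "i \<in> I \<Longrightarrow> (\<lambda>f. f i) \<in> mod_hom R (dsum M I) M"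
  by (auto intro!: mod_homI)

lemma mod_hom_inject:
  assumes "module R M" "i \<in> I"
  shows "(\<lambda>m j. if j = i then m else \<zero>\<^bsub>M\<^esub>) \<in> mod_hom R M (dsum M I)"
proof -
  interpret module R M by fact
  have "finite {j. (if j = i then m else \<zero>\<^bsub>M\<^esub>) \<noteq> \<zero>\<^bsub>M\<^esub>}" for m
    by (rule finite_subset[of _ "{i}"]) auto
  then show ?thesis using assms(2) by (auto intro!: mod_homI)
qed

text \<open>The module structure pushed forward along a map \<open>p\<close> whose fibres are compatible with the
  operations: it serves both to rename elements (\<open>p\<close> injective) and to form quotients
  (\<open>p\<close> choosing representatives).\<close>

definition img_mod :: "('a, 'm, 'c) module_scheme \<Rightarrow> ('m \<Rightarrow> 'n) \<Rightarrow> ('a, 'n) module"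
  where "img_mod M p = \<lparr>carrier = p ` carrier M, mult = undefined, one = undefined,
    zero = p \<zero>\<^bsub>M\<^esub>,
    add = (\<lambda>u v. p (inv_into (carrier M) p u \<oplus>\<^bsub>M\<^esub> inv_into (carrier M) p v)),
    smult = (\<lambda>a u. p (a \<odot>\<^bsub>M\<^esub> inv_into (carrier M) p u))\<rparr>"

lemma img_mod_module:
  assumes M: "module R M"
    and add: "\<And>x x' y y'. x \<in> carrier M \<Longrightarrow> x' \<in> carrier M \<Longrightarrow> y \<in> carrier M \<Longrightarrow> y' \<in> carrier M \<Longrightarrow>
      p x = p x' \<Longrightarrow> p y = p y' \<Longrightarrow> p (x \<oplus>\<^bsub>M\<^esub> y) = p (x' \<oplus>\<^bsub>M\<^esub> y')"
    and smult: "\<And>a x x'. a \<in> carrier R \<Longrightarrow> x \<in> carrier M \<Longrightarrow> x' \<in> carrier M \<Longrightarrow>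
      p x = p x' \<Longrightarrow> p (a \<odot>\<^bsub>M\<^esub> x) = p (a \<odot>\<^bsub>M\<^esub> x')"
  shows "module R (img_mod M p)" and "p \<in> mod_hom R M (img_mod M p)"
    and "p ` carrier M = carrier (img_mod M p)"
proof -
  interpret module R M by fact
  have inv: "inv_into (carrier M) p (p x) \<in> carrier M" "p (inv_into (carrier M) p (p x)) = p x"
    if "x \<in> carrier M" for x
    using that by (auto intro: inv_into_into f_inv_into_f)
  have a: "p x \<oplus>\<^bsub>img_mod M p\<^esub> p y = p (x \<oplus>\<^bsub>M\<^esub> y)" if "x \<in> carrier M" "y \<in> carrier M" for x y
    unfolding img_mod_def using that inv by (auto intro!: add)
  have s: "a \<odot>\<^bsub>img_mod M p\<^esub> p x = p (a \<odot>\<^bsub>M\<^esub> x)" if "x \<in> carrier M" "a \<in> carrier R" for x a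
    unfolding img_mod_def using that inv by (auto intro!: smult)
  have c: "carrier (img_mod M p) = p ` carrier M" and z: "\<zero>\<^bsub>img_mod M p\<^esub> = p \<zero>\<^bsub>M\<^esub>"
    by (simp_all add: img_mod_def)
  show "module R (img_mod M p)"
    by (rule module_fromI)
      (auto simp: R.is_cring c z a s smult_l_distr smult_r_distr smult_assoc1 M.a_ac)
  show "p \<in> mod_hom R M (img_mod M p)"
    by (rule mod_homI) (auto simp: a s c)
  show "p ` carrier M = carrier (img_mod M p)" by (simp add: c)
qed

text \<open>Each coset is replaced by a chosen representative, so the quotient keeps the element
  type of \<open>M\<close>. This keeps cokernels inside the universe
  \<open>nat => 'a\<close>.\<close>

lemma ex_quotient:
  fixes M :: "('a, 'm, 'c) module_scheme"
  assumes M: "module R M" and H: "submodule H R M"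
  shows "\<exists>(Q :: ('a, 'm) module) p. module R Q \<and> p \<in> mod_hom R M Q \<and> p ` carrier M = carrier Q
    \<and> (\<forall>x \<in> carrier M. p x = \<zero>\<^bsub>Q\<^esub> \<longleftrightarrow> x \<in> H)"
proof -
  interpret module R M by fact
  note E = submoduleE[OF H]
  have zH: "\<zero>\<^bsub>M\<^esub> \<in> H" using subgroup.one_closed[OF submodule.axioms(1)[OF H]] by simp
  define p where "p x = (SOME y. y \<in> carrier M \<and> x \<ominus>\<^bsub>M\<^esub> y \<in> H)" for x
  have p: "p x \<in> carrier M \<and> x \<ominus>\<^bsub>M\<^esub> p x \<in> H" if "x \<in> carrier M" for x
    unfolding p_def by (rule someI[of _ x]) (simp add: that zH M.minus_eq M.r_neg)
  have eq: "p x = p y \<longleftrightarrow> x \<ominus>\<^bsub>M\<^esub> y \<in> H" if xy: "x \<in> carrier M" "y \<in> carrier M" for x y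
  proof
    assume "p x = p y"
    then have "x \<ominus>\<^bsub>M\<^esub> p x \<in> H" "\<ominus>\<^bsub>M\<^esub> (y \<ominus>\<^bsub>M\<^esub> p x) \<in> H" "p x \<in> carrier M"
      using p[OF xy(1)] p[OF xy(2)] E(3) by auto
    moreover have "x \<ominus>\<^bsub>M\<^esub> p x \<oplus>\<^bsub>M\<^esub> \<ominus>\<^bsub>M\<^esub> (y \<ominus>\<^bsub>M\<^esub> p x) = x \<ominus>\<^bsub>M\<^esub> y"
      using xy \<open>p x \<in> carrier M\<close> by algebra
    ultimately show "x \<ominus>\<^bsub>M\<^esub> y \<in> H" using E(5) by metis
  next
    assume h: "x \<ominus>\<^bsub>M\<^esub> y \<in> H"
    \<comment> \<open>Congruent elements satisfy the same condition under \<open>SOME\<close>, so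
      the same representative is chosen for both.\<close>
    have "x \<ominus>\<^bsub>M\<^esub> z \<in> H \<longleftrightarrow> y \<ominus>\<^bsub>M\<^esub> z \<in> H" if z: "z \<in> carrier M" for z
    proof -
      have "x \<ominus>\<^bsub>M\<^esub> z = x \<ominus>\<^bsub>M\<^esub> y \<oplus>\<^bsub>M\<^esub> (y \<ominus>\<^bsub>M\<^esub> z)" "y \<ominus>\<^bsub>M\<^esub> z = \<ominus>\<^bsub>M\<^esub> (x \<ominus>\<^bsub>M\<^esub> y) \<oplus>\<^bsub>M\<^esub> (x \<ominus>\<^bsub>M\<^esub> z)"
        using xy z by algebra+
      then show ?thesis using h E(3,5) by metis
    qed
    then show "p x = p y" unfolding p_def by metis
  qed
  have padd: "p (x \<oplus>\<^bsub>M\<^esub> y) = p (x' \<oplus>\<^bsub>M\<^esub> y')"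
    if c: "x \<in> carrier M" "x' \<in> carrier M" "y \<in> carrier M" "y' \<in> carrier M"
      and "p x = p x'" "p y = p y'" for x x' y y'
  proof -
    have "x \<ominus>\<^bsub>M\<^esub> x' \<in> H" "y \<ominus>\<^bsub>M\<^esub> y' \<in> H" using that by (simp_all add: eq)
    moreover have "x \<ominus>\<^bsub>M\<^esub> x' \<oplus>\<^bsub>M\<^esub> (y \<ominus>\<^bsub>M\<^esub> y') = (x \<oplus>\<^bsub>M\<^esub> y) \<ominus>\<^bsub>M\<^esub> (x' \<oplus>\<^bsub>M\<^esub> y')" using c by algebra
    ultimately show ?thesis using c E(5) eq by (metis M.a_closed)
  qed
  have psmult: "p (a \<odot>\<^bsub>M\<^esub> x) = p (a \<odot>\<^bsub>M\<^esub> x')"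
    if c: "a \<in> carrier R" "x \<in> carrier M" "x' \<in> carrier M" and "p x = p x'" for a x x'
  proof -
    have "a \<odot>\<^bsub>M\<^esub> (x \<ominus>\<^bsub>M\<^esub> x') \<in> H" using that E(4) by (simp add: eq)
    moreover have "a \<odot>\<^bsub>M\<^esub> (x \<ominus>\<^bsub>M\<^esub> x') = a \<odot>\<^bsub>M\<^esub> x \<ominus>\<^bsub>M\<^esub> a \<odot>\<^bsub>M\<^esub> x'" using c by algebra
    ultimately show ?thesis using c by (simp add: eq)
  qed
  note img_mod_module[OF M padd psmult]
  moreover have "\<forall>x \<in> carrier M. p x = \<zero>\<^bsub>img_mod M p\<^esub> \<longleftrightarrow> x \<in> H"
  proof
    fix x assume x: "x \<in> carrier M"
    then have "x \<ominus>\<^bsub>M\<^esub> \<zero>\<^bsub>M\<^esub> = x" by algebra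
    then show "p x = \<zero>\<^bsub>img_mod M p\<^esub> \<longleftrightarrow> x \<in> H" using x eq[of x "\<zero>\<^bsub>M\<^esub>"] by (simp add: img_mod_def)
  qed
  ultimately show ?thesis by blast
qed

lemma ex_transport:
  assumes M: "module R M" and inj: "inj_on \<phi> (carrier M)"
  shows "module R (img_mod M \<phi>) \<and> \<phi> \<in> mod_hom R M (img_mod M \<phi>) \<and>
    inv_into (carrier M) \<phi> \<in> mod_hom R (img_mod M \<phi>) M"
proof -
  interpret module R M by fact
  have *: "module R (img_mod M \<phi>)" "\<phi> \<in> mod_hom R M (img_mod M \<phi>)"
    "\<phi> ` carrier M = carrier (img_mod M \<phi>)"
    by (rule_tac [!] img_mod_module[OF M]) (auto dest: inj_onD[OF inj])
  moreover have "inv_into (carrier M) \<phi> \<in> mod_hom R (img_mod M \<phi>) M"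
    using inj by (intro mod_homI) (auto simp: img_mod_def)
  ultimately show ?thesis by simp
qed


section \<open>Generation and noetherian modules\<close>

text \<open>Adding one multiple of a generator at a time turns arguments about linear combinations
  into inductions; \<open>finitely_generated_iff\<close> returns to finite sums.\<close>

inductive_set mspan ::
  "('a, 'r) ring_scheme \<Rightarrow> ('a, 'm, 'c) module_scheme \<Rightarrow> 'm set \<Rightarrow> 'm set"
  for R M S where
  zero: "\<zero>\<^bsub>M\<^esub> \<in> mspan R M S"
| step: "s \<in> S \<Longrightarrow> c \<in> carrier R \<Longrightarrow> x \<in> mspan R M S \<Longrightarrow> c \<odot>\<^bsub>M\<^esub> s \<oplus>\<^bsub>M\<^esub> x \<in> mspan R M S"

lemma mspan_closed:
  assumes "module R M" "S \<subseteq> carrier M" "x \<in> mspan R M S" shows "x \<in> carrier M"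
proof -
  interpret module R M by fact
  show ?thesis using assms(3) by induct (use assms(2) in auto)
qed

lemma mspan_mono: "x \<in> mspan R M S \<Longrightarrow> S \<subseteq> T \<Longrightarrow> x \<in> mspan R M T"
  by (induct rule: mspan.induct) (auto intro: mspan.intros)

lemma mspan_add:
  assumes "module R M" "S \<subseteq> carrier M" "x \<in> mspan R M S" "y \<in> mspan R M S"
  shows "x \<oplus>\<^bsub>M\<^esub> y \<in> mspan R M S"
proof -
  interpret module R M by fact
  have y: "y \<in> carrier M" using mspan_closed assms by metis
  show ?thesis using assms(3)
  proof induct
    case zero then show ?case using assms(4) y by simp
  next
    case (step s c x)
    then have "x \<in> carrier M" "s \<in> carrier M" using mspan_closed assms by (metis, auto)
    then have "c \<odot>\<^bsub>M\<^esub> s \<oplus>\<^bsub>M\<^esub> x \<oplus>\<^bsub>M\<^esub> y = c \<odot>\<^bsub>M\<^esub> s \<oplus>\<^bsub>M\<^esub> (x \<oplus>\<^bsub>M\<^esub> y)"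
      using step(2) y by algebra
    then show ?case using step by (auto intro: mspan.step)
  qed
qed

lemma mspan_smult:
  assumes "module R M" "S \<subseteq> carrier M" "x \<in> mspan R M S" "a \<in> carrier R"
  shows "a \<odot>\<^bsub>M\<^esub> x \<in> mspan R M S"
proof -
  interpret module R M by fact
  show ?thesis using assms(3)
  proof induct
    case zero then show ?case using assms(4) by (simp add: mspan.zero)
  next
    case (step s c x)
    then have "x \<in> carrier M" "s \<in> carrier M" using mspan_closed assms by (metis, auto)
    then have "a \<odot>\<^bsub>M\<^esub> (c \<odot>\<^bsub>M\<^esub> s \<oplus>\<^bsub>M\<^esub> x) = (a \<otimes>\<^bsub>R\<^esub> c) \<odot>\<^bsub>M\<^esub> s \<oplus>\<^bsub>M\<^esub> a \<odot>\<^bsub>M\<^esub> x"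
      using step(2) assms(4) by (simp add: smult_r_distr smult_assoc1)
    then show ?case using step assms(4) by (auto intro: mspan.step)
  qed
qed

lemma mspan_base:
  assumes "module R M" "S \<subseteq> carrier M" "x \<in> S" shows "x \<in> mspan R M S"
proof -
  interpret module R M by fact
  have "\<one>\<^bsub>R\<^esub> \<odot>\<^bsub>M\<^esub> x \<oplus>\<^bsub>M\<^esub> \<zero>\<^bsub>M\<^esub> = x" using assms by auto
  then show ?thesis using mspan.step[OF assms(3) R.one_closed mspan.zero] by metis
qed

lemma submodule_mspan:
  assumes "module R M" "S \<subseteq> carrier M" shows "submodule (mspan R M S) R M"
proof -
  interpret module R M by fact
  show ?thesis
  proof (rule submoduleI)
    fix x assume x: "x \<in> mspan R M S"
    then have "(\<ominus>\<^bsub>R\<^esub> \<one>\<^bsub>R\<^esub>) \<odot>\<^bsub>M\<^esub> x = \<ominus>\<^bsub>M\<^esub> x" using mspan_closed[OF assms] by (simp add: smult_l_minus)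
    then show "\<ominus>\<^bsub>M\<^esub> x \<in> mspan R M S" using mspan_smult[OF assms x, of "\<ominus>\<^bsub>R\<^esub> \<one>\<^bsub>R\<^esub>"] by simp
  qed (use mspan_closed[OF assms] mspan_add[OF assms] mspan_smult[OF assms] mspan.zero in blast)+
qed

lemma mspan_least:
  assumes "module R M" "submodule H R M" "S \<subseteq> H" "x \<in> mspan R M S" shows "x \<in> H"
proof -
  interpret module R M by fact
  have "\<zero>\<^bsub>M\<^esub> \<in> H" using subgroup.one_closed[OF submodule.axioms(1)[OF assms(2)]] by simp
  with assms(4,3) show ?thesis
    by (induct) (use submoduleE[OF assms(2)] in auto)
qed

lemma finsum_in_mspan:
  assumes "module R M" "S \<subseteq> carrier M" "finite T" "T \<subseteq> S" "c \<in> S \<rightarrow> carrier R"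
  shows "(\<Oplus>\<^bsub>M\<^esub>s\<in>T. c s \<odot>\<^bsub>M\<^esub> s) \<in> mspan R M S"
proof -
  interpret module R M by fact
  show ?thesis using assms(3,4)
  proof induct
    case empty then show ?case by (simp add: mspan.zero)
  next
    case (insert s T)
    then have "(\<Oplus>\<^bsub>M\<^esub>s\<in>insert s T. c s \<odot>\<^bsub>M\<^esub> s) = c s \<odot>\<^bsub>M\<^esub> s \<oplus>\<^bsub>M\<^esub> (\<Oplus>\<^bsub>M\<^esub>s\<in>T. c s \<odot>\<^bsub>M\<^esub> s)"
      using assms(2,5) by (intro M.finsum_insert) auto
    then show ?case using insert assms(5) by (auto intro: mspan.step)
  qed
qed

lemma mspan_finsum:
  assumes "module R M" "finite S" "S \<subseteq> carrier M" "x \<in> mspan R M S"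
  shows "\<exists>c \<in> S \<rightarrow> carrier R. x = (\<Oplus>\<^bsub>M\<^esub>s\<in>S. c s \<odot>\<^bsub>M\<^esub> s)"
proof -
  interpret module R M by fact
  show ?thesis using assms(4)
  proof induct
    case zero
    have "(\<Oplus>\<^bsub>M\<^esub>s\<in>S. \<zero>\<^bsub>R\<^esub> \<odot>\<^bsub>M\<^esub> s) = (\<Oplus>\<^bsub>M\<^esub>s\<in>S. \<zero>\<^bsub>M\<^esub>)"
      using assms(3) by (intro M.finsum_cong') auto
    then show ?case by (intro bexI[of _ "\<lambda>_. \<zero>\<^bsub>R\<^esub>"]) auto
  next
    case (step t a x)
    then obtain c where c: "c \<in> S \<rightarrow> carrier R" "x = (\<Oplus>\<^bsub>M\<^esub>s\<in>S. c s \<odot>\<^bsub>M\<^esub> s)" by auto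
    \<comment> \<open>The new multiple of \<open>t\<close> is absorbed into the coefficient that
      \<open>t\<close> already has.\<close>
    let ?c = "c(t := a \<oplus>\<^bsub>R\<^esub> c t)" and ?T = "S - {t}"
    have S: "S = insert t ?T" "finite ?T" "t \<notin> ?T" using step(1) assms(2) by auto
    have t: "t \<in> carrier M" "c t \<in> carrier R" using step(1) c(1) assms(3) by auto
    have cl: "(\<Oplus>\<^bsub>M\<^esub>s\<in>?T. c s \<odot>\<^bsub>M\<^esub> s) \<in> carrier M"
      using c(1) assms(3) by (intro M.finsum_closed) auto
    have "(\<Oplus>\<^bsub>M\<^esub>s\<in>insert t ?T. ?c s \<odot>\<^bsub>M\<^esub> s) = ?c t \<odot>\<^bsub>M\<^esub> t \<oplus>\<^bsub>M\<^esub> (\<Oplus>\<^bsub>M\<^esub>s\<in>?T. ?c s \<odot>\<^bsub>M\<^esub> s)"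
      using S c(1) assms(3) t step(2) by (intro M.finsum_insert) (auto simp: subset_iff Pi_iff)
    also have "(\<Oplus>\<^bsub>M\<^esub>s\<in>?T. ?c s \<odot>\<^bsub>M\<^esub> s) = (\<Oplus>\<^bsub>M\<^esub>s\<in>?T. c s \<odot>\<^bsub>M\<^esub> s)"
      using c(1) assms(3) by (intro M.finsum_cong') auto
    also have "?c t \<odot>\<^bsub>M\<^esub> t \<oplus>\<^bsub>M\<^esub> (\<Oplus>\<^bsub>M\<^esub>s\<in>?T. c s \<odot>\<^bsub>M\<^esub> s) =
        a \<odot>\<^bsub>M\<^esub> t \<oplus>\<^bsub>M\<^esub> (c t \<odot>\<^bsub>M\<^esub> t \<oplus>\<^bsub>M\<^esub> (\<Oplus>\<^bsub>M\<^esub>s\<in>?T. c s \<odot>\<^bsub>M\<^esub> s))"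
      using t cl step(2) by (simp add: smult_l_distr M.a_assoc)
    also have "c t \<odot>\<^bsub>M\<^esub> t \<oplus>\<^bsub>M\<^esub> (\<Oplus>\<^bsub>M\<^esub>s\<in>?T. c s \<odot>\<^bsub>M\<^esub> s) = (\<Oplus>\<^bsub>M\<^esub>s\<in>insert t ?T. c s \<odot>\<^bsub>M\<^esub> s)"
      using S c(1) assms(3) t by (intro M.finsum_insert[symmetric]) auto
    finally have "(\<Oplus>\<^bsub>M\<^esub>s\<in>S. ?c s \<odot>\<^bsub>M\<^esub> s) = a \<odot>\<^bsub>M\<^esub> t \<oplus>\<^bsub>M\<^esub> x"
      using S(1) c(2) by simp
    moreover have "?c \<in> S \<rightarrow> carrier R" using c(1) t step(2) by auto
    ultimately show ?case by metis
  qed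
qed

lemma finitely_generated_iff:
  assumes "module R M"
  shows "finitely_generated R M \<longleftrightarrow>
    (\<exists>S. finite S \<and> S \<subseteq> carrier M \<and> carrier M \<subseteq> mspan R M S)"
proof
  assume "finitely_generated R M"
  then obtain S where S: "finite S" "S \<subseteq> carrier M"
    "\<forall>x \<in> carrier M. \<exists>c \<in> S \<rightarrow> carrier R. x = (\<Oplus>\<^bsub>M\<^esub>s\<in>S. c s \<odot>\<^bsub>M\<^esub> s)"
    unfolding finitely_generated_def by blast
  have "carrier M \<subseteq> mspan R M S"
  proof
    fix x assume "x \<in> carrier M"
    then obtain c where "c \<in> S \<rightarrow> carrier R" "x = (\<Oplus>\<^bsub>M\<^esub>s\<in>S. c s \<odot>\<^bsub>M\<^esub> s)" using S(3) by blast
    then show "x \<in> mspan R M S" using finsum_in_mspan[OF assms S(2) S(1) subset_refl] by simp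
  qed
  then show "\<exists>S. finite S \<and> S \<subseteq> carrier M \<and> carrier M \<subseteq> mspan R M S" using S by blast
next
  assume "\<exists>S. finite S \<and> S \<subseteq> carrier M \<and> carrier M \<subseteq> mspan R M S"
  then obtain S where "finite S" "S \<subseteq> carrier M" "carrier M \<subseteq> mspan R M S" by blast
  then show "finitely_generated R M"
    unfolding finitely_generated_def
    by (intro exI[of _ S] conjI ballI mspan_finsum[OF assms]) auto
qed

section \<open>Noetherian modules: quotients, submodules, finite sums\<close>

definition noeth :: "('a, 'r) ring_scheme \<Rightarrow> ('a, 'm, 'c) module_scheme \<Rightarrow> bool"
  where "noeth R M \<longleftrightarrow> module R M \<and>
    (\<forall>H. submodule H R M \<longrightarrow> (\<exists>S. finite S \<and> S \<subseteq> H \<and> H \<subseteq> mspan R M S))"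

lemma noeth_module: "noeth R M \<Longrightarrow> module R M"
  by (simp add: noeth_def)

lemma noeth_fg: "noeth R M \<Longrightarrow> finitely_generated R M"
  using module.carrier_is_submodule[of R M] finitely_generated_iff[of R M]
  unfolding noeth_def by blast

lemma mspan_hom:
  assumes "module R M" "module R N" "h \<in> mod_hom R M N" "T \<subseteq> carrier M" "x \<in> mspan R N (h ` T)"
  shows "\<exists>y \<in> mspan R M T. h y = x"
proof -
  interpret M: module R M by fact
  show ?thesis using assms(5)
  proof induct
    case zero then show ?case using mod_hom_zero[OF assms(1-3)] mspan.zero by metis
  next
    case (step s c x)
    then obtain y t where y: "y \<in> mspan R M T" "h y = x" "t \<in> T" "s = h t" by auto
    then have "h (c \<odot>\<^bsub>M\<^esub> t \<oplus>\<^bsub>M\<^esub> y) = c \<odot>\<^bsub>N\<^esub> s \<oplus>\<^bsub>N\<^esub> x"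
      using step(2) mspan_closed[OF assms(1,4) y(1)] assms(4)
      by (auto simp: mod_hom_add[OF assms(3)] mod_hom_smult[OF assms(3)])
    moreover have "c \<odot>\<^bsub>M\<^esub> t \<oplus>\<^bsub>M\<^esub> y \<in> mspan R M T" using y step by (auto intro: mspan.step)
    ultimately show ?case by metis
  qed
qed

text \<open>Generators of the preimage of a submodule are mapped to generators of that
  submodule.\<close>

lemma noeth_surj:
  assumes N: "noeth R M" "module R N" "h \<in> mod_hom R M N" and s: "h ` carrier M = carrier N"
  shows "noeth R N"
proof -
  have M: "module R M" using N by (simp add: noeth_def)
  interpret N: module R N by fact
  {
    fix H assume H: "submodule H R N"
    then obtain S where S: "finite S" "S \<subseteq> {x \<in> carrier M. h x \<in> H}"
      "{x \<in> carrier M. h x \<in> H} \<subseteq> mspan R M S"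
      using submodule_preimage[OF M N(2,3) H] N(1) unfolding noeth_def by blast
    have "H \<subseteq> mspan R N (h ` S)"
    proof
      fix y assume y: "y \<in> H"
      then obtain x where x: "x \<in> carrier M" "y = h x" using s N.submoduleE(1)[OF H] by auto
      have sub: "submodule {x \<in> carrier M. h x \<in> mspan R N (h ` S)} R M"
        using S(2) mod_hom_closed[OF N(3)] by (intro submodule_preimage[OF M N(2,3)] submodule_mspan[OF N(2)]) auto
      have "x \<in> {x \<in> carrier M. h x \<in> mspan R N (h ` S)}"
      proof (rule mspan_least[OF M sub])
        show "S \<subseteq> {x \<in> carrier M. h x \<in> mspan R N (h ` S)}"
          using S(2) mod_hom_closed[OF N(3)] by (auto intro!: mspan_base[OF N(2)])
        show "x \<in> mspan R M S" using S(3) x y by auto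
      qed
      then show "y \<in> mspan R N (h ` S)" using x by simp
    qed
    then have "\<exists>S. finite S \<and> S \<subseteq> H \<and> H \<subseteq> mspan R N S" using S by (intro exI[of _ "h ` S"]) auto
  }
  then show ?thesis using N(2) by (simp add: noeth_def)
qed

text \<open>Lifts of generators of the image of \<open>H\<close>, together with generators of the
  part of \<open>H\<close> inside the kernel, generate \<open>H\<close>. The last assumption
  concerns only submodules of the kernel, so that both injections and products are
  instances.\<close>

lemma noeth_ext:
  assumes M: "module R M" and N: "noeth R N" and h: "h \<in> mod_hom R M N"
    and ker: "\<And>H. submodule H R M \<Longrightarrow> (\<forall>x\<in>H. h x = \<zero>\<^bsub>N\<^esub>) \<Longrightarrow>
      \<exists>S. finite S \<and> S \<subseteq> H \<and> H \<subseteq> mspan R M S"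
  shows "noeth R M"
proof -
  have mN: "module R N" using N by (simp add: noeth_def)
  interpret M: module R M by fact
  interpret N: module R N by fact
  {
    fix H assume H: "submodule H R M"
    note E = M.submoduleE[OF H]
    obtain T where T: "finite T" "T \<subseteq> h ` H" "h ` H \<subseteq> mspan R N T"
      using submodule_image[OF M mN h H] N unfolding noeth_def by blast
    then obtain T' where T': "finite T'" "T' \<subseteq> H" "T = h ` T'" by (meson finite_subset_image)
    let ?K = "H \<inter> {x \<in> carrier M. h x = \<zero>\<^bsub>N\<^esub>}"
    obtain U where U: "finite U" "U \<subseteq> ?K" "?K \<subseteq> mspan R M U"
      using ker[OF submodule_inter[OF M H submodule_ker[OF M mN h]]] by auto
    have c: "T' \<subseteq> carrier M" "T' \<union> U \<subseteq> carrier M" using T' U E(1) by auto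
    have "H \<subseteq> mspan R M (T' \<union> U)"
    proof
      fix x assume x: "x \<in> H"
      then obtain y where y: "y \<in> mspan R M T'" "h y = h x"
        using mspan_hom[OF M mN h c(1), of "h x"] T(3) T'(3) by auto
      have yH: "y \<in> H" using mspan_least[OF M H T'(2) y(1)] .
      have xy: "x \<in> carrier M" "y \<in> carrier M" using x yH E(1) by auto
      have "h (x \<ominus>\<^bsub>M\<^esub> y) = \<zero>\<^bsub>N\<^esub>"
        using mod_hom_diff[OF M mN h xy] y(2) mod_hom_closed[OF h xy(2)]
        by (simp add: N.M.minus_eq N.M.r_neg)
      moreover have "x \<ominus>\<^bsub>M\<^esub> y \<in> H" using x yH E(3,5) by (simp add: M.M.minus_eq)
      ultimately have "x \<ominus>\<^bsub>M\<^esub> y \<in> mspan R M U" using U(3) xy by auto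
      then have "(x \<ominus>\<^bsub>M\<^esub> y) \<oplus>\<^bsub>M\<^esub> y \<in> mspan R M (T' \<union> U)"
        using y(1) by (intro mspan_add[OF M c(2)]) (auto elim: mspan_mono)
      moreover have "(x \<ominus>\<^bsub>M\<^esub> y) \<oplus>\<^bsub>M\<^esub> y = x" using xy by algebra
      ultimately show "x \<in> mspan R M (T' \<union> U)" by simp
    qed
    then have "\<exists>S. finite S \<and> S \<subseteq> H \<and> H \<subseteq> mspan R M S"
      using T' U by (intro exI[of _ "T' \<union> U"]) auto
  }
  then show ?thesis using M by (simp add: noeth_def)
qed

lemma noeth_inj:
  assumes M: "module R M" and N: "noeth R N" and h: "h \<in> mod_hom R M N"
    and inj: "inj_on h (carrier M)"
  shows "noeth R M"
proof (rule noeth_ext[OF M N h])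
  interpret M: module R M by fact
  fix H assume H: "submodule H R M" "\<forall>x\<in>H. h x = \<zero>\<^bsub>N\<^esub>"
  have "x = \<zero>\<^bsub>M\<^esub>" if "x \<in> H" for x
    using that H(2) M.submoduleE(1)[OF H(1)] mod_hom_zero[OF M noeth_module[OF N] h]
      inj_onD[OF inj, of x "\<zero>\<^bsub>M\<^esub>"] by auto
  then have "H \<subseteq> mspan R M {}" using mspan.zero[of M R "{}"] by auto
  then show "\<exists>S. finite S \<and> S \<subseteq> H \<and> H \<subseteq> mspan R M S" by blast
qed

text \<open>The kernel of \<open>fst\<close> is a copy of \<open>N\<close>, so the part inside the
  kernel takes its generators from the second components.\<close>

lemma noeth_prod:
  assumes M: "noeth R M" and N: "noeth R N"
  shows "noeth R (prod_mod M N)"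
proof (rule noeth_ext[OF module_prod[OF noeth_module[OF M] noeth_module[OF N]] M mod_hom_fst])
  note m = noeth_module[OF M] noeth_module[OF N]
  interpret M: module R M by fact
  interpret N: module R N by fact
  interpret P: module R "prod_mod M N" by (rule module_prod[OF m])
  fix H assume H: "submodule H R (prod_mod M N)" "\<forall>x\<in>H. fst x = \<zero>\<^bsub>M\<^esub>"
  obtain T where T: "finite T" "T \<subseteq> snd ` H" "snd ` H \<subseteq> mspan R N T"
    using submodule_image[OF P.module_axioms m(2) mod_hom_snd H(1)] N unfolding noeth_def by blast
  let ?i = "\<lambda>y. (\<zero>\<^bsub>M\<^esub>, y)"
  have i: "?i \<in> mod_hom R N (prod_mod M N)" by (rule mod_homI) auto
  have "?i ` T \<subseteq> H"
  proof
    fix z assume "z \<in> ?i ` T"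
    then obtain x where "x \<in> H" "z = (\<zero>\<^bsub>M\<^esub>, snd x)" using T(2) by auto
    then show "z \<in> H" using H(2) by (metis prod.collapse)
  qed
  moreover have "H \<subseteq> mspan R (prod_mod M N) (?i ` T)"
  proof
    fix x assume x: "x \<in> H"
    have sub: "submodule {y \<in> carrier N. ?i y \<in> mspan R (prod_mod M N) (?i ` T)} R N"
      using \<open>?i ` T \<subseteq> H\<close> P.submoduleE(1)[OF H(1)]
      by (intro submodule_preimage[OF m(2) P.module_axioms i] submodule_mspan[OF P.module_axioms]) auto
    have c: "?i ` T \<subseteq> carrier (prod_mod M N)" using \<open>?i ` T \<subseteq> H\<close> P.submoduleE(1)[OF H(1)] by blast
    have "snd x \<in> {y \<in> carrier N. ?i y \<in> mspan R (prod_mod M N) (?i ` T)}"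
    proof (rule mspan_least[OF m(2) sub])
      show "T \<subseteq> {y \<in> carrier N. ?i y \<in> mspan R (prod_mod M N) (?i ` T)}"
        using c by (auto intro!: mspan_base[OF P.module_axioms c])
      show "snd x \<in> mspan R N T" using T(3) x by auto
    qed
    then show "x \<in> mspan R (prod_mod M N) (?i ` T)" using H(2) x by (metis (lifting) mem_Collect_eq prod.collapse)
  qed
  ultimately show "\<exists>S. finite S \<and> S \<subseteq> H \<and> H \<subseteq> mspan R (prod_mod M N) S"
    using T(1) by blast
qed

lemma noeth_dsum:
  assumes M: "noeth R M" and fin: "finite I"
  shows "noeth R (dsum M I)"
  using fin
proof induct
  case empty
  have m: "module R (dsum M {})" by (rule module_dsum[OF noeth_module[OF M]])
  show ?case unfolding noeth_def
  proof (intro conjI allI impI m)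
    fix H assume "submodule H R (dsum M {})"
    then have "H \<subseteq> {\<zero>\<^bsub>dsum M {}\<^esub>}" using module.submoduleE(1)[OF m] by fastforce
    then have "H \<subseteq> mspan R (dsum M {}) {}" using mspan.zero[of "dsum M {}" R "{}"] by blast
    then show "\<exists>S. finite S \<and> S \<subseteq> H \<and> H \<subseteq> mspan R (dsum M {}) S" by blast
  qed
next
  case (insert j I)
  interpret module R M by (rule noeth_module[OF M])
  note c = carrier_dsum_finite[OF insert(1)] carrier_dsum_finite[OF finite.insertI[OF insert(1)]]
  \<comment> \<open>One more index amounts to a product with one more copy of \<open>M\<close>: the
    first component becomes the value at \<open>j\<close>.\<close>
  let ?h = "\<lambda>x. (snd x)(j := fst x)"
  have "?h \<in> mod_hom R (prod_mod M (dsum M I)) (dsum M (insert j I))"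
    by (rule mod_homI) (auto simp: c simp del: dsum_simps(1))
  moreover have "?h ` carrier (prod_mod M (dsum M I)) = carrier (dsum M (insert j I))"
  proof safe
    fix f assume f: "f \<in> carrier (dsum M (insert j I))"
    have "(f j, f(j := \<zero>\<^bsub>M\<^esub>)) \<in> carrier (prod_mod M (dsum M I))"
      using f insert(2) by (auto simp: c simp del: dsum_simps(1))
    moreover have "f = ?h (f j, f(j := \<zero>\<^bsub>M\<^esub>))" by auto
    ultimately show "f \<in> ?h ` carrier (prod_mod M (dsum M I))" by blast
  qed (auto simp: c simp del: dsum_simps(1))
  ultimately show ?case
    using noeth_surj[OF noeth_prod[OF M insert(3)] module_dsum[OF module_axioms]] by blast
qed

text \<open>Submodules of \<open>self_module R\<close> are ideals of \<open>R\<close>. A finite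
  generating set of the ideal also spans it, because the span is itself an ideal and the generated
  ideal is minimal.\<close>

lemma noeth_self:
  assumes "cring R" "noetherian_ring R" shows "noeth R (self_module R)"
  unfolding noeth_def
proof (intro conjI allI impI module_self[OF assms(1)])
  interpret R: cring R by fact
  interpret S: module R "self_module R" by (rule module_self[OF assms(1)])
  have id: "ideal H R" if "submodule H R (self_module R)" for H
  proof (rule idealI[OF R.ring_axioms])
    note E = S.submoduleE[OF that]
    have "subgroup H (add_monoid (self_module R))" using that by (rule submodule.axioms(1))
    then show "subgroup H (add_monoid R)"
      by (auto simp: subgroup_def m_inv_def)
    fix a x assume "a \<in> H" "x \<in> carrier R"
    then show "x \<otimes>\<^bsub>R\<^esub> a \<in> H" "a \<otimes>\<^bsub>R\<^esub> x \<in> H" using E(1) E(4)[of x a] by (auto simp: R.m_comm)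
  qed
  fix H assume H: "submodule H R (self_module R)"
  obtain A where A: "A \<subseteq> carrier R" "finite A" "H = Idl\<^bsub>R\<^esub> A"
    using noetherian_ring.finetely_gen[OF assms(2) id[OF H]] by auto
  have c: "A \<subseteq> carrier (self_module R)" using A by simp
  have "Idl\<^bsub>R\<^esub> A \<subseteq> mspan R (self_module R) A"
    by (intro R.genideal_minimal id submodule_mspan[OF S.module_axioms c])
      (use mspan_base[OF S.module_axioms c] in blast)
  then show "\<exists>S. finite S \<and> S \<subseteq> H \<and> H \<subseteq> mspan R (self_module R) S"
    using A R.genideal_self[OF A(1)] by blast
qed

section \<open>Finite free covers and the embedding into \<open>nat => 'a\<close>\<close>

lemma ex_free_cover:
  fixes M :: "('a, 'm, 'c) module_scheme"
  assumes R: "cring R" and M: "module R M" and fg: "finitely_generated R M"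
  shows "\<exists>(S :: 'm set) \<pi>. finite S \<and> \<pi> \<in> mod_hom R (dsum (self_module R) S) M \<and>
    \<pi> ` carrier (dsum (self_module R) S) = carrier M"
proof -
  interpret module R M by fact
  obtain S where S: "finite S" "S \<subseteq> carrier M"
    "\<And>x. x \<in> carrier M \<Longrightarrow> \<exists>c \<in> S \<rightarrow> carrier R. x = (\<Oplus>\<^bsub>M\<^esub>s\<in>S. c s \<odot>\<^bsub>M\<^esub> s)"
    using fg unfolding finitely_generated_def by blast
  note cd = carrier_dsum_finite[OF S(1)]
  let ?F = "dsum (self_module R) S" and ?h = "\<lambda>c. \<Oplus>\<^bsub>M\<^esub>s\<in>S. c s \<odot>\<^bsub>M\<^esub> s"
  have h: "?h \<in> mod_hom R ?F M"
  proof (rule mod_homI)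
    fix x y assume x: "x \<in> carrier ?F" and y: "y \<in> carrier ?F"
    show "?h x \<in> carrier M" using x S(2) by (intro M.finsum_closed) auto
    have "?h (x \<oplus>\<^bsub>?F\<^esub> y) = (\<Oplus>\<^bsub>M\<^esub>s\<in>S. x s \<odot>\<^bsub>M\<^esub> s \<oplus>\<^bsub>M\<^esub> y s \<odot>\<^bsub>M\<^esub> s)"
      using x y S(2) by (intro M.finsum_cong') (auto simp: smult_l_distr subset_iff)
    also have "\<dots> = ?h x \<oplus>\<^bsub>M\<^esub> ?h y" using x y S(2) by (intro M.finsum_addf) auto
    finally show "?h (x \<oplus>\<^bsub>?F\<^esub> y) = ?h x \<oplus>\<^bsub>M\<^esub> ?h y" .
    fix a assume a: "a \<in> carrier R"
    have "?h (a \<odot>\<^bsub>?F\<^esub> x) = (\<Oplus>\<^bsub>M\<^esub>s\<in>S. a \<odot>\<^bsub>M\<^esub> (x s \<odot>\<^bsub>M\<^esub> s))"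
      using x a S(2) by (intro M.finsum_cong') (auto simp: smult_assoc1 subset_iff)
    also have "\<dots> = a \<odot>\<^bsub>M\<^esub> ?h x"
      using x a S(1,2) by (intro finsum_smult_ldistr[symmetric]) auto
    finally show "?h (a \<odot>\<^bsub>?F\<^esub> x) = a \<odot>\<^bsub>M\<^esub> ?h x" .
  qed
  moreover have "?h ` carrier ?F = carrier M"
  proof safe
    fix x assume "x \<in> carrier M"
    then obtain c where c: "c \<in> S \<rightarrow> carrier R" "x = ?h c" by (elim bexE[OF S(3)])
    \<comment> \<open>\<open>c\<close> is arbitrary outside \<open>S\<close>, while elements of
      \<open>dsum\<close> vanish there; the truncation leaves the sum unchanged.\<close>
    let ?c = "\<lambda>s. if s \<in> S then c s else \<zero>\<^bsub>R\<^esub>"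
    have cl: "\<And>s. s \<in> S \<Longrightarrow> c s \<odot>\<^bsub>M\<^esub> s \<in> carrier M" using c(1) S(2) by (auto simp: Pi_iff subset_iff)
    have eq: "?h c = ?h ?c" by (rule M.finsum_cong'[OF refl]) (simp_all add: Pi_iff cl)
    have "?c \<in> carrier ?F" using c(1) by (auto simp: cd simp del: dsum_simps(1))
    then show "x \<in> ?h ` carrier ?F" by (rule rev_image_eqI) (rule trans[OF c(2) eq])
  qed (use mod_hom_closed[OF h] in blast)
  ultimately show ?thesis using S(1) by blast
qed

text \<open>The module is a quotient of a finite free module, which is noetherian as a finite sum of
  copies of \<open>R\<close>.\<close>

lemma fg_noeth:
  fixes M :: "('a, 'm, 'c) module_scheme"
  assumes "cring R" "noetherian_ring R" "module R M" "finitely_generated R M"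
  shows "noeth R M"
proof -
  obtain S :: "'m set" and \<pi> where "finite S" "\<pi> \<in> mod_hom R (dsum (self_module R) S) M"
    "\<pi> ` carrier (dsum (self_module R) S) = carrier M"
    using ex_free_cover[OF assms(1,3,4)] by blast
  then show ?thesis
    using noeth_surj[OF noeth_dsum[OF noeth_self[OF assms(1,2)]] assms(3)] by metis
qed

text \<open>The embedding is a choice of coefficient vectors with respect to a finite generating set.\<close>

lemma fg_embeds:
  fixes M :: "('a, 'm, 'c) module_scheme"
  assumes M: "module R M" and fg: "finitely_generated R M"
  shows "\<exists>\<phi> :: 'm \<Rightarrow> nat \<Rightarrow> 'a. inj_on \<phi> (carrier M)"
proof -
  interpret module R M by fact
  obtain S where S: "finite S" "S \<subseteq> carrier M"
    "\<And>x. x \<in> carrier M \<Longrightarrow> \<exists>c \<in> S \<rightarrow> carrier R. x = (\<Oplus>\<^bsub>M\<^esub>s\<in>S. c s \<odot>\<^bsub>M\<^esub> s)"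
    using fg unfolding finitely_generated_def by blast
  define c where "c x = (SOME c. c \<in> S \<rightarrow> carrier R \<and> x = (\<Oplus>\<^bsub>M\<^esub>s\<in>S. c s \<odot>\<^bsub>M\<^esub> s))" for x
  have c: "c x \<in> S \<rightarrow> carrier R" "x = (\<Oplus>\<^bsub>M\<^esub>s\<in>S. c x s \<odot>\<^bsub>M\<^esub> s)" if "x \<in> carrier M" for x
    using someI_ex[OF S(3)[OF that, unfolded Bex_def]] unfolding c_def by blast+
  obtain e where e: "S = e ` {i::nat. i < card S}"
    using finite_imp_nat_seg_image_inj_on[OF S(1)] by (metis card_Collect_less_nat card_image)
  \<comment> \<open>The index \<open>i\<close> runs through all of \<open>nat\<close>, but already
    the values with \<open>i\<close> below \<open>card S\<close> cover \<open>S\<close>, and the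
    coefficients on \<open>S\<close> determine \<open>x\<close>.\<close>
  have "inj_on (\<lambda>x i. c x (e i)) (carrier M)"
  proof (rule inj_onI)
    fix x y assume xy: "x \<in> carrier M" "y \<in> carrier M" and "(\<lambda>i. c x (e i)) = (\<lambda>i. c y (e i))"
    then have "c x s = c y s" if "s \<in> S" for s using that e by (metis imageE)
    then have "(\<Oplus>\<^bsub>M\<^esub>s\<in>S. c x s \<odot>\<^bsub>M\<^esub> s) = (\<Oplus>\<^bsub>M\<^esub>s\<in>S. c y s \<odot>\<^bsub>M\<^esub> s)"
      using c(1)[OF xy(2)] S(2) by (intro M.finsum_cong') auto
    then show "x = y" using c(2) xy by metis
  qed
  then show ?thesis by blast
qed


section \<open>Retracts and maps factoring through free modules\<close>

text \<open>Direct summands in terms of maps: this form composes directly and involves no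
  submodules. \<open>retract_direct_summand\<close> converts it once the summand is needed.\<close>

definition retract ::
  "('a, 'r) ring_scheme \<Rightarrow> ('a, 'm, 'c) module_scheme \<Rightarrow> ('a, 'n, 'd) module_scheme \<Rightarrow> bool"
  where "retract R M N \<longleftrightarrow> module R M \<and> module R N \<and>
    (\<exists>i \<in> mod_hom R M N. \<exists>p \<in> mod_hom R N M. \<forall>x \<in> carrier M. p (i x) = x)"

lemma retractI:
  "module R M \<Longrightarrow> module R N \<Longrightarrow> i \<in> mod_hom R M N \<Longrightarrow> p \<in> mod_hom R N M \<Longrightarrow>
    (\<And>x. x \<in> carrier M \<Longrightarrow> p (i x) = x) \<Longrightarrow> retract R M N"
  unfolding retract_def by blast

lemma retract_trans:
  assumes "retract R M N" "retract R N L" shows "retract R M L"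
proof -
  obtain i p where 1: "i \<in> mod_hom R M N" "p \<in> mod_hom R N M" "\<And>x. x \<in> carrier M \<Longrightarrow> p (i x) = x"
    using assms(1) unfolding retract_def by blast
  obtain j q where 2: "j \<in> mod_hom R N L" "q \<in> mod_hom R L N" "\<And>x. x \<in> carrier N \<Longrightarrow> q (j x) = x"
    using assms(2) unfolding retract_def by blast
  show ?thesis
    by (rule retractI[of R M L "\<lambda>x. j (i x)" "\<lambda>x. p (q x)"])
      (use assms 1 2 in \<open>auto simp: retract_def mod_hom_closed intro: mod_hom_comp\<close>)
qed

lemma mod_isomorphicI:
  "module R M \<Longrightarrow> module R N \<Longrightarrow> f \<in> mod_hom R M N \<Longrightarrow> bij_betw f (carrier M) (carrier N) \<Longrightarrow>
    mod_isomorphic R M N"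
  unfolding mod_isomorphic_def by blast

text \<open>The complement is the kernel of \<open>p\<close>: every \<open>y\<close> is the sum of
  \<open>i (p y)\<close> and \<open>y - i (p y)\<close>, and \<open>p\<close> is injective on the
  image of \<open>i\<close>.\<close>

lemma retract_direct_summand:
  assumes "retract R M N" shows "direct_summand R M N"
proof -
  obtain i p where i: "i \<in> mod_hom R M N" and p: "p \<in> mod_hom R N M"
    and pi: "\<And>x. x \<in> carrier M \<Longrightarrow> p (i x) = x"
    using assms unfolding retract_def by blast
  have m: "module R M" "module R N" using assms by (auto simp: retract_def)
  interpret M: module R M by fact
  interpret N: module R N by fact
  let ?A = "i ` carrier M" and ?B = "{y \<in> carrier N. p y = \<zero>\<^bsub>M\<^esub>}"
  have A: "submodule ?A R N" by (rule submodule_image[OF m i M.carrier_is_submodule])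
  have B: "submodule ?B R N" by (rule submodule_ker[OF m(2,1) p])
  have "?A <+>\<^bsub>N\<^esub> ?B = carrier N"
  proof safe
    fix y assume "y \<in> ?A <+>\<^bsub>N\<^esub> ?B"
    then show "y \<in> carrier N" using mod_hom_closed[OF i] by (auto simp: set_add_def')
  next
    fix y assume y: "y \<in> carrier N"
    let ?z = "i (p y)"
    have z: "?z \<in> carrier N" "p y \<in> carrier M" using y i p by (auto simp: mod_hom_closed)
    have "p (y \<ominus>\<^bsub>N\<^esub> ?z) = \<zero>\<^bsub>M\<^esub>"
      using z y pi by (simp add: mod_hom_diff[OF m(2,1) p] M.M.minus_eq M.M.r_neg)
    moreover have "?z \<oplus>\<^bsub>N\<^esub> (y \<ominus>\<^bsub>N\<^esub> ?z) = y" using y z(1) by algebra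
    ultimately show "y \<in> ?A <+>\<^bsub>N\<^esub> ?B" unfolding set_add_def' using y z
      by (auto intro!: bexI[of _ "y \<ominus>\<^bsub>N\<^esub> ?z"] bexI[of _ "p y"])
  qed
  moreover have "?A \<inter> ?B = {\<zero>\<^bsub>N\<^esub>}"
    using mod_hom_zero[OF m i] mod_hom_zero[OF m(2,1) p] pi by (auto simp: image_iff) (metis M.M.zero_closed)
  moreover have "mod_isomorphic R M (N\<lparr>carrier := ?A\<rparr>)"
  proof (rule mod_isomorphicI[OF m(1) module_restrict[OF m(2) A]])
    show "i \<in> mod_hom R M (N\<lparr>carrier := ?A\<rparr>)"
      using i by (intro mod_homI) (auto simp: mod_hom_add mod_hom_smult)
    show "bij_betw i (carrier M) (carrier (N\<lparr>carrier := ?A\<rparr>))"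
      using pi by (auto simp: bij_betw_def intro!: inj_on_inverseI[of _ p])
  qed
  ultimately show ?thesis unfolding direct_summand_def using A B m(2) by blast
qed

text \<open>A map factors through a finitely generated free module if and only if it is a finite sum of maps
  \<open>x \<mapsto> \<alpha>(x) s\<close>.  A module is finitely generated projective if and only if its identity is of this kind.\<close>

inductive fac ::
  "('a, 'r) ring_scheme \<Rightarrow> ('a, 'm, 'c) module_scheme \<Rightarrow> ('a, 'n, 'd) module_scheme \<Rightarrow> ('m \<Rightarrow> 'n) \<Rightarrow> bool"
  for R M N where
  zero: "(\<And>x. x \<in> carrier M \<Longrightarrow> \<theta> x = \<zero>\<^bsub>N\<^esub>) \<Longrightarrow> fac R M N \<theta>"
| step: "fac R M N \<theta> \<Longrightarrow> \<alpha> \<in> mod_hom R M (self_module R) \<Longrightarrow> s \<in> carrier N \<Longrightarrow>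
    (\<And>x. x \<in> carrier M \<Longrightarrow> \<theta>' x = \<alpha> x \<odot>\<^bsub>N\<^esub> s \<oplus>\<^bsub>N\<^esub> \<theta> x) \<Longrightarrow> fac R M N \<theta>'"

lemma fac_closed:
  assumes "module R M" "module R N" "fac R M N \<theta>" "x \<in> carrier M" shows "\<theta> x \<in> carrier N"
proof -
  interpret N: module R N by fact
  show ?thesis using assms(3,4)
  proof induct
    case (step \<theta> \<alpha> s \<theta>')
    then show ?case using mod_hom_closed[OF step(3)] by simp
  qed simp
qed

lemma fac_cong:
  assumes "module R N" "fac R M N \<theta>" "\<And>x. x \<in> carrier M \<Longrightarrow> \<theta>' x = \<theta> x"
  shows "fac R M N \<theta>'"
  using assms(2,3)
proof induct
  case (zero \<theta>) then show ?case by (intro fac.zero) simp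
next
  case (step \<theta> \<alpha> s \<theta>0)
  show ?case by (rule fac.step[OF step(1,3,4)]) (simp add: step(5,6))
qed

text \<open>Together with \<open>fac_post\<close> and \<open>fac_pre\<close>, this makes
  \<open>fac\<close> a two-sided ideal of homomorphisms; the factorizations below are assembled from
  these closure rules.\<close>

lemma fac_add:
  assumes "module R M" "module R N" "fac R M N \<theta>" "fac R M N \<eta>"
  shows "fac R M N (\<lambda>x. \<theta> x \<oplus>\<^bsub>N\<^esub> \<eta> x)"
proof -
  interpret N: module R N by fact
  show ?thesis using assms(3)
  proof induct
    case (zero \<theta>)
    then show ?case using assms(4)
      by (intro fac_cong[OF assms(2,4)]) (auto simp: fac_closed[OF assms(1,2)])
  next
    case (step \<theta> \<alpha> s \<theta>')
    show ?case
    proof (rule fac.step[OF step(2,3,4)])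
      fix x assume x: "x \<in> carrier M"
      then have "\<theta> x \<in> carrier N" "\<eta> x \<in> carrier N" "\<alpha> x \<odot>\<^bsub>N\<^esub> s \<in> carrier N"
        using step assms mod_hom_closed[OF step(3)] by (auto simp: fac_closed[OF assms(1,2)])
      then show "\<theta>' x \<oplus>\<^bsub>N\<^esub> \<eta> x = \<alpha> x \<odot>\<^bsub>N\<^esub> s \<oplus>\<^bsub>N\<^esub> (\<theta> x \<oplus>\<^bsub>N\<^esub> \<eta> x)"
        using step(5)[OF x] by (simp add: N.M.a_assoc)
    qed
  qed
qed

lemma fac_post:
  assumes "module R M" "module R N" "module R L" "fac R M N \<theta>" "h \<in> mod_hom R N L"
  shows "fac R M L (\<lambda>x. h (\<theta> x))"
  using assms(4)
proof induct
  case (zero \<theta>)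
  then show ?case by (intro fac.zero) (simp add: mod_hom_zero[OF assms(2,3,5)])
next
  case (step \<theta> \<alpha> s \<theta>')
  interpret N: module R N by fact
  show ?case
  proof (rule fac.step[OF step(2,3) mod_hom_closed[OF assms(5) step(4)]])
    fix x assume x: "x \<in> carrier M"
    then show "h (\<theta>' x) = \<alpha> x \<odot>\<^bsub>L\<^esub> h s \<oplus>\<^bsub>L\<^esub> h (\<theta> x)"
      using step mod_hom_closed[OF step(3) x] fac_closed[OF assms(1,2) step(1) x]
      by (simp add: mod_hom_add[OF assms(5)] mod_hom_smult[OF assms(5)])
  qed
qed

lemma fac_pre:
  assumes "fac R M N \<theta>" "h \<in> mod_hom R L M"
  shows "fac R L N (\<lambda>x. \<theta> (h x))"
  using assms(1)
proof induct
  case (zero \<theta>)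
  then show ?case by (intro fac.zero) (simp add: mod_hom_closed[OF assms(2)])
next
  case (step \<theta> \<alpha> s \<theta>')
  show ?case
    by (rule fac.step[OF step(2) mod_hom_comp[OF assms(2) step(3)] step(4)])
      (simp add: step mod_hom_closed[OF assms(2)])
qed

lemma fac_hom:
  assumes "module R M" "module R N" "fac R M N \<theta>" shows "\<theta> \<in> mod_hom R M N"
  using assms(3)
proof induct
  case (zero \<theta>)
  interpret M: module R M by fact
  interpret N: module R N by fact
  show ?case by (rule mod_homI) (auto simp: zero)
next
  case (step \<theta> \<alpha> s \<theta>')
  interpret M: module R M by fact
  interpret N: module R N by fact
  have "(\<lambda>x. \<alpha> x \<odot>\<^bsub>N\<^esub> s) \<in> mod_hom R M N"
    using step(3,4) mod_hom_closed[OF step(3)] mod_hom_add[OF step(3)] mod_hom_smult[OF step(3)]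
    by (intro mod_homI) (auto simp: N.smult_l_distr N.smult_assoc1)
  from mod_hom_plus[OF assms(2) this step(2)]
  have "(\<lambda>x. \<alpha> x \<odot>\<^bsub>N\<^esub> s \<oplus>\<^bsub>N\<^esub> \<theta> x) \<in> mod_hom R M N" .
  then show ?case by (auto simp: mod_hom_def step(5) Pi_iff)
qed

text \<open>Each vector \<open>s\<close> of the sum is replaced by a preimage \<open>w\<close>,
  while the functionals stay the same. This is the lifting property of the free module through which
  \<open>\<theta>\<close> factors.\<close>

lemma fac_lift:
  assumes M: "module R M" and N: "module R N" and F: "module R F"
    and \<pi>: "\<pi> \<in> mod_hom R F N" "\<pi> ` carrier F = carrier N" and \<theta>: "fac R M N \<theta>"
  shows "\<exists>f. fac R M F f \<and> (\<forall>x \<in> carrier M. \<pi> (f x) = \<theta> x)"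
  using \<theta>
proof induct
  case (zero \<theta>)
  then show ?case
    by (intro exI[of _ "\<lambda>_. \<zero>\<^bsub>F\<^esub>"]) (auto intro: fac.zero simp: mod_hom_zero[OF F N \<pi>(1)])
next
  case (step \<theta> \<alpha> s \<theta>')
  interpret F: module R F by fact
  obtain f where f: "fac R M F f" "\<forall>x \<in> carrier M. \<pi> (f x) = \<theta> x" using step(2) by blast
  obtain w where w: "w \<in> carrier F" "\<pi> w = s" using step(4)[folded \<pi>(2)] by blast
  have "fac R M F (\<lambda>x. \<alpha> x \<odot>\<^bsub>F\<^esub> w \<oplus>\<^bsub>F\<^esub> f x)" by (rule fac.step[OF f(1) step(3) w(1)]) simp
  moreover have "\<pi> (\<alpha> x \<odot>\<^bsub>F\<^esub> w \<oplus>\<^bsub>F\<^esub> f x) = \<theta>' x" if x: "x \<in> carrier M" for x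
    using x w f step(5)[OF x] mod_hom_closed[OF step(3) x] fac_closed[OF M F f(1) x]
    by (simp add: mod_hom_add[OF \<pi>(1)] mod_hom_smult[OF \<pi>(1)])
  ultimately show ?case by blast
qed

section \<open>Modules whose identity is in \<open>fac\<close>\<close>

lemma fac_self: assumes "cring R" shows "fac R (self_module R) (self_module R) (\<lambda>x. x)"
proof -
  interpret cring R by fact
  show ?thesis
    by (rule fac.step[of R _ _ "\<lambda>_. \<zero>\<^bsub>R\<^esub>" "\<lambda>x. x" "\<one>\<^bsub>R\<^esub>"]) (auto intro: fac.zero mod_hom_id)
qed

text \<open>The identity of the product is the sum of two maps, each of which projects to a factor
  and includes it again, and so passes through an identity in \<open>fac\<close>.\<close>

lemma fac_prod:
  assumes "module R M" "module R N" "fac R M M (\<lambda>x. x)" "fac R N N (\<lambda>x. x)"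
  shows "fac R (prod_mod M N) (prod_mod M N) (\<lambda>x. x)"
proof -
  interpret M: module R M by fact
  interpret N: module R N by fact
  note P = module_prod[OF assms(1,2)]
  have "(\<lambda>x. (x, \<zero>\<^bsub>N\<^esub>)) \<in> mod_hom R M (prod_mod M N)"
    and "(\<lambda>x. (\<zero>\<^bsub>M\<^esub>, x)) \<in> mod_hom R N (prod_mod M N)"
    by (auto intro!: mod_homI)
  from fac_add[OF P P
      fac_pre[OF fac_post[OF assms(1,1) P assms(3) this(1)] mod_hom_fst]
      fac_pre[OF fac_post[OF assms(2,2) P assms(4) this(2)] mod_hom_snd]]
  show ?thesis by (rule fac_cong[OF P]) auto
qed

lemma fac_dsum:
  assumes M: "module R M" and fac: "fac R M M (\<lambda>x. x)" and fin: "finite I"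
  shows "fac R (dsum M I) (dsum M I) (\<lambda>x. x)"
proof -
  interpret M: module R M by fact
  note D = module_dsum[OF M, of I]
  \<comment> \<open>The truncations to \<open>J\<close> gain one coordinate at a time, each
    factoring through a copy of \<open>M\<close>; for \<open>J = I\<close> the truncation is the
    identity.\<close>
  have "fac R (dsum M I) (dsum M I) (\<lambda>f j. if j \<in> J then f j else \<zero>\<^bsub>M\<^esub>)" if "J \<subseteq> I" for J
    using finite_subset[OF that fin] that
  proof induct
    case empty
    show ?case by (rule fac.zero) simp
  next
    case (insert i J)
    from insert(4) have i: "i \<in> I" by simp
    have "fac R (dsum M I) (dsum M I) (\<lambda>f. (\<lambda>j. if j = i then f i else \<zero>\<^bsub>M\<^esub>)
        \<oplus>\<^bsub>dsum M I\<^esub> (\<lambda>j. if j \<in> J then f j else \<zero>\<^bsub>M\<^esub>))"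
      using insert i
      by (intro fac_add[OF D D] fac_pre[OF fac_post[OF M M D fac mod_hom_inject[OF M i]] mod_hom_coord[OF i]]) auto
    then show ?case
    proof (rule fac_cong[OF D])
      fix f assume f: "f \<in> carrier (dsum M I)"
      show "(\<lambda>j. if j \<in> insert i J then f j else \<zero>\<^bsub>M\<^esub>) = (\<lambda>j. if j = i then f i else \<zero>\<^bsub>M\<^esub>)
        \<oplus>\<^bsub>dsum M I\<^esub> (\<lambda>j. if j \<in> J then f j else \<zero>\<^bsub>M\<^esub>)"
        using insert(2) dsum_closed[OF M f] by (auto simp: fun_eq_iff)
    qed
  qed
  from this[of I] show ?thesis by (rule fac_cong[OF D]) auto
qed

lemma fac_iso:
  assumes "module R M" "module R N" "i \<in> mod_hom R M N" "p \<in> mod_hom R N M"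
    "\<And>x. x \<in> carrier M \<Longrightarrow> p (i x) = x" and fac: "fac R N N (\<lambda>x. x)"
  shows "fac R M M (\<lambda>x. x)"
  using fac_post[OF assms(1,2,1) fac_pre[OF fac assms(3)] assms(4)]
  by (rule fac_cong[OF assms(1)]) (simp add: assms(5))

text \<open>The terms of the sum become the coordinates of a finite free module. The indices are
  taken from an injection \<open>\<iota>\<close> of \<open>nat\<close> because
  \<open>projective_module\<close> prescribes the type of its index sets.\<close>

lemma fac_through_dsum:
  fixes \<iota> :: "nat \<Rightarrow> 'i"
  assumes M: "module R M" and N: "module R N" and \<iota>: "inj \<iota>" and fac: "fac R M N \<theta>"
  shows "\<exists>p \<alpha> \<beta>. \<alpha> \<in> mod_hom R M (dsum (self_module R) (\<iota> ` {..<p})) \<and>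
    \<beta> \<in> mod_hom R (dsum (self_module R) (\<iota> ` {..<p})) N \<and> (\<forall>x \<in> carrier M. \<beta> (\<alpha> x) = \<theta> x)"
  using fac
proof induct
  case (zero \<theta>)
  interpret M: module R M by fact
  interpret N: module R N by fact
  show ?case
    by (rule exI[of _ 0], rule exI[of _ "\<lambda>_. \<zero>\<^bsub>dsum (self_module R) {}\<^esub>"], rule exI[of _ "\<lambda>_. \<zero>\<^bsub>N\<^esub>"])
      (auto simp: zero intro!: mod_homI)
next
  case (step \<theta> \<alpha> s \<theta>')
  interpret N: module R N by fact
  interpret S: module R "self_module R" by (rule module_self[OF N.R.is_cring])
  obtain p a b where IH: "a \<in> mod_hom R M (dsum (self_module R) (\<iota> ` {..<p}))"
    "b \<in> mod_hom R (dsum (self_module R) (\<iota> ` {..<p})) N" "\<forall>x \<in> carrier M. b (a x) = \<theta> x"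
    using step(2) by blast
  let ?q = "\<iota> p" and ?D = "dsum (self_module R) (\<iota> ` {..<p})" and ?D' = "dsum (self_module R) (insert (\<iota> p) (\<iota> ` {..<p}))"
  have q: "?q \<notin> \<iota> ` {..<p}" "\<iota> ` {..<Suc p} = insert ?q (\<iota> ` {..<p})"
    using injD[OF \<iota>] by (auto simp: lessThan_Suc)
  have cD: "v \<in> carrier ?D \<longleftrightarrow> (\<forall>i\<in>\<iota> ` {..<p}. v i \<in> carrier R) \<and> (\<forall>i. i \<notin> \<iota> ` {..<p} \<longrightarrow> v i = \<zero>\<^bsub>R\<^esub>)"
    and cD': "v \<in> carrier ?D' \<longleftrightarrow> (\<forall>i\<in>insert ?q (\<iota> ` {..<p}). v i \<in> carrier R) \<and>
      (\<forall>i. i \<notin> insert ?q (\<iota> ` {..<p}) \<longrightarrow> v i = \<zero>\<^bsub>R\<^esub>)"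
    for v by (subst carrier_dsum_finite; simp)+
  \<comment> \<open>The new coordinate records the value of \<open>\<alpha>\<close>, and its unit
    vector is sent to \<open>s\<close>; the old \<open>b\<close> sees the vector with that
    coordinate erased.\<close>
  let ?a = "\<lambda>x. (a x)(?q := \<alpha> x)" and ?b = "\<lambda>v. v ?q \<odot>\<^bsub>N\<^esub> s \<oplus>\<^bsub>N\<^esub> b (v(?q := \<zero>\<^bsub>R\<^esub>))"
  have aD: "a x \<in> carrier ?D" and \<alpha>R: "\<alpha> x \<in> carrier R" if "x \<in> carrier M" for x
    using mod_hom_closed[OF IH(1) that] mod_hom_closed[OF step(3) that] by simp_all
  have "?a \<in> mod_hom R M ?D'"
  proof (rule mod_homI)
    fix x y assume x: "x \<in> carrier M" and y: "y \<in> carrier M"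
    show "?a x \<in> carrier ?D'"
      using aD[OF x] \<alpha>R[OF x] unfolding cD cD' by auto
    show "?a (x \<oplus>\<^bsub>M\<^esub> y) = ?a x \<oplus>\<^bsub>?D'\<^esub> ?a y"
      using mod_hom_add[OF IH(1) x y] mod_hom_add[OF step(3) x y] by (auto simp: fun_eq_iff)
    fix c assume c: "c \<in> carrier R"
    show "?a (c \<odot>\<^bsub>M\<^esub> x) = c \<odot>\<^bsub>?D'\<^esub> ?a x"
      using mod_hom_smult[OF IH(1) c x] mod_hom_smult[OF step(3) c x] by (auto simp: fun_eq_iff)
  qed
  moreover have "?b \<in> mod_hom R ?D' N"
  proof -
    have v: "(\<lambda>v. v(?q := \<zero>\<^bsub>R\<^esub>)) \<in> mod_hom R ?D' ?D"
      by (rule mod_homI) (use q(1) in \<open>auto simp: cD cD' fun_eq_iff simp del: dsum_simps(1)\<close>)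
    have "(\<lambda>v. v ?q \<odot>\<^bsub>N\<^esub> s) \<in> mod_hom R ?D' N"
      by (rule mod_homI) (use q(1) step(4) in \<open>auto simp: cD' N.smult_l_distr N.smult_assoc1 simp del: dsum_simps(1)\<close>)
    from mod_hom_plus[OF N this mod_hom_comp[OF v IH(2)]] show ?thesis .
  qed
  moreover have "?b (?a x) = \<theta>' x" if x: "x \<in> carrier M" for x
  proof -
    have "(?a x)(?q := \<zero>\<^bsub>R\<^esub>) = a x" using aD[OF x] q(1) unfolding cD by (auto simp: fun_eq_iff)
    then show ?thesis using IH(3) step(5)[OF x] x by simp
  qed
  ultimately show ?case unfolding q(2)[symmetric] by (intro exI[of _ "Suc p"] exI[of _ ?a] exI[of _ ?b]) blast
qed

lemma fac_projective:
  fixes P :: "('a, nat \<Rightarrow> 'a) module"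
  assumes P: "module R P" and fac: "fac R P P (\<lambda>x. x)"
  shows "projective_module R P"
proof -
  interpret module R P by fact
  note S = module_self[OF R.is_cring]
  have "\<exists>I :: (nat \<Rightarrow> 'a) set. retract R P (dsum (self_module R) I)"
  \<comment> \<open>The unit vectors that serve as indices below are distinct only if 1 differs from
    0. Over the zero ring \<open>P\<close> is zero, and the empty index set suffices.\<close>
  proof (cases "\<one>\<^bsub>R\<^esub> = \<zero>\<^bsub>R\<^esub>")
    case True
    then have z: "carrier P = {\<zero>\<^bsub>P\<^esub>}" using smult_one smult_l_null by fastforce
    show ?thesis
      by (rule exI[of _ "{}"], rule retractI[OF P module_dsum[OF S], of "\<lambda>_ _. \<zero>\<^bsub>R\<^esub>" _ "\<lambda>_. \<zero>\<^bsub>P\<^esub>"])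
        (auto intro!: mod_homI simp: z)
  next
    case False
    define \<iota> :: "nat \<Rightarrow> nat \<Rightarrow> 'a" where "\<iota> i j = (if i = j then \<one>\<^bsub>R\<^esub> else \<zero>\<^bsub>R\<^esub>)" for i j
    have "inj \<iota>" using False by (auto simp: inj_def \<iota>_def fun_eq_iff split: if_splits)
    from fac_through_dsum[OF P P this fac] obtain p \<alpha> \<beta>
      where "\<alpha> \<in> mod_hom R P (dsum (self_module R) (\<iota> ` {..<p}))"
      "\<beta> \<in> mod_hom R (dsum (self_module R) (\<iota> ` {..<p})) P" "\<forall>x \<in> carrier P. \<beta> (\<alpha> x) = x"
      by blast
    then have "retract R P (dsum (self_module R) (\<iota> ` {..<p}))"
      by (intro retractI[OF P module_dsum[OF S]]) auto
    then show ?thesis by blast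
  qed
  then show ?thesis
    unfolding projective_module_def using P retract_direct_summand by blast
qed


section \<open>Complexes\<close>

lemma cplx_module: "is_cplx R X \<Longrightarrow> module R (obj X i)"
  and cplx_hom: "is_cplx R X \<Longrightarrow> diff X i \<in> mod_hom R (obj X i) (obj X (i - 1))"
  by (auto simp: is_cplx_def)

lemma cplx_dd: "is_cplx R X \<Longrightarrow> x \<in> carrier (obj X i) \<Longrightarrow> diff X (i - 1) (diff X i x) = \<zero>\<^bsub>obj X (i - 1 - 1)\<^esub>"
  by (simp add: is_cplx_def)

lemma cplx_hom': "is_cplx R X \<Longrightarrow> diff X (i + 1) \<in> mod_hom R (obj X (i + 1)) (obj X i)"
  using cplx_hom[of R X "i + 1"] by simp

lemma cplx_dd': "is_cplx R X \<Longrightarrow> x \<in> carrier (obj X (i + 1)) \<Longrightarrow> diff X i (diff X (i + 1) x) = \<zero>\<^bsub>obj X (i - 1)\<^esub>"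
  using cplx_dd[of R X x "i + 1"] by simp

lemma chain_hom: "chain_map R X Y f \<Longrightarrow> f i \<in> mod_hom R (obj X i) (obj Y i)"
  and chain_diff: "chain_map R X Y f \<Longrightarrow> x \<in> carrier (obj X i) \<Longrightarrow> f (i - 1) (diff X i x) = diff Y i (f i x)"
  by (auto simp: chain_map_def)

lemma chain_diff': "chain_map R X Y f \<Longrightarrow> x \<in> carrier (obj X (i + 1)) \<Longrightarrow>
    f i (diff X (i + 1) x) = diff Y (i + 1) (f (i + 1) x)"
  using chain_diff[of R X Y f x "i + 1"] by simp

lemma chain_mapI:
  "(\<And>i. f i \<in> mod_hom R (obj X i) (obj Y i)) \<Longrightarrow>
   (\<And>i x. x \<in> carrier (obj X i) \<Longrightarrow> f (i - 1) (diff X i x) = diff Y i (f i x)) \<Longrightarrow> chain_map R X Y f"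
  by (auto simp: chain_map_def)

lemma chain_map_comp:
  assumes "chain_map R X Y f" "chain_map R Y Z g" shows "chain_map R X Z (\<lambda>i x. g i (f i x))"
proof (rule chain_mapI)
  fix i x assume x: "x \<in> carrier (obj X i)"
  show "g (i - 1) (f (i - 1) (diff X i x)) = diff Z i (g i (f i x))"
    using chain_diff[OF assms(1) x] chain_diff[OF assms(2) mod_hom_closed[OF chain_hom[OF assms(1)] x]]
    by simp
qed (auto intro: mod_hom_comp chain_hom[OF assms(1)] chain_hom[OF assms(2)])

section \<open>Cycles, boundaries and quasi-isomorphisms\<close>

lemma submodule_cycles: "is_cplx R X \<Longrightarrow> submodule (cycles X i) R (obj X i)"
  unfolding cycles_def by (intro submodule_ker cplx_module cplx_hom)

lemma submodule_boundaries: "is_cplx R X \<Longrightarrow> submodule (boundaries X i) R (obj X i)"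
  unfolding boundaries_def
  by (intro submodule_image[OF _ _ cplx_hom'] cplx_module module.carrier_is_submodule)

lemma boundaries_cycles: "is_cplx R X \<Longrightarrow> boundaries X i \<subseteq> cycles X i"
  by (auto simp: cycles_def boundaries_def cplx_dd' intro: mod_hom_closed[OF cplx_hom'])

lemma chain_cycles:
  assumes "is_cplx R X" "is_cplx R Y" "chain_map R X Y f" "z \<in> cycles X i"
  shows "f i z \<in> cycles Y i"
  using assms(4) chain_diff[OF assms(3), of z i, symmetric]
    mod_hom_zero[OF cplx_module[OF assms(1)] cplx_module[OF assms(2)] chain_hom[OF assms(3)]]
  by (auto simp: cycles_def intro: mod_hom_closed[OF chain_hom[OF assms(3)]])

lemma chain_boundaries:
  assumes "chain_map R X Y f" "z \<in> boundaries X i"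
  shows "f i z \<in> boundaries Y i"
  using assms(2) by (auto simp: boundaries_def chain_diff'[OF assms(1)]
    intro!: imageI mod_hom_closed[OF chain_hom[OF assms(1)]])

text \<open>What \<open>quasi_iso\<close> says about cosets, said about cycles: the last two clauses
  are injectivity and surjectivity on homology. The constructions use this form, and
  \<open>qis_elem_quasi_iso\<close> translates it back.\<close>

definition qis_elem ::
  "('a, 'r) ring_scheme \<Rightarrow> ('a, 'u) mod_cplx \<Rightarrow> ('a, 'v) mod_cplx \<Rightarrow> (int \<Rightarrow> 'u \<Rightarrow> 'v) \<Rightarrow> bool"
  where "qis_elem R X Y f \<longleftrightarrow> is_cplx R X \<and> is_cplx R Y \<and> chain_map R X Y f \<and>
    (\<forall>i. \<forall>z \<in> cycles X i. f i z \<in> boundaries Y i \<longrightarrow> z \<in> boundaries X i) \<and>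
    (\<forall>i. \<forall>w \<in> cycles Y i. \<exists>z \<in> cycles X i. w \<ominus>\<^bsub>obj Y i\<^esub> f i z \<in> boundaries Y i)"

lemma coset_eq:
  assumes M: "module R M" and B: "submodule B R M" and xy: "x \<in> carrier M" "y \<in> carrier M"
  shows "B +>\<^bsub>M\<^esub> x = B +>\<^bsub>M\<^esub> y \<longleftrightarrow> x \<ominus>\<^bsub>M\<^esub> y \<in> B"
proof -
  interpret module R M by fact
  note E = submoduleE[OF B]
  have z: "\<zero>\<^bsub>M\<^esub> \<in> B" using subgroup.one_closed[OF submodule.axioms(1)[OF B]] by simp
  have sub: "B +>\<^bsub>M\<^esub> x \<subseteq> B +>\<^bsub>M\<^esub> y" if "x \<ominus>\<^bsub>M\<^esub> y \<in> B" "x \<in> carrier M" "y \<in> carrier M" for x y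
  proof
    fix w assume "w \<in> B +>\<^bsub>M\<^esub> x"
    then obtain b where b: "b \<in> B" "w = b \<oplus>\<^bsub>M\<^esub> x" by (auto simp: a_r_coset_def')
    then have "b \<in> carrier M" using E(1) by auto
    then have "w = (b \<oplus>\<^bsub>M\<^esub> (x \<ominus>\<^bsub>M\<^esub> y)) \<oplus>\<^bsub>M\<^esub> y" unfolding b(2) using that(2,3) by algebra
    then show "w \<in> B +>\<^bsub>M\<^esub> y" using E(5)[OF b(1) that(1)] by (auto simp: a_r_coset_def')
  qed
  show ?thesis
  proof
    assume "B +>\<^bsub>M\<^esub> x = B +>\<^bsub>M\<^esub> y"
    moreover have "x \<in> B +>\<^bsub>M\<^esub> x" using z xy by (force simp: a_r_coset_def')
    ultimately obtain b where b: "b \<in> B" "x = b \<oplus>\<^bsub>M\<^esub> y" by (auto simp: a_r_coset_def')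
    then have "b \<in> carrier M" using E(1) by auto
    then have "x \<ominus>\<^bsub>M\<^esub> y = b" unfolding b(2) using xy(2) by algebra
    then show "x \<ominus>\<^bsub>M\<^esub> y \<in> B" using b by simp
  next
    assume d: "x \<ominus>\<^bsub>M\<^esub> y \<in> B"
    moreover have "y \<ominus>\<^bsub>M\<^esub> x = \<ominus>\<^bsub>M\<^esub> (x \<ominus>\<^bsub>M\<^esub> y)" using xy by algebra
    ultimately have "y \<ominus>\<^bsub>M\<^esub> x \<in> B" using E(3) by simp
    then show "B +>\<^bsub>M\<^esub> x = B +>\<^bsub>M\<^esub> y" using sub d xy by blast
  qed
qed

lemma homology_carrier:
  "carrier (homology X i) = {boundaries X i +>\<^bsub>obj X i\<^esub> z | z. z \<in> cycles X i}"
  by (auto simp: homology_def quot_mod_def A_RCOSETS_def' a_r_coset_def')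

text \<open>Since \<open>f\<close> sends boundaries to boundaries, adding the boundaries of
  \<open>Y\<close> absorbs the image of the whole coset into the class of
  \<open>f i z\<close>.\<close>

lemma induced_coset:
  assumes X: "is_cplx R X" and Y: "is_cplx R Y" and f: "chain_map R X Y f" and z: "z \<in> cycles X i"
  shows "boundaries Y i <+>\<^bsub>obj Y i\<^esub> (f i ` (boundaries X i +>\<^bsub>obj X i\<^esub> z)) =
    boundaries Y i +>\<^bsub>obj Y i\<^esub> f i z"
proof -
  interpret X: module R "obj X i" by (rule cplx_module[OF X])
  interpret Y: module R "obj Y i" by (rule cplx_module[OF Y])
  note sX = submodule_boundaries[OF X, of i] and sY = submodule_boundaries[OF Y, of i]
  note EX = X.submoduleE[OF sX] and EY = Y.submoduleE[OF sY]
  note fh = chain_hom[OF f, of i]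
  have zX: "\<zero>\<^bsub>obj X i\<^esub> \<in> boundaries X i"
    using subgroup.one_closed[OF submodule.axioms(1)[OF sX]] by simp
  have zc: "z \<in> carrier (obj X i)" using z by (simp add: cycles_def)
  note fz = mod_hom_closed[OF fh zc]
  show ?thesis
  proof safe
    fix w assume "w \<in> boundaries Y i <+>\<^bsub>obj Y i\<^esub> (f i ` (boundaries X i +>\<^bsub>obj X i\<^esub> z))"
    then obtain b c where bc: "b \<in> boundaries Y i" "c \<in> boundaries X i" "w = b \<oplus>\<^bsub>obj Y i\<^esub> f i (c \<oplus>\<^bsub>obj X i\<^esub> z)"
      by (auto simp: set_add_def' a_r_coset_def')
    then have c: "c \<in> carrier (obj X i)" using EX(1) by auto
    have "f i c \<in> boundaries Y i" "b \<in> carrier (obj Y i)" using chain_boundaries[OF f bc(2)] bc(1) EY(1) by auto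
    then have "w = (b \<oplus>\<^bsub>obj Y i\<^esub> f i c) \<oplus>\<^bsub>obj Y i\<^esub> f i z"
      using bc(3) c zc fz EY(1) by (auto simp: mod_hom_add[OF fh] Y.M.a_assoc)
    then show "w \<in> boundaries Y i +>\<^bsub>obj Y i\<^esub> f i z"
      using EY(5)[OF bc(1) \<open>f i c \<in> boundaries Y i\<close>] by (auto simp: a_r_coset_def')
  next
    fix w assume "w \<in> boundaries Y i +>\<^bsub>obj Y i\<^esub> f i z"
    then obtain b where b: "b \<in> boundaries Y i" "w = b \<oplus>\<^bsub>obj Y i\<^esub> f i z" by (auto simp: a_r_coset_def')
    then have "w = b \<oplus>\<^bsub>obj Y i\<^esub> f i (\<zero>\<^bsub>obj X i\<^esub> \<oplus>\<^bsub>obj X i\<^esub> z)" using zc by simp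
    then show "w \<in> boundaries Y i <+>\<^bsub>obj Y i\<^esub> (f i ` (boundaries X i +>\<^bsub>obj X i\<^esub> z))"
      using b(1) zX by (auto simp: set_add_def' a_r_coset_def')
  qed
qed

lemma qis_elem_quasi_iso:
  assumes "qis_elem R X Y f" shows "quasi_iso R X Y f"
proof -
  have X: "is_cplx R X" and Y: "is_cplx R Y" and f: "chain_map R X Y f"
    and inj: "\<And>i z. z \<in> cycles X i \<Longrightarrow> f i z \<in> boundaries Y i \<Longrightarrow> z \<in> boundaries X i"
    and surj: "\<And>i w. w \<in> cycles Y i \<Longrightarrow> \<exists>z \<in> cycles X i. w \<ominus>\<^bsub>obj Y i\<^esub> f i z \<in> boundaries Y i"
    using assms by (auto simp: qis_elem_def)
  have "bij_betw (\<lambda>C. boundaries Y i <+>\<^bsub>obj Y i\<^esub> (f i ` C)) (carrier (homology X i)) (carrier (homology Y i))" for i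
    unfolding bij_betw_def
  proof
    interpret X: module R "obj X i" by (rule cplx_module[OF X])
    have cc: "\<And>z. z \<in> cycles X i \<Longrightarrow> z \<in> carrier (obj X i)" "\<And>z. z \<in> cycles Y i \<Longrightarrow> z \<in> carrier (obj Y i)"
      by (auto simp: cycles_def)
    note eX = coset_eq[OF cplx_module[OF X] submodule_boundaries[OF X]]
    note eY = coset_eq[OF cplx_module[OF Y] submodule_boundaries[OF Y]]
    note fc = chain_cycles[OF X Y f]
    show "inj_on (\<lambda>C. boundaries Y i <+>\<^bsub>obj Y i\<^esub> (f i ` C)) (carrier (homology X i))"
    proof (rule inj_onI)
      fix C D assume "C \<in> carrier (homology X i)" "D \<in> carrier (homology X i)"
        and eq: "boundaries Y i <+>\<^bsub>obj Y i\<^esub> (f i ` C) = boundaries Y i <+>\<^bsub>obj Y i\<^esub> (f i ` D)"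
      then obtain z z' where z: "z \<in> cycles X i" "z' \<in> cycles X i"
        "C = boundaries X i +>\<^bsub>obj X i\<^esub> z" "D = boundaries X i +>\<^bsub>obj X i\<^esub> z'"
        unfolding homology_carrier by auto
      have "boundaries Y i +>\<^bsub>obj Y i\<^esub> f i z = boundaries Y i +>\<^bsub>obj Y i\<^esub> f i z'"
        using eq by (simp only: z(3,4) induced_coset[OF X Y f z(1)] induced_coset[OF X Y f z(2)])
      then have "f i z \<ominus>\<^bsub>obj Y i\<^esub> f i z' \<in> boundaries Y i" using eY cc fc z by simp
      then have "f i (z \<ominus>\<^bsub>obj X i\<^esub> z') \<in> boundaries Y i"
        using z cc by (simp add: mod_hom_diff[OF cplx_module[OF X] cplx_module[OF Y] chain_hom[OF f]])
      moreover have "z \<ominus>\<^bsub>obj X i\<^esub> z' \<in> cycles X i"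
        using z X.submoduleE(3,5)[OF submodule_cycles[OF X]] by (simp add: a_minus_def)
      ultimately show "C = D" using inj z eX cc by simp
    qed
    show "(\<lambda>C. boundaries Y i <+>\<^bsub>obj Y i\<^esub> (f i ` C)) ` carrier (homology X i) = carrier (homology Y i)"
    proof safe
      fix C assume "C \<in> carrier (homology X i)"
      then obtain z where z: "z \<in> cycles X i" "C = boundaries X i +>\<^bsub>obj X i\<^esub> z"
        unfolding homology_carrier by auto
      show "boundaries Y i <+>\<^bsub>obj Y i\<^esub> (f i ` C) \<in> carrier (homology Y i)"
        unfolding z(2) induced_coset[OF X Y f z(1)] homology_carrier using fc[OF z(1)] by blast
    next
      fix D assume "D \<in> carrier (homology Y i)"
      then obtain w where w: "w \<in> cycles Y i" "D = boundaries Y i +>\<^bsub>obj Y i\<^esub> w"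
        unfolding homology_carrier by auto
      obtain z where z: "z \<in> cycles X i" "w \<ominus>\<^bsub>obj Y i\<^esub> f i z \<in> boundaries Y i" using surj[OF w(1)] by blast
      have "D = boundaries Y i +>\<^bsub>obj Y i\<^esub> f i z" using w z eY cc fc by simp
      then have "D = boundaries Y i <+>\<^bsub>obj Y i\<^esub> (f i ` (boundaries X i +>\<^bsub>obj X i\<^esub> z))"
        using induced_coset[OF X Y f z(1)] by simp
      moreover have "boundaries X i +>\<^bsub>obj X i\<^esub> z \<in> carrier (homology X i)"
        unfolding homology_carrier using z(1) by blast
      ultimately show "D \<in> (\<lambda>C. boundaries Y i <+>\<^bsub>obj Y i\<^esub> (f i ` C)) ` carrier (homology X i)" by blast
    qed
  qed
  then show ?thesis unfolding quasi_iso_def using X Y f by blast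
qed

text \<open>For surjectivity, approximate \<open>w\<close> in two stages: \<open>w - g (f x)\<close>
  is the sum of \<open>w - g y\<close> and \<open>g (y - f x)\<close>, both boundaries.\<close>

lemma qis_elem_comp:
  assumes f: "qis_elem R X Y f" and g: "qis_elem R Y Z g"
  shows "qis_elem R X Z (\<lambda>i x. g i (f i x))"
proof -
  have X: "is_cplx R X" and Y: "is_cplx R Y" and Z: "is_cplx R Z"
    and cf: "chain_map R X Y f" and cg: "chain_map R Y Z g"
    using f g by (auto simp: qis_elem_def)
  have "\<exists>x \<in> cycles X i. w \<ominus>\<^bsub>obj Z i\<^esub> g i (f i x) \<in> boundaries Z i" if w: "w \<in> cycles Z i" for i w
  proof -
    interpret Z: module R "obj Z i" by (rule cplx_module[OF Z])
    obtain y where y: "y \<in> cycles Y i" "w \<ominus>\<^bsub>obj Z i\<^esub> g i y \<in> boundaries Z i"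
      using g w unfolding qis_elem_def by blast
    obtain x where x: "x \<in> cycles X i" "y \<ominus>\<^bsub>obj Y i\<^esub> f i x \<in> boundaries Y i"
      using f y(1) unfolding qis_elem_def by blast
    have c: "w \<in> carrier (obj Z i)" "y \<in> carrier (obj Y i)" "f i x \<in> carrier (obj Y i)"
      using w y chain_cycles[OF X Y cf x(1)] by (auto simp: cycles_def)
    have c': "g i y \<in> carrier (obj Z i)" "g i (f i x) \<in> carrier (obj Z i)"
      using c mod_hom_closed[OF chain_hom[OF cg]] by auto
    have "g i (y \<ominus>\<^bsub>obj Y i\<^esub> f i x) \<in> boundaries Z i" by (rule chain_boundaries[OF cg x(2)])
    then have "g i y \<ominus>\<^bsub>obj Z i\<^esub> g i (f i x) \<in> boundaries Z i"
      using c by (simp add: mod_hom_diff[OF cplx_module[OF Y] cplx_module[OF Z] chain_hom[OF cg]])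
    from Z.submoduleE(5)[OF submodule_boundaries[OF Z] y(2) this]
    have "w \<ominus>\<^bsub>obj Z i\<^esub> g i y \<oplus>\<^bsub>obj Z i\<^esub> (g i y \<ominus>\<^bsub>obj Z i\<^esub> g i (f i x)) \<in> boundaries Z i" .
    moreover have "w \<ominus>\<^bsub>obj Z i\<^esub> g i y \<oplus>\<^bsub>obj Z i\<^esub> (g i y \<ominus>\<^bsub>obj Z i\<^esub> g i (f i x)) = w \<ominus>\<^bsub>obj Z i\<^esub> g i (f i x)"
      using c(1) c' by algebra
    ultimately show ?thesis using x(1) by auto
  qed
  moreover have "x \<in> boundaries X i" if "x \<in> cycles X i" "g i (f i x) \<in> boundaries Z i" for i x
    using that f g chain_cycles[OF X Y cf that(1)] unfolding qis_elem_def by blast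
  ultimately show ?thesis unfolding qis_elem_def using X Z chain_map_comp[OF cf cg] by blast
qed

text \<open>That \<open>Y\<close> is a complex is a conclusion: its differential is that of
  \<open>X\<close> carried along the bijections. This serves for renaming elements and also yields
  that Koszul complexes are complexes, by comparison with a cone.\<close>

lemma iso_cplx:
  assumes X: "is_cplx R X" and mY: "\<And>i. module R (obj Y i)"
    and j: "\<And>i. j i \<in> mod_hom R (obj X i) (obj Y i)"
    and bij: "\<And>i. bij_betw (j i) (carrier (obj X i)) (carrier (obj Y i))"
    and d: "\<And>i x. x \<in> carrier (obj X i) \<Longrightarrow> j (i - 1) (diff X i x) = diff Y i (j i x)"
  shows "is_cplx R Y" and "qis_elem R X Y j"
proof -
  note dX = cplx_hom[OF X]
  have ex: "\<exists>x. x \<in> carrier (obj X i) \<and> y = j i x" if "y \<in> carrier (obj Y i)" for i y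
    using bij[of i] that by (auto simp: bij_betw_def)
  note mX = cplx_module[OF X]
  have X_add: "x \<oplus>\<^bsub>obj X i\<^esub> y \<in> carrier (obj X i)" and X_smult: "c \<in> carrier R \<Longrightarrow> c \<odot>\<^bsub>obj X i\<^esub> x \<in> carrier (obj X i)"
    if "x \<in> carrier (obj X i)" "y \<in> carrier (obj X i)" for x y c i
  proof -
    interpret module R "obj X i" by (rule mX)
    show "x \<oplus>\<^bsub>obj X i\<^esub> y \<in> carrier (obj X i)" "c \<in> carrier R \<Longrightarrow> c \<odot>\<^bsub>obj X i\<^esub> x \<in> carrier (obj X i)"
      using that by auto
  qed
  have hY: "diff Y i \<in> mod_hom R (obj Y i) (obj Y (i - 1))" for i
  proof (rule mod_homI)
    fix y y' assume "y \<in> carrier (obj Y i)" "y' \<in> carrier (obj Y i)"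
    then obtain x x' where x: "x \<in> carrier (obj X i)" "y = j i x" "x' \<in> carrier (obj X i)" "y' = j i x'"
      using ex by blast
    show "diff Y i y \<in> carrier (obj Y (i - 1))"
      using d[OF x(1)] x mod_hom_closed[OF j mod_hom_closed[OF dX x(1)]] by simp
    have "diff Y i (j i x \<oplus>\<^bsub>obj Y i\<^esub> j i x') = j (i - 1) (diff X i (x \<oplus>\<^bsub>obj X i\<^esub> x'))"
      using x X_add by (simp add: d mod_hom_add[OF j])
    also have "\<dots> = diff Y i (j i x) \<oplus>\<^bsub>obj Y (i - 1)\<^esub> diff Y i (j i x')"
      using x by (simp add: d[symmetric] mod_hom_add[OF j] mod_hom_add[OF dX] mod_hom_closed[OF dX])
    finally show "diff Y i (y \<oplus>\<^bsub>obj Y i\<^esub> y') = diff Y i y \<oplus>\<^bsub>obj Y (i - 1)\<^esub> diff Y i y'" using x by simp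
    fix a assume a: "a \<in> carrier R"
    have "diff Y i (a \<odot>\<^bsub>obj Y i\<^esub> j i x) = j (i - 1) (diff X i (a \<odot>\<^bsub>obj X i\<^esub> x))"
      using x X_smult a by (simp add: d mod_hom_smult[OF j])
    also have "\<dots> = a \<odot>\<^bsub>obj Y (i - 1)\<^esub> diff Y i (j i x)"
      using x a by (simp add: d[symmetric] mod_hom_smult[OF j] mod_hom_smult[OF dX] mod_hom_closed[OF dX])
    finally show "diff Y i (a \<odot>\<^bsub>obj Y i\<^esub> y) = a \<odot>\<^bsub>obj Y (i - 1)\<^esub> diff Y i y" using x by simp
  qed
  have ddY: "diff Y (i - 1) (diff Y i y) = \<zero>\<^bsub>obj Y (i - 2)\<^esub>" if y: "y \<in> carrier (obj Y i)" for i y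
  proof -
    obtain x where x: "x \<in> carrier (obj X i)" "y = j i x" using ex[OF y] by blast
    have "diff Y (i - 1) (diff Y i y) = j (i - 1 - 1) (diff X (i - 1) (diff X i x))"
      using x mod_hom_closed[OF dX x(1)] by (simp only: d)
    also have "\<dots> = \<zero>\<^bsub>obj Y (i - 1 - 1)\<^esub>" using cplx_dd[OF X x(1)] mod_hom_zero[OF mX mY j] by simp
    finally show ?thesis by simp
  qed
  show Y: "is_cplx R Y" unfolding is_cplx_def using mY hY ddY by blast
  have ch: "chain_map R X Y j" by (rule chain_mapI[OF j d])
  have inj: "x = x'" if "j i x = j i x'" "x \<in> carrier (obj X i)" "x' \<in> carrier (obj X i)" for i x x'
    using bij[of i] that by (auto simp: bij_betw_def inj_on_def)
  have "z \<in> boundaries X i" if z: "z \<in> cycles X i" "j i z \<in> boundaries Y i" for z i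
  proof -
    obtain y where y: "y \<in> carrier (obj Y (i + 1))" "j i z = diff Y (i + 1) y"
      using z(2) by (auto simp: boundaries_def)
    obtain x where x: "x \<in> carrier (obj X (i + 1))" "y = j (i + 1) x" using ex[OF y(1)] by blast
    have "j i z = j i (diff X (i + 1) x)" using chain_diff'[OF ch x(1)] x y by simp
    then have "z = diff X (i + 1) x"
      using z(1) x by (intro inj) (auto simp: cycles_def intro: mod_hom_closed[OF cplx_hom'[OF X]])
    then show ?thesis using x by (auto simp: boundaries_def)
  qed
  moreover have "\<exists>z \<in> cycles X i. w \<ominus>\<^bsub>obj Y i\<^esub> j i z \<in> boundaries Y i" if w: "w \<in> cycles Y i" for w i
  proof -
    interpret Y: module R "obj Y i" by (rule mY)
    obtain x where x: "x \<in> carrier (obj X i)" "w = j i x" using ex w by (auto simp: cycles_def)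
    have "j (i - 1) (diff X i x) = j (i - 1) \<zero>\<^bsub>obj X (i - 1)\<^esub>"
      using w x by (simp add: d cycles_def mod_hom_zero[OF mX mY j])
    then have "diff X i x = \<zero>\<^bsub>obj X (i - 1)\<^esub>"
      using x mod_hom_closed[OF dX x(1)] submodule_zero[OF mX, of "i - 1"] module.submoduleE(1)[OF mX submodule_zero[OF mX]]
      by (intro inj) auto
    then have "x \<in> cycles X i" using x by (simp add: cycles_def)
    moreover have "w \<ominus>\<^bsub>obj Y i\<^esub> j i x = \<zero>\<^bsub>obj Y i\<^esub>"
      using x mod_hom_closed[OF j x(1)] by (simp add: a_minus_def Y.M.r_neg)
    moreover have "\<zero>\<^bsub>obj Y i\<^esub> \<in> boundaries Y i"
      using subgroup.one_closed[OF submodule.axioms(1)[OF submodule_boundaries[OF Y]]] by simp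
    ultimately show ?thesis by (intro bexI[of _ x]) simp_all
  qed
  ultimately show "qis_elem R X Y j" unfolding qis_elem_def using X Y ch by blast
qed


section \<open>Cones\<close>

text \<open>The sign (-1)^i for an integer exponent, as degrees may be negative.\<close>

definition eps :: "('a, 'r) ring_scheme \<Rightarrow> int \<Rightarrow> 'a"
  where "eps R i = (if even i then \<one>\<^bsub>R\<^esub> else \<ominus>\<^bsub>R\<^esub> \<one>\<^bsub>R\<^esub>)"

lemma eps_closed [simp]: assumes "cring R" shows "eps R i \<in> carrier R"
proof -
  interpret cring R by fact
  show ?thesis by (simp add: eps_def)
qed

lemma eps_smult2:
  assumes "module R M" "x \<in> carrier M"
  shows "eps R i \<odot>\<^bsub>M\<^esub> (eps R i \<odot>\<^bsub>M\<^esub> x) = x"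
proof -
  interpret module R M by fact
  show ?thesis using assms(2) by (simp add: eps_def smult_l_minus smult_r_minus)
qed

lemma eps_pred:
  assumes "module R M" "x \<in> carrier M"
  shows "eps R (i - 1) \<odot>\<^bsub>M\<^esub> x = \<ominus>\<^bsub>M\<^esub> (eps R i \<odot>\<^bsub>M\<^esub> x)"
proof -
  interpret module R M by fact
  show ?thesis using assms(2) by (simp add: eps_def smult_l_minus smult_r_minus)
qed

text \<open>The sign sits on \<open>\<phi>\<close> instead of on the differential of \<open>X\<close>, as in the Koszul differential.\<close>

definition cone :: "('a, 'r) ring_scheme \<Rightarrow> (int \<Rightarrow> 'u \<Rightarrow> 'v) \<Rightarrow> ('a, 'u) mod_cplx \<Rightarrow> ('a, 'v) mod_cplx \<Rightarrow>
    ('a, 'v \<times> 'u) mod_cplx"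
  where "cone R \<phi> X Y = \<lparr>obj = (\<lambda>i. prod_mod (obj Y i) (obj X (i - 1))),
    diff = (\<lambda>i x. (diff Y i (fst x) \<oplus>\<^bsub>obj Y (i - 1)\<^esub> eps R (i - 1) \<odot>\<^bsub>obj Y (i - 1)\<^esub> \<phi> (i - 1) (snd x),
      diff X (i - 1) (snd x)))\<rparr>"

lemma cone_simps [simp]:
  "obj (cone R \<phi> X Y) i = prod_mod (obj Y i) (obj X (i - 1))"
  "diff (cone R \<phi> X Y) i x =
    (diff Y i (fst x) \<oplus>\<^bsub>obj Y (i - 1)\<^esub> eps R (i - 1) \<odot>\<^bsub>obj Y (i - 1)\<^esub> \<phi> (i - 1) (snd x), diff X (i - 1) (snd x))"
  by (simp_all add: cone_def)

text \<open>The sign on \<open>\<phi>\<close> alternates with the degree, so the differential of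
  \<open>\<phi> c\<close> and the image under \<open>\<phi>\<close> of the differential of
  \<open>c\<close> occur with opposite signs and cancel.\<close>

lemma is_cplx_cone:
  assumes X: "is_cplx R X" and Y: "is_cplx R Y" and \<phi>: "chain_map R X Y \<phi>"
  shows "is_cplx R (cone R \<phi> X Y)"
  unfolding is_cplx_def
proof (intro allI conjI ballI)
  fix i
  note mX = cplx_module[OF X] and mY = cplx_module[OF Y]
  interpret X: module R "obj X (i - 1)" by (rule mX)
  interpret Y: module R "obj Y (i - 1)" by (rule mY)
  interpret Y2: module R "obj Y (i - 2)" by (rule mY)
  note e = eps_closed[OF X.R.is_cring]
  show "module R (obj (cone R \<phi> X Y) i)" using module_prod[OF mY mX] by simp
  have "(\<lambda>x. diff Y i (fst x) \<oplus>\<^bsub>obj Y (i - 1)\<^esub> eps R (i - 1) \<odot>\<^bsub>obj Y (i - 1)\<^esub> \<phi> (i - 1) (snd x))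
      \<in> mod_hom R (prod_mod (obj Y i) (obj X (i - 1))) (obj Y (i - 1))"
    by (intro mod_hom_plus mY mod_hom_comp[OF mod_hom_fst cplx_hom[OF Y]]
      mod_hom_comp[OF mod_hom_comp[OF mod_hom_snd chain_hom[OF \<phi>]] mod_hom_scale[OF mY e]])
  moreover have "(\<lambda>x. diff X (i - 1) (snd x)) \<in> mod_hom R (prod_mod (obj Y i) (obj X (i - 1))) (obj X (i - 1 - 1))"
    by (intro mod_hom_comp[OF mod_hom_snd cplx_hom[OF X]])
  ultimately show "diff (cone R \<phi> X Y) i \<in> mod_hom R (obj (cone R \<phi> X Y) i) (obj (cone R \<phi> X Y) (i - 1))"
    using mod_hom_pair by (fastforce simp: cone_def)
  fix x assume "x \<in> carrier (obj (cone R \<phi> X Y) i)"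
  then obtain u c where x: "x = (u, c)" and u: "u \<in> carrier (obj Y i)" and c: "c \<in> carrier (obj X (i - 1))" by auto
  have du: "diff Y i u \<in> carrier (obj Y (i - 1))" and pc: "\<phi> (i - 1) c \<in> carrier (obj Y (i - 1))"
    and dc: "diff X (i - 1) c \<in> carrier (obj X (i - 1 - 1))"
    and dpc: "diff Y (i - 1) (\<phi> (i - 1) c) \<in> carrier (obj Y (i - 1 - 1))"
    by (intro mod_hom_closed[OF cplx_hom[OF Y]] mod_hom_closed[OF cplx_hom[OF X]]
      mod_hom_closed[OF chain_hom[OF \<phi>]] u c)+
  have "diff Y (i - 1) (diff Y i u \<oplus>\<^bsub>obj Y (i - 1)\<^esub> eps R (i - 1) \<odot>\<^bsub>obj Y (i - 1)\<^esub> \<phi> (i - 1) c)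
    \<oplus>\<^bsub>obj Y (i - 1 - 1)\<^esub> eps R (i - 1 - 1) \<odot>\<^bsub>obj Y (i - 1 - 1)\<^esub> \<phi> (i - 1 - 1) (diff X (i - 1) c)
    = \<zero>\<^bsub>obj Y (i - 1 - 1)\<^esub>"
    unfolding chain_diff[OF \<phi> c]
    using du pc dpc e eps_pred[OF mY dpc, of "i - 1"] cplx_dd[OF Y u]
    by (simp add: mod_hom_add[OF cplx_hom[OF Y]] mod_hom_smult[OF cplx_hom[OF Y]] Y2.M.r_neg del: diff_diff_eq)
  moreover have "diff X (i - 1 - 1) (diff X (i - 1) c) = \<zero>\<^bsub>obj X (i - 1 - 1 - 1)\<^esub>" by (rule cplx_dd[OF X c])
  moreover have "i - 2 = i - 1 - 1" "i - 2 - 1 = i - 1 - 1 - 1" by simp_all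
  ultimately show "diff (cone R \<phi> X Y) (i - 1) (diff (cone R \<phi> X Y) i x) = \<zero>\<^bsub>obj (cone R \<phi> X Y) (i - 2)\<^esub>"
    by (simp only: x cone_simps prod_mod_simps fst_conv snd_conv)
qed

lemma chain_map_scale:
  assumes X: "is_cplx R X" and a: "a \<in> carrier R"
  shows "chain_map R X X (\<lambda>i x. a \<odot>\<^bsub>obj X i\<^esub> x)"
  by (rule chain_mapI[OF mod_hom_scale[OF cplx_module[OF X] a]])
    (simp add: mod_hom_smult[OF cplx_hom[OF X] a])

text \<open>The hypotheses on \<open>E\<close> say that it is the degreewise pullback of \<open>\<pi>\<close> along multiplication by \<open>a\<close>.
  Replacing \<open>E\<close> by a quasi-isomorphic \<open>C\<close> turns the cone of \<open>a\<close> on \<open>A\<close> into an equivalent complex.\<close>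

lemma cone_pullback_qis:
  assumes A: "is_cplx R A" and B: "is_cplx R B" and E: "is_cplx R E" and a: "a \<in> carrier R"
    and \<pi>: "chain_map R B A \<pi>" and \<pi>s: "\<And>i. \<pi> i ` carrier (obj B i) = carrier (obj A i)"
    and pr: "chain_map R E A pr" and ph: "chain_map R E B ph"
    and comm: "\<And>i y. y \<in> carrier (obj E i) \<Longrightarrow> \<pi> i (ph i y) = a \<odot>\<^bsub>obj A i\<^esub> pr i y"
    and pull: "\<And>i q b. q \<in> carrier (obj A i) \<Longrightarrow> b \<in> carrier (obj B i) \<Longrightarrow> \<pi> i b = a \<odot>\<^bsub>obj A i\<^esub> q \<Longrightarrow>
      \<exists>y \<in> carrier (obj E i). pr i y = q \<and> ph i y = b"
    and uniq: "\<And>i y y'. y \<in> carrier (obj E i) \<Longrightarrow> y' \<in> carrier (obj E i) \<Longrightarrow>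
      pr i y = pr i y' \<Longrightarrow> ph i y = ph i y' \<Longrightarrow> y = y'"
    and f: "qis_elem R C E f"
  shows "qis_elem R (cone R (\<lambda>i c. ph i (f i c)) C B) (cone R (\<lambda>i x. a \<odot>\<^bsub>obj A i\<^esub> x) A A)
    (\<lambda>i x. (\<pi> i (fst x), pr (i - 1) (f (i - 1) (snd x))))"
    (is "qis_elem R ?X ?Y ?g")
proof -
  have C: "is_cplx R C" and cf: "chain_map R C E f" using f by (auto simp: qis_elem_def)
  note finj = f[unfolded qis_elem_def, THEN conjunct2, THEN conjunct2, THEN conjunct2, THEN conjunct1, rule_format]
  note fsurj = f[unfolded qis_elem_def, THEN conjunct2, THEN conjunct2, THEN conjunct2, THEN conjunct2, rule_format]
  have \<pi>ex: "\<exists>b \<in> carrier (obj B i). \<pi> i b = x" if "x \<in> carrier (obj A i)" for i x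
    using that unfolding \<pi>s[of i, symmetric] by auto
  note mA = cplx_module[OF A] and mB = cplx_module[OF B] and mE = cplx_module[OF E] and mC = cplx_module[OF C]
  note dA = cplx_hom[OF A] cplx_hom'[OF A] and dB = cplx_hom[OF B] cplx_hom'[OF B]
    and dE = cplx_hom[OF E] cplx_hom'[OF E] and dC = cplx_hom[OF C] cplx_hom'[OF C]
  note hpi = chain_hom[OF \<pi>] and hpr = chain_hom[OF pr] and hph = chain_hom[OF ph] and hf = chain_hom[OF cf]
  note cl = hpi[THEN mod_hom_closed] hpr[THEN mod_hom_closed] hph[THEN mod_hom_closed] hf[THEN mod_hom_closed]
    dA[THEN mod_hom_closed] dB[THEN mod_hom_closed] dE[THEN mod_hom_closed] dC[THEN mod_hom_closed]
  have R: "cring R" using mA[of 0] by (simp add: module_def)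
  note e = eps_closed[OF R]
  have X: "is_cplx R ?X" by (rule is_cplx_cone[OF C B chain_map_comp[OF cf ph]])
  have Y: "is_cplx R ?Y" by (rule is_cplx_cone[OF A A chain_map_scale[OF A a]])
  have g: "chain_map R ?X ?Y ?g"
  proof (rule chain_mapI)
    fix i
    show "?g i \<in> mod_hom R (obj ?X i) (obj ?Y i)"
      by (simp, intro mod_hom_pair mod_hom_comp[OF mod_hom_fst hpi]
        mod_hom_comp[OF mod_hom_comp[OF mod_hom_snd hf] hpr])
    fix x assume "x \<in> carrier (obj ?X i)"
    then obtain u c where x: "x = (u, c)" and u: "u \<in> carrier (obj B i)" and c: "c \<in> carrier (obj C (i - 1))" by auto
    interpret B: module R "obj B (i - 1)" by (rule mB)
    have "\<pi> (i - 1) (diff B i u \<oplus>\<^bsub>obj B (i - 1)\<^esub> eps R (i - 1) \<odot>\<^bsub>obj B (i - 1)\<^esub> ph (i - 1) (f (i - 1) c)) =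
      diff A i (\<pi> i u) \<oplus>\<^bsub>obj A (i - 1)\<^esub> eps R (i - 1) \<odot>\<^bsub>obj A (i - 1)\<^esub> (a \<odot>\<^bsub>obj A (i - 1)\<^esub> pr (i - 1) (f (i - 1) c))"
      using u c e by (simp add: mod_hom_add[OF hpi] mod_hom_smult[OF hpi] cl comm chain_diff[OF \<pi>])
    moreover have "pr (i - 1 - 1) (f (i - 1 - 1) (diff C (i - 1) c)) = diff A (i - 1) (pr (i - 1) (f (i - 1) c))"
      using c by (simp only: chain_diff[OF cf] chain_diff[OF pr] cl)
    ultimately show "?g (i - 1) (diff ?X i x) = diff ?Y i (?g i x)" by (simp add: x)
  qed
  have inj: "x \<in> boundaries ?X i" if x: "x \<in> cycles ?X i" and gx: "?g i x \<in> boundaries ?Y i" for x i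
  proof -
    obtain u c where xuc: "x = (u, c)" and u: "u \<in> carrier (obj B i)" and c: "c \<in> carrier (obj C (i - 1))"
      and cyc1: "diff B i u \<oplus>\<^bsub>obj B (i - 1)\<^esub> eps R (i - 1) \<odot>\<^bsub>obj B (i - 1)\<^esub> ph (i - 1) (f (i - 1) c) = \<zero>\<^bsub>obj B (i - 1)\<^esub>"
      and cyc2: "diff C (i - 1) c = \<zero>\<^bsub>obj C (i - 1 - 1)\<^esub>"
      using x by (auto simp: cycles_def)
    obtain p q where p: "p \<in> carrier (obj A (i + 1))" and q: "q \<in> carrier (obj A i)"
      and piu: "\<pi> i u = diff A (i + 1) p \<oplus>\<^bsub>obj A i\<^esub> eps R i \<odot>\<^bsub>obj A i\<^esub> (a \<odot>\<^bsub>obj A i\<^esub> q)"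
      and prfc: "pr (i - 1) (f (i - 1) c) = diff A i q"
      using gx by (auto simp: boundaries_def xuc)
    interpret A: module R "obj A i" by (rule mA)
    interpret B: module R "obj B i" by (rule mB)
    interpret B1: module R "obj B (i - 1)" by (rule mB)
    interpret E: module R "obj E i" by (rule mE)
    interpret C: module R "obj C i" by (rule mC)
    obtain p' where p': "p' \<in> carrier (obj B (i + 1))" "\<pi> (i + 1) p' = p" using \<pi>ex[OF p] by blast
    have dp': "diff B (i + 1) p' \<in> carrier (obj B i)" using cl p' by auto
    \<comment> \<open>Solves the first boundary equation for the component in \<open>B\<close>. As
      \<open>eps\<close> is its own inverse, \<open>\<pi> i b\<close> equals \<open>a\<close> times
      \<open>q\<close>, so \<open>q\<close> and \<open>b\<close> combine to an element of the
      pullback.\<close>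
    define b where "b = eps R i \<odot>\<^bsub>obj B i\<^esub> (u \<ominus>\<^bsub>obj B i\<^esub> diff B (i + 1) p')"
    have b: "b \<in> carrier (obj B i)" unfolding b_def using u dp' e by simp
    have "\<pi> i (u \<ominus>\<^bsub>obj B i\<^esub> diff B (i + 1) p') = eps R i \<odot>\<^bsub>obj A i\<^esub> (a \<odot>\<^bsub>obj A i\<^esub> q)"
    proof -
      have dp: "diff A (i + 1) p \<in> carrier (obj A i)" and t: "eps R i \<odot>\<^bsub>obj A i\<^esub> (a \<odot>\<^bsub>obj A i\<^esub> q) \<in> carrier (obj A i)"
        using p q a e cl by auto
      have "\<pi> i (u \<ominus>\<^bsub>obj B i\<^esub> diff B (i + 1) p') =
        diff A (i + 1) p \<oplus>\<^bsub>obj A i\<^esub> eps R i \<odot>\<^bsub>obj A i\<^esub> (a \<odot>\<^bsub>obj A i\<^esub> q) \<ominus>\<^bsub>obj A i\<^esub> diff A (i + 1) p"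
        using u dp' p' by (simp add: mod_hom_diff[OF mB mA hpi] chain_diff'[OF \<pi>] piu)
      also have "\<dots> = eps R i \<odot>\<^bsub>obj A i\<^esub> (a \<odot>\<^bsub>obj A i\<^esub> q)"
        using dp t by (simp add: a_minus_def A.M.a_ac A.M.r_neg A.M.r_neg1 A.M.r_neg2)
      finally show ?thesis .
    qed
    then have pib: "\<pi> i b = a \<odot>\<^bsub>obj A i\<^esub> q"
      unfolding b_def using u dp' e a q by (simp add: mod_hom_smult[OF hpi] eps_smult2[OF mA])
    obtain y where y: "y \<in> carrier (obj E i)" "pr i y = q" "ph i y = b" using pull[OF q b pib] by blast
    have fc: "f (i - 1) c \<in> carrier (obj E (i - 1))" using c cl by auto
    have pfc: "ph (i - 1) (f (i - 1) c) \<in> carrier (obj B (i - 1))" using fc cl by auto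
    have "diff B i b = eps R i \<odot>\<^bsub>obj B (i - 1)\<^esub> diff B i u"
      unfolding b_def using u dp' e cl p'
      by (simp add: mod_hom_smult[OF dB(1)] mod_hom_diff[OF mB mB dB(1)] cplx_dd'[OF B] B1.minus_zero_right)
    also have "diff B i u = eps R i \<odot>\<^bsub>obj B (i - 1)\<^esub> ph (i - 1) (f (i - 1) c)"
    proof -
      have du: "diff B i u \<in> carrier (obj B (i - 1))" "eps R i \<odot>\<^bsub>obj B (i - 1)\<^esub> ph (i - 1) (f (i - 1) c) \<in> carrier (obj B (i - 1))"
        using u cl pfc e by auto
      have "diff B i u \<oplus>\<^bsub>obj B (i - 1)\<^esub> \<ominus>\<^bsub>obj B (i - 1)\<^esub> (eps R i \<odot>\<^bsub>obj B (i - 1)\<^esub> ph (i - 1) (f (i - 1) c)) = \<zero>\<^bsub>obj B (i - 1)\<^esub>"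
        using cyc1 by (simp add: eps_pred[OF mB pfc])
      then show ?thesis using du by (metis B1.M.minus_equality B1.M.minus_minus B1.M.a_inv_closed B1.M.a_comm)
    qed
    finally have db: "diff B i b = ph (i - 1) (f (i - 1) c)" by (simp add: eps_smult2[OF mB pfc])
    \<comment> \<open>An element of the pullback is determined by its two projections, and both have
      been matched.\<close>
    have "diff E i y = f (i - 1) c"
      by (rule uniq[OF _ fc]) (use y cl in \<open>auto simp: chain_diff[OF pr] chain_diff[OF ph] prfc db\<close>)
    then have "f (i - 1) c \<in> boundaries E (i - 1)" using y(1) by (force simp: boundaries_def)
    moreover have "c \<in> cycles C (i - 1)" using c cyc2 by (simp add: cycles_def)
    ultimately have "c \<in> boundaries C (i - 1)" using finj by blast
    then obtain c1 where c1: "c1 \<in> carrier (obj C i)" "c = diff C i c1" by (auto simp: boundaries_def)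
    have fc1: "f i c1 \<in> carrier (obj E i)" using c1 cl by auto
    \<comment> \<open>\<open>y\<close> and \<open>f i c1\<close> have the same boundary, but
      \<open>y\<close> need not come from \<open>C\<close>. Their difference is a cycle, so changing
      \<open>c1\<close> by a cycle of \<open>C\<close> makes them agree up to a boundary.\<close>
    have "f i c1 \<ominus>\<^bsub>obj E i\<^esub> y \<in> cycles E i"
    proof -
      interpret E1: module R "obj E (i - 1)" by (rule mE)
      have "diff E i (f i c1 \<ominus>\<^bsub>obj E i\<^esub> y) = \<zero>\<^bsub>obj E (i - 1)\<^esub>"
        using fc1 y(1) fc \<open>diff E i y = f (i - 1) c\<close> c1
        by (simp add: mod_hom_diff[OF mE mE dE(1)] chain_diff[OF cf, symmetric] E1.minus_self)
      then show ?thesis using fc1 y(1) by (simp add: cycles_def)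
    qed
    from fsurj[OF this] obtain c2 z where c2: "c2 \<in> cycles C i" and z: "z \<in> carrier (obj E (i + 1))"
      "f i c1 \<ominus>\<^bsub>obj E i\<^esub> y \<ominus>\<^bsub>obj E i\<^esub> f i c2 = diff E (i + 1) z"
      by (auto simp: boundaries_def)
    have c2c: "c2 \<in> carrier (obj C i)" "diff C i c2 = \<zero>\<^bsub>obj C (i - 1)\<^esub>" using c2 by (auto simp: cycles_def)
    have fc2: "f i c2 \<in> carrier (obj E i)" and dz: "diff E (i + 1) z \<in> carrier (obj E i)" using c2c z cl by auto
    define c3 where "c3 = c1 \<ominus>\<^bsub>obj C i\<^esub> c2"
    have c3: "c3 \<in> carrier (obj C i)" unfolding c3_def using c1 c2c by simp
    have dc3: "diff C i c3 = c"
    proof -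
      interpret C1: module R "obj C (i - 1)" by (rule mC)
      show ?thesis unfolding c3_def using c1 c2c c
        by (simp add: mod_hom_diff[OF mC mC dC(1)] C1.minus_zero_right)
    qed
    have "f i c1 \<ominus>\<^bsub>obj E i\<^esub> f i c2 = y \<oplus>\<^bsub>obj E i\<^esub> (f i c1 \<ominus>\<^bsub>obj E i\<^esub> y \<ominus>\<^bsub>obj E i\<^esub> f i c2)"
      using fc1 fc2 y(1) by algebra
    then have fc3: "f i c3 = y \<oplus>\<^bsub>obj E i\<^esub> diff E (i + 1) z"
      unfolding c3_def z(2) using c1 c2c by (simp add: mod_hom_diff[OF mC mE hf])
    have phz: "ph (i + 1) z \<in> carrier (obj B (i + 1))" using z cl by auto
    interpret B2: module R "obj B (i + 1)" by (rule mB)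
    \<comment> \<open>The term in \<open>ph (i + 1) z\<close> cancels the error in
      \<open>f i c3\<close>, which is \<open>y\<close> plus the boundary of \<open>z\<close>; the
      differential of \<open>(P, c3)\<close> is then exactly \<open>x\<close>.\<close>
    define P where "P = p' \<ominus>\<^bsub>obj B (i + 1)\<^esub> eps R i \<odot>\<^bsub>obj B (i + 1)\<^esub> ph (i + 1) z"
    have P: "P \<in> carrier (obj B (i + 1))" unfolding P_def using p' phz e by simp
    define w where "w = eps R i \<odot>\<^bsub>obj B i\<^esub> diff B (i + 1) (ph (i + 1) z)"
    have w: "w \<in> carrier (obj B i)" unfolding w_def using phz cl e by auto
    have dP: "diff B (i + 1) P = diff B (i + 1) p' \<ominus>\<^bsub>obj B i\<^esub> w"
      unfolding P_def w_def using p' phz e by (simp add: mod_hom_diff[OF mB mB dB(2)] mod_hom_smult[OF dB(2)])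
    have "eps R i \<odot>\<^bsub>obj B i\<^esub> ph i (f i c3) = (u \<ominus>\<^bsub>obj B i\<^esub> diff B (i + 1) p') \<oplus>\<^bsub>obj B i\<^esub> w"
    proof -
      have "ph i (f i c3) = b \<oplus>\<^bsub>obj B i\<^esub> diff B (i + 1) (ph (i + 1) z)"
        unfolding fc3 using y z dz by (simp add: mod_hom_add[OF hph] chain_diff'[OF ph])
      then show ?thesis
        unfolding w_def using b phz cl e u dp' by (simp add: B.smult_r_distr b_def eps_smult2[OF mB])
    qed
    then have "diff B (i + 1) P \<oplus>\<^bsub>obj B i\<^esub> eps R i \<odot>\<^bsub>obj B i\<^esub> ph i (f i c3) =
      diff B (i + 1) p' \<ominus>\<^bsub>obj B i\<^esub> w \<oplus>\<^bsub>obj B i\<^esub> ((u \<ominus>\<^bsub>obj B i\<^esub> diff B (i + 1) p') \<oplus>\<^bsub>obj B i\<^esub> w)"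
      by (simp add: dP)
    also have "\<dots> = u" using u dp' w by algebra
    finally have "x = diff ?X (i + 1) (P, c3)" using dc3 by (simp add: xuc)
    moreover have "(P, c3) \<in> carrier (obj ?X (i + 1))" using P c3 by simp
    ultimately show ?thesis unfolding boundaries_def by (rule image_eqI)
  qed
  have surj: "\<exists>x \<in> cycles ?X i. w \<ominus>\<^bsub>obj ?Y i\<^esub> ?g i x \<in> boundaries ?Y i" if w: "w \<in> cycles ?Y i" for w i
  proof -
    obtain p q where wpq: "w = (p, q)" and p: "p \<in> carrier (obj A i)" and q: "q \<in> carrier (obj A (i - 1))"
      and cyc1: "diff A i p \<oplus>\<^bsub>obj A (i - 1)\<^esub> eps R (i - 1) \<odot>\<^bsub>obj A (i - 1)\<^esub> (a \<odot>\<^bsub>obj A (i - 1)\<^esub> q) = \<zero>\<^bsub>obj A (i - 1)\<^esub>"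
      and cyc2: "diff A (i - 1) q = \<zero>\<^bsub>obj A (i - 1 - 1)\<^esub>"
      using w by (auto simp: cycles_def)
    interpret A: module R "obj A i" by (rule mA)
    interpret A1: module R "obj A (i - 1)" by (rule mA)
    interpret B: module R "obj B i" by (rule mB)
    interpret B1: module R "obj B (i - 1)" by (rule mB)
    interpret E1: module R "obj E (i - 1)" by (rule mE)
    obtain p' where p': "p' \<in> carrier (obj B i)" "\<pi> i p' = p" using \<pi>ex[OF p] by blast
    \<comment> \<open>The cycle condition says that the differential of \<open>p\<close> is
      \<open>eps R i\<close> times \<open>a\<close> times \<open>q\<close>, because
      \<open>eps R (i - 1)\<close> is the opposite sign. Hence this \<open>b\<close> lies over
      \<open>a\<close> times \<open>q\<close>.\<close>
    define b where "b = eps R i \<odot>\<^bsub>obj B (i - 1)\<^esub> diff B i p'"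
    have dp': "diff B i p' \<in> carrier (obj B (i - 1))" using p' cl by auto
    have b: "b \<in> carrier (obj B (i - 1))" unfolding b_def using dp' e by simp
    have aq: "a \<odot>\<^bsub>obj A (i - 1)\<^esub> q \<in> carrier (obj A (i - 1))" using a q by simp
    have "diff A i p = eps R i \<odot>\<^bsub>obj A (i - 1)\<^esub> (a \<odot>\<^bsub>obj A (i - 1)\<^esub> q)"
    proof -
      have du: "diff A i p \<in> carrier (obj A (i - 1))" "eps R i \<odot>\<^bsub>obj A (i - 1)\<^esub> (a \<odot>\<^bsub>obj A (i - 1)\<^esub> q) \<in> carrier (obj A (i - 1))"
        using p cl aq e by auto
      have "diff A i p \<oplus>\<^bsub>obj A (i - 1)\<^esub> \<ominus>\<^bsub>obj A (i - 1)\<^esub> (eps R i \<odot>\<^bsub>obj A (i - 1)\<^esub> (a \<odot>\<^bsub>obj A (i - 1)\<^esub> q)) = \<zero>\<^bsub>obj A (i - 1)\<^esub>"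
        using cyc1 by (simp add: eps_pred[OF mA aq])
      then show ?thesis using du by (metis A1.M.minus_equality A1.M.minus_minus A1.M.a_inv_closed A1.M.a_comm)
    qed
    then have pib: "\<pi> (i - 1) b = a \<odot>\<^bsub>obj A (i - 1)\<^esub> q"
      unfolding b_def using dp' e p' aq by (simp add: mod_hom_smult[OF hpi] chain_diff[OF \<pi>] eps_smult2[OF mA])
    obtain y where y: "y \<in> carrier (obj E (i - 1))" "pr (i - 1) y = q" "ph (i - 1) y = b" using pull[OF q b pib] by blast
    have db: "diff B (i - 1) b = \<zero>\<^bsub>obj B (i - 1 - 1)\<^esub>"
      unfolding b_def using dp' e module.smult_r_null[OF mB]
      by (simp add: mod_hom_smult[OF dB(1)] cplx_dd[OF B p'(1)] del: diff_diff_eq)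
    have "diff E (i - 1) y = \<zero>\<^bsub>obj E (i - 1 - 1)\<^esub>"
    proof (rule uniq)
      show "\<zero>\<^bsub>obj E (i - 1 - 1)\<^esub> \<in> carrier (obj E (i - 1 - 1))"
        by (rule subsetD[OF module.submoduleE(1)[OF mE submodule_zero[OF mE]]]) simp
      show "diff E (i - 1) y \<in> carrier (obj E (i - 1 - 1))" by (rule cl(9)[OF y(1)])
      show "pr (i - 1 - 1) (diff E (i - 1) y) = pr (i - 1 - 1) \<zero>\<^bsub>obj E (i - 1 - 1)\<^esub>"
        unfolding chain_diff[OF pr y(1)] y(2) cyc2 by (rule mod_hom_zero[OF mE mA hpr, symmetric])
      show "ph (i - 1 - 1) (diff E (i - 1) y) = ph (i - 1 - 1) \<zero>\<^bsub>obj E (i - 1 - 1)\<^esub>"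
        unfolding chain_diff[OF ph y(1)] y(3) db by (rule mod_hom_zero[OF mE mB hph, symmetric])
    qed
    then have "y \<in> cycles E (i - 1)" using y(1) by (simp add: cycles_def)
    from fsurj[OF this] obtain c z where c: "c \<in> cycles C (i - 1)" and z: "z \<in> carrier (obj E i)"
      "y \<ominus>\<^bsub>obj E (i - 1)\<^esub> f (i - 1) c = diff E i z"
      by (auto simp: boundaries_def)
    have cc: "c \<in> carrier (obj C (i - 1))" "diff C (i - 1) c = \<zero>\<^bsub>obj C (i - 1 - 1)\<^esub>" using c by (auto simp: cycles_def)
    have fc: "f (i - 1) c \<in> carrier (obj E (i - 1))" and dz: "diff E i z \<in> carrier (obj E (i - 1))" using cc z cl by auto
    have phz: "ph i z \<in> carrier (obj B i)" and prz: "pr i z \<in> carrier (obj A i)" using z cl by auto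
    have pfc: "ph (i - 1) (f (i - 1) c) \<in> carrier (obj B (i - 1))" using fc cl by auto
    \<comment> \<open>\<open>y\<close> and \<open>f (i - 1) c\<close> differ by the boundary of
      \<open>z\<close>; subtracting this term from \<open>p'\<close> makes the pair with
      \<open>c\<close> a cycle.\<close>
    define v where "v = eps R i \<odot>\<^bsub>obj B i\<^esub> ph i z"
    have v: "v \<in> carrier (obj B i)" unfolding v_def using phz e by simp
    define u where "u = p' \<ominus>\<^bsub>obj B i\<^esub> v"
    have u: "u \<in> carrier (obj B i)" unfolding u_def using p' v by simp
    have dv: "diff B i v = eps R i \<odot>\<^bsub>obj B (i - 1)\<^esub> diff B i (ph i z)"
      unfolding v_def using phz e by (simp add: mod_hom_smult[OF dB(1)])
    have dvc: "diff B i v \<in> carrier (obj B (i - 1))" using v cl by auto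
    have "ph (i - 1) (diff E i z) = b \<ominus>\<^bsub>obj B (i - 1)\<^esub> ph (i - 1) (f (i - 1) c)"
      unfolding z(2)[symmetric] using y fc by (simp add: mod_hom_diff[OF mE mB hph])
    then have "diff B i (ph i z) = b \<ominus>\<^bsub>obj B (i - 1)\<^esub> ph (i - 1) (f (i - 1) c)"
      using z(1) by (simp add: chain_diff[OF ph])
    then have "diff B i v = eps R i \<odot>\<^bsub>obj B (i - 1)\<^esub> (b \<ominus>\<^bsub>obj B (i - 1)\<^esub> ph (i - 1) (f (i - 1) c))" by (simp add: dv)
    also have "\<dots> = diff B i p' \<ominus>\<^bsub>obj B (i - 1)\<^esub> eps R i \<odot>\<^bsub>obj B (i - 1)\<^esub> ph (i - 1) (f (i - 1) c)"
      using b pfc e dp' by (simp add: a_minus_def B1.smult_r_distr B1.smult_r_minus b_def eps_smult2[OF mB])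
    finally have dv': "diff B i v = diff B i p' \<ominus>\<^bsub>obj B (i - 1)\<^esub> eps R i \<odot>\<^bsub>obj B (i - 1)\<^esub> ph (i - 1) (f (i - 1) c)" .
    have "diff B i u \<oplus>\<^bsub>obj B (i - 1)\<^esub> eps R (i - 1) \<odot>\<^bsub>obj B (i - 1)\<^esub> ph (i - 1) (f (i - 1) c) = \<zero>\<^bsub>obj B (i - 1)\<^esub>"
    proof -
      have t: "eps R i \<odot>\<^bsub>obj B (i - 1)\<^esub> ph (i - 1) (f (i - 1) c) \<in> carrier (obj B (i - 1))" using pfc e by simp
      have "diff B i u = diff B i p' \<ominus>\<^bsub>obj B (i - 1)\<^esub> diff B i v"
        unfolding u_def using p' v by (simp add: mod_hom_diff[OF mB mB dB(1)])
      then show ?thesis unfolding dv' eps_pred[OF mB pfc] using t dp'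
        by (simp add: a_minus_def B1.M.minus_add B1.M.r_neg1 B1.M.r_neg2 B1.M.r_neg)
    qed
    then have cyc: "(u, c) \<in> cycles ?X i" using u cc by (simp add: cycles_def)
    interpret Y: module R "obj ?Y i" by (rule cplx_module[OF Y])
    have mY: "module R (prod_mod (obj A i) (obj A (i - 1)))" by (rule module_prod[OF mA mA])
    have piu: "\<pi> i u \<in> carrier (obj A i)" and prfc: "pr (i - 1) (f (i - 1) c) \<in> carrier (obj A (i - 1))" using u fc cl by auto
    have "p \<ominus>\<^bsub>obj A i\<^esub> \<pi> i u = eps R i \<odot>\<^bsub>obj A i\<^esub> (a \<odot>\<^bsub>obj A i\<^esub> pr i z)"
    proof -
      have "\<pi> i u = p \<ominus>\<^bsub>obj A i\<^esub> \<pi> i v" unfolding u_def using p' v by (simp add: mod_hom_diff[OF mB mA hpi])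
      moreover have pv: "\<pi> i v \<in> carrier (obj A i)" using v cl by auto
      moreover have "p \<ominus>\<^bsub>obj A i\<^esub> (p \<ominus>\<^bsub>obj A i\<^esub> \<pi> i v) = \<pi> i v" using p pv by algebra
      moreover have "\<pi> i v = eps R i \<odot>\<^bsub>obj A i\<^esub> (a \<odot>\<^bsub>obj A i\<^esub> pr i z)"
        unfolding v_def using phz e z by (simp add: mod_hom_smult[OF hpi] comm)
      ultimately show ?thesis by simp
    qed
    moreover have "q \<ominus>\<^bsub>obj A (i - 1)\<^esub> pr (i - 1) (f (i - 1) c) = diff A i (pr i z)"
      using y fc z by (simp add: chain_diff[OF pr, symmetric] z(2)[symmetric] mod_hom_diff[OF mE mA hpr])
    moreover have "w \<ominus>\<^bsub>obj ?Y i\<^esub> ?g i (u, c) = (p \<ominus>\<^bsub>obj A i\<^esub> \<pi> i u, q \<ominus>\<^bsub>obj A (i - 1)\<^esub> pr (i - 1) (f (i - 1) c))"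
      by (rule prod_eqI) (use p q piu prfc in \<open>simp_all add: wpq mod_hom_diff[OF mY mA mod_hom_fst] mod_hom_diff[OF mY mA mod_hom_snd]\<close>)
    moreover have "eps R i \<odot>\<^bsub>obj A i\<^esub> (a \<odot>\<^bsub>obj A i\<^esub> pr i z) \<in> carrier (obj A i)" using prz a e by simp
    \<comment> \<open>What remains of \<open>w\<close> is the cone differential of
      \<open>pr i z\<close>, placed in the shifted copy of \<open>A\<close>.\<close>
    ultimately have "w \<ominus>\<^bsub>obj ?Y i\<^esub> ?g i (u, c) = diff ?Y (i + 1) (\<zero>\<^bsub>obj A (i + 1)\<^esub>, pr i z)"
      by (simp add: mod_hom_zero[OF mA mA dA(2)])
    moreover have "(\<zero>\<^bsub>obj A (i + 1)\<^esub>, pr i z) \<in> carrier (obj ?Y (i + 1))"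
      using prz subsetD[OF module.submoduleE(1)[OF mA submodule_zero[OF mA]], of "\<zero>\<^bsub>obj A (i + 1)\<^esub>" "i + 1"] by simp
    ultimately have "w \<ominus>\<^bsub>obj ?Y i\<^esub> ?g i (u, c) \<in> boundaries ?Y i" unfolding boundaries_def by (rule image_eqI)
    then show ?thesis using cyc by blast
  qed
  show ?thesis unfolding qis_elem_def using X Y g inj surj by blast
qed


section \<open>Koszul complexes\<close>

lemma finite_index_sets: "finite (index_sets n i)"
  unfolding index_sets_def by (rule finite_subset[of _ "Pow {..<n}"]) auto

lemma index_sets_Suc:
  "J \<in> index_sets (Suc n) i \<longleftrightarrow> (if n \<in> J then J - {n} \<in> index_sets n (i - 1) else J \<in> index_sets n i)"
proof (cases "n \<in> J")
  case True
  have "J \<subseteq> {..<Suc n} \<longleftrightarrow> J - {n} \<subseteq> {..<n}" by (auto simp: less_Suc_eq)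
  moreover have "int (card (J - {n})) = int (card J) - 1" if "J \<subseteq> {..<Suc n}"
    using True card_Suc_Diff1[OF finite_subset[OF that] True] by simp
  ultimately show ?thesis using True by (auto simp: index_sets_def)
next
  case False
  then have "J \<subseteq> {..<Suc n} \<longleftrightarrow> J \<subseteq> {..<n}" by (auto simp: less_Suc_eq)
  then show ?thesis using False by (auto simp: index_sets_def)
qed

lemma index_sets_notin: "J \<in> index_sets n i \<Longrightarrow> n \<notin> J"
  by (auto simp: index_sets_def)

lemma index_sets_empty: assumes "i < 0 \<or> i > int n" shows "index_sets n i = {}"
proof (rule equals0I)
  fix J assume "J \<in> index_sets n i"
  then have J: "J \<subseteq> {..<n}" "int (card J) = i" by (simp_all add: index_sets_def)
  have "card J \<le> n" using card_mono[OF _ J(1)] by simp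
  then show False using J(2) assms by linarith
qed

lemma koszul_obj: "obj (koszul R xs M) i = dsum M (index_sets (length xs) i)"
  by (simp add: koszul_def)

lemma koszul_diff:
  "diff (koszul R xs M) i f J = (if J \<in> index_sets (length xs) (i - 1)
      then (\<Oplus>\<^bsub>M\<^esub>j\<in>{..<length xs} - J.
        (((\<ominus>\<^bsub>R\<^esub> \<one>\<^bsub>R\<^esub>) [^]\<^bsub>R\<^esub> card {l \<in> J. l < j}) \<otimes>\<^bsub>R\<^esub> xs ! j) \<odot>\<^bsub>M\<^esub> f (insert j J))
      else \<zero>\<^bsub>M\<^esub>)"
  by (simp add: koszul_def)

lemma koszul_carrier:
  "f \<in> carrier (obj (koszul R xs M) i) \<longleftrightarrow>
    (\<forall>J \<in> index_sets (length xs) i. f J \<in> carrier M) \<and> (\<forall>J. J \<notin> index_sets (length xs) i \<longrightarrow> f J = \<zero>\<^bsub>M\<^esub>)"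
  unfolding koszul_obj by (rule carrier_dsum_finite[OF finite_index_sets])

lemma koszul_closed:
  assumes "module R M" "f \<in> carrier (obj (koszul R xs M) i)" shows "f J \<in> carrier M"
  using assms(2) unfolding koszul_obj by (rule dsum_closed[OF assms(1)])

lemma neg_one_pow:
  assumes "cring R" shows "(\<ominus>\<^bsub>R\<^esub> \<one>\<^bsub>R\<^esub>) [^]\<^bsub>R\<^esub> k = eps R (int k)"
proof -
  interpret cring R by fact
  show ?thesis by (induct k) (auto simp: eps_def l_minus)
qed

lemma koszul_nil_cplx:
  assumes M: "module R M" shows "is_cplx R (koszul R [] M)"
proof -
  interpret M: module R M by fact
  have d: "diff (koszul R [] M) i f = (\<lambda>_. \<zero>\<^bsub>M\<^esub>)" for i f
    by (auto simp: koszul_diff fun_eq_iff)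
  show ?thesis unfolding is_cplx_def
    by (auto simp: d koszul_obj module_dsum[OF M] intro!: mod_homI)
qed

text \<open>The pair \<open>(u, v)\<close> stands for \<open>u + v e\<^sub>n\<close>.\<close>

definition kjoin :: "nat \<Rightarrow> (nat set \<Rightarrow> 'm) \<times> (nat set \<Rightarrow> 'm) \<Rightarrow> nat set \<Rightarrow> 'm"
  where "kjoin n x J = (if n \<in> J then snd x (J - {n}) else fst x J)"

text \<open>The new index exceeds all others. Removing it from a set costs the sign given by the
  number of remaining elements, which is the sign \<open>eps\<close> of the cone, and its presence
  changes no sign for the removal of another index. Appending at the end thus gives the cone of
  \<open>a\<close> exactly, and the complex property is inherited from the cone.\<close>

lemma koszul_snoc:
  assumes M: "module R M" and xs: "set xs \<subseteq> carrier R" and a: "a \<in> carrier R"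
    and K: "is_cplx R (koszul R xs M)"
  shows "is_cplx R (koszul R (xs @ [a]) M)"
    and "qis_elem R (cone R (\<lambda>i x. a \<odot>\<^bsub>obj (koszul R xs M) i\<^esub> x) (koszul R xs M) (koszul R xs M))
      (koszul R (xs @ [a]) M) (\<lambda>i. kjoin (length xs))"
proof -
  interpret M: module R M by fact
  let ?n = "length xs" and ?K = "koszul R xs M" and ?L = "koszul R (xs @ [a]) M"
  let ?C = "cone R (\<lambda>i x. a \<odot>\<^bsub>obj ?K i\<^esub> x) ?K ?K" and ?j = "kjoin (length xs)"
  have C: "is_cplx R ?C" by (rule is_cplx_cone[OF K K chain_map_scale[OF K a]])
  have mL: "module R (obj ?L i)" for i unfolding koszul_obj by (rule module_dsum[OF M])
  have jh: "?j \<in> mod_hom R (obj ?C i) (obj ?L i)" for i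
  proof (rule mod_homI)
    fix x y assume x: "x \<in> carrier (obj ?C i)"
    then show "?j x \<in> carrier (obj ?L i)"
      unfolding koszul_carrier by (auto simp: koszul_carrier index_sets_Suc kjoin_def simp del: dsum_simps(1))
    show "?j (x \<oplus>\<^bsub>obj ?C i\<^esub> y) = ?j x \<oplus>\<^bsub>obj ?L i\<^esub> ?j y"
      by (auto simp: kjoin_def koszul_obj fun_eq_iff)
    fix c show "?j (c \<odot>\<^bsub>obj ?C i\<^esub> x) = c \<odot>\<^bsub>obj ?L i\<^esub> ?j x"
      by (auto simp: kjoin_def koszul_obj fun_eq_iff)
  qed
  have jb: "bij_betw ?j (carrier (obj ?C i)) (carrier (obj ?L i))" for i
  \<comment> \<open>The inverse separates the coefficients at sets without the new index from those
    at sets containing it. The zeros keep both halves inside the Koszul complex of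
    \<open>xs\<close>.\<close>
  proof (rule bij_betw_byWitness[where f' = "\<lambda>y. (\<lambda>J. if ?n \<in> J then \<zero>\<^bsub>M\<^esub> else y J, \<lambda>J. if ?n \<in> J then \<zero>\<^bsub>M\<^esub> else y (insert ?n J))"])
    show "\<forall>x\<in>carrier (obj ?C i). (\<lambda>J. if ?n \<in> J then \<zero>\<^bsub>M\<^esub> else ?j x J, \<lambda>J. if ?n \<in> J then \<zero>\<^bsub>M\<^esub> else ?j x (insert ?n J)) = x"
    proof
      fix x assume "x \<in> carrier (obj ?C i)"
      then obtain u v where x: "x = (u, v)" "u \<in> carrier (obj ?K i)" "v \<in> carrier (obj ?K (i - 1))" by auto
      have "u J = \<zero>\<^bsub>M\<^esub>" "v J = \<zero>\<^bsub>M\<^esub>" if "?n \<in> J" for J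
        using x that index_sets_notin unfolding koszul_carrier by blast+
      then show "(\<lambda>J. if ?n \<in> J then \<zero>\<^bsub>M\<^esub> else ?j x J, \<lambda>J. if ?n \<in> J then \<zero>\<^bsub>M\<^esub> else ?j x (insert ?n J)) = x"
        by (auto simp: x(1) kjoin_def fun_eq_iff)
    qed
    show "\<forall>y\<in>carrier (obj ?L i). ?j (\<lambda>J. if ?n \<in> J then \<zero>\<^bsub>M\<^esub> else y J, \<lambda>J. if ?n \<in> J then \<zero>\<^bsub>M\<^esub> else y (insert ?n J)) = y"
      by (auto simp: kjoin_def fun_eq_iff insert_absorb)
    show "?j ` carrier (obj ?C i) \<subseteq> carrier (obj ?L i)" using mod_hom_closed[OF jh] by auto
    have "insert ?n J \<in> index_sets (Suc ?n) i \<longleftrightarrow> J \<in> index_sets ?n (i - 1)" if "?n \<notin> J" for J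
      using that by (simp add: index_sets_Suc)
    moreover have "J \<in> index_sets (Suc ?n) i \<longleftrightarrow> J \<in> index_sets ?n i" if "?n \<notin> J" for J
      using that by (simp add: index_sets_Suc)
    ultimately show "(\<lambda>y. (\<lambda>J. if ?n \<in> J then \<zero>\<^bsub>M\<^esub> else y J, \<lambda>J. if ?n \<in> J then \<zero>\<^bsub>M\<^esub> else y (insert ?n J))) ` carrier (obj ?L i) \<subseteq> carrier (obj ?C i)"
      by (auto simp: koszul_carrier index_sets_notin simp del: dsum_simps(1))
  qed
  have jd: "?j (diff ?C i x) = diff ?L i (?j x)" if x: "x \<in> carrier (obj ?C i)" for i x
  proof
    fix J
    obtain u v where uv: "x = (u, v)" "u \<in> carrier (obj ?K i)" "v \<in> carrier (obj ?K (i - 1))" using x by auto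
    have c: "u S \<in> carrier M" "v S \<in> carrier M" for S
      by (rule koszul_closed[OF M uv(2)], rule koszul_closed[OF M uv(3)])
    have xc: "xs ! k \<in> carrier R" if "k < ?n" for k using xs that by auto
    let ?s = "\<lambda>J k. ((\<ominus>\<^bsub>R\<^esub> \<one>\<^bsub>R\<^esub>) [^]\<^bsub>R\<^esub> card {l \<in> J. l < k})"
    have sc: "?s J k \<in> carrier R" for J k by simp
    show "?j (diff ?C i x) J = diff ?L i (?j x) J"
    proof (cases "J \<in> index_sets (Suc ?n) (i - 1)")
      case False
      \<comment> \<open>Outside the index sets both sides vanish: the left because
        \<open>kjoin\<close> lands in the Koszul term, the right by definition.\<close>
      have "?j (diff ?C i x) \<in> carrier (obj ?L (i - 1))"
        by (rule mod_hom_closed[OF jh mod_hom_closed[OF cplx_hom[OF C] x]])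
      then show ?thesis using False unfolding koszul_carrier by (simp add: koszul_diff)
    next
      case True
      show ?thesis
      proof (cases "?n \<in> J")
        case False
        then have J: "J \<in> index_sets ?n (i - 1)" using True by (simp add: index_sets_Suc)
        then have sub: "J \<subseteq> {..<?n}" and cJ: "int (card J) = i - 1" by (auto simp: index_sets_def)
        let ?t = "\<lambda>k. (?s J k \<otimes>\<^bsub>R\<^esub> (xs @ [a]) ! k) \<odot>\<^bsub>M\<^esub> ?j x (insert k J)"
        have "diff ?L i (?j x) J = (\<Oplus>\<^bsub>M\<^esub>k\<in>insert ?n ({..<?n} - J). ?t k)"
        proof -
          have "{..<Suc ?n} - J = insert ?n ({..<?n} - J)" using False by auto
          then show ?thesis using True by (simp add: koszul_diff)
        qed
        also have "\<dots> = ?t ?n \<oplus>\<^bsub>M\<^esub> (\<Oplus>\<^bsub>M\<^esub>k\<in>{..<?n} - J. ?t k)"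
          by (rule M.finsum_insert) (use c xc a sc in \<open>auto simp: nth_append kjoin_def uv(1)\<close>)
        also have "(\<Oplus>\<^bsub>M\<^esub>k\<in>{..<?n} - J. ?t k) = (\<Oplus>\<^bsub>M\<^esub>k\<in>{..<?n} - J. (?s J k \<otimes>\<^bsub>R\<^esub> xs ! k) \<odot>\<^bsub>M\<^esub> u (insert k J))"
          by (rule M.finsum_cong'[OF refl]) (use False c xc sc in \<open>auto simp: nth_append kjoin_def uv(1)\<close>)
        also have "\<dots> = diff ?K i u J" using J by (simp add: koszul_diff)
        also have "?t ?n = eps R (i - 1) \<odot>\<^bsub>M\<^esub> (a \<odot>\<^bsub>M\<^esub> v J)"
        proof -
          have "{l \<in> J. l < ?n} = J" using sub by auto
          then have "?s J ?n = eps R (i - 1)" by (simp add: neg_one_pow[OF M.R.is_cring] cJ)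
          then show ?thesis using False a c eps_closed[OF M.R.is_cring]
            by (simp add: kjoin_def uv(1) M.smult_assoc1)
        qed
        also have "diff ?K i u J \<in> carrier M"
          using dsum_closed[OF M mod_hom_closed[OF cplx_hom[OF K] uv(2), unfolded koszul_obj]] .
        then have "eps R (i - 1) \<odot>\<^bsub>M\<^esub> (a \<odot>\<^bsub>M\<^esub> v J) \<oplus>\<^bsub>M\<^esub> diff ?K i u J = ?j (diff ?C i x) J"
          using False c a eps_closed[OF M.R.is_cring] by (simp add: kjoin_def uv(1) koszul_obj M.M.a_comm)
        finally show ?thesis by simp
      next
        case n: True
        let ?J = "J - {?n}"
        have J: "?J \<in> index_sets ?n (i - 1 - 1)" using True n by (simp add: index_sets_Suc)
        have "diff ?L i (?j x) J = (\<Oplus>\<^bsub>M\<^esub>k\<in>{..<?n} - ?J. (?s J k \<otimes>\<^bsub>R\<^esub> (xs @ [a]) ! k) \<odot>\<^bsub>M\<^esub> ?j x (insert k J))"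
        proof -
          have "{..<Suc ?n} - J = {..<?n} - ?J" using n by (auto simp: less_Suc_eq)
          then show ?thesis using True by (simp add: koszul_diff)
        qed
        also have "\<dots> = (\<Oplus>\<^bsub>M\<^esub>k\<in>{..<?n} - ?J. (?s ?J k \<otimes>\<^bsub>R\<^esub> xs ! k) \<odot>\<^bsub>M\<^esub> v (insert k ?J))"
        proof (rule M.finsum_cong'[OF refl])
          fix k assume k: "k \<in> {..<?n} - ?J"
          then have "{l \<in> J. l < k} = {l \<in> ?J. l < k}" "insert k J - {?n} = insert k ?J" by auto
          then show "(?s J k \<otimes>\<^bsub>R\<^esub> (xs @ [a]) ! k) \<odot>\<^bsub>M\<^esub> ?j x (insert k J) = (?s ?J k \<otimes>\<^bsub>R\<^esub> xs ! k) \<odot>\<^bsub>M\<^esub> v (insert k ?J)"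
            using k n by (simp add: nth_append kjoin_def uv(1))
        qed (use c xc sc in auto)
        also have "\<dots> = diff ?K (i - 1) v ?J" using J by (simp add: koszul_diff)
        also have "\<dots> = ?j (diff ?C i x) J" using n by (simp add: kjoin_def uv(1))
        finally show ?thesis by simp
      qed
    qed
  qed
  show "is_cplx R ?L" using C mL jh jb jd by (rule iso_cplx(1))
  show "qis_elem R ?C ?L (\<lambda>i. kjoin ?n)"
    using iso_cplx(2)[where j = "\<lambda>i. kjoin ?n" and Y = ?L, OF C mL] jh jb jd by blast
qed

lemma koszul_cplx:
  assumes "module R M" "set xs \<subseteq> carrier R" shows "is_cplx R (koszul R xs M)"
  using assms(2) by (induct xs rule: rev_induct) (auto intro: koszul_nil_cplx koszul_snoc(1) assms(1))

section \<open>Functoriality of the Koszul complex in the module\<close>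

lemma mod_hom_finsum:
  assumes "module R M" "module R N" "h \<in> mod_hom R M N" "finite A" "g \<in> A \<rightarrow> carrier M"
  shows "h (\<Oplus>\<^bsub>M\<^esub>x\<in>A. g x) = (\<Oplus>\<^bsub>N\<^esub>x\<in>A. h (g x))"
proof -
  interpret M: module R M by fact
  interpret N: module R N by fact
  show ?thesis using assms(4,5)
  proof induct
    case empty then show ?case by (simp add: mod_hom_zero[OF assms(1-3)])
  next
    case (insert x A)
    then have g: "g \<in> A \<rightarrow> carrier M" "g x \<in> carrier M" by auto
    have "h (\<Oplus>\<^bsub>M\<^esub>x\<in>insert x A. g x) = h (g x \<oplus>\<^bsub>M\<^esub> (\<Oplus>\<^bsub>M\<^esub>x\<in>A. g x))"
      using insert(1,2) g by (simp add: M.M.finsum_insert)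
    also have "\<dots> = h (g x) \<oplus>\<^bsub>N\<^esub> (\<Oplus>\<^bsub>N\<^esub>x\<in>A. h (g x))"
      using insert(3)[OF g(1)] g by (simp add: mod_hom_add[OF assms(3)] M.M.finsum_closed)
    also have "\<dots> = (\<Oplus>\<^bsub>N\<^esub>x\<in>insert x A. h (g x))"
      using insert(1,2) g mod_hom_closed[OF assms(3)] by (intro N.M.finsum_insert[symmetric]) auto
    finally show ?case .
  qed
qed

lemma mod_hom_dsum_map:
  assumes "module R M" "module R N" "h \<in> mod_hom R M N"
  shows "(\<lambda>f i. h (f i)) \<in> mod_hom R (dsum M I) (dsum N I)"
proof (rule mod_homI)
  fix x y assume x: "x \<in> carrier (dsum M I)" and y: "y \<in> carrier (dsum M I)"
  note z = mod_hom_zero[OF assms]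
  have "finite {i. h (x i) \<noteq> \<zero>\<^bsub>N\<^esub>}" by (rule finite_subset[of _ "{i. x i \<noteq> \<zero>\<^bsub>M\<^esub>}"]) (use x z in auto)
  then show "(\<lambda>i. h (x i)) \<in> carrier (dsum N I)" using x z by (auto intro: mod_hom_closed[OF assms(3)])
  show "(\<lambda>i. h ((x \<oplus>\<^bsub>dsum M I\<^esub> y) i)) = (\<lambda>i. h (x i)) \<oplus>\<^bsub>dsum N I\<^esub> (\<lambda>i. h (y i))"
    using dsum_closed[OF assms(1) x] dsum_closed[OF assms(1) y] by (simp add: mod_hom_add[OF assms(3)] del: dsum_simps(1))
  fix a assume "a \<in> carrier R"
  then show "(\<lambda>i. h ((a \<odot>\<^bsub>dsum M I\<^esub> x) i)) = a \<odot>\<^bsub>dsum N I\<^esub> (\<lambda>i. h (x i))"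
    using dsum_closed[OF assms(1) x] by (simp add: mod_hom_smult[OF assms(3)] del: dsum_simps(1))
qed

lemma koszul_map:
  assumes M: "module R M" and N: "module R N" and h: "h \<in> mod_hom R M N" and xs: "set xs \<subseteq> carrier R"
  shows "chain_map R (koszul R xs M) (koszul R xs N) (\<lambda>i f J. h (f J))"
proof (rule chain_mapI)
  fix i
  show "(\<lambda>f J. h (f J)) \<in> mod_hom R (obj (koszul R xs M) i) (obj (koszul R xs N) i)"
    unfolding koszul_obj by (rule mod_hom_dsum_map[OF M N h])
  interpret M: module R M by fact
  interpret N: module R N by fact
  fix f assume f: "f \<in> carrier (obj (koszul R xs M) i)"
  have fc: "f J \<in> carrier M" for J by (rule koszul_closed[OF M f])
  have xc: "xs ! k \<in> carrier R" if "k < length xs" for k using xs that by auto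
  show "(\<lambda>J. h (diff (koszul R xs M) i f J)) = diff (koszul R xs N) i (\<lambda>J. h (f J))"
  proof
    fix J
    let ?s = "\<lambda>j. ((\<ominus>\<^bsub>R\<^esub> \<one>\<^bsub>R\<^esub>) [^]\<^bsub>R\<^esub> card {l \<in> J. l < j}) \<otimes>\<^bsub>R\<^esub> xs ! j"
    have "h (\<Oplus>\<^bsub>M\<^esub>j\<in>{..<length xs} - J. ?s j \<odot>\<^bsub>M\<^esub> f (insert j J)) = (\<Oplus>\<^bsub>N\<^esub>j\<in>{..<length xs} - J. h (?s j \<odot>\<^bsub>M\<^esub> f (insert j J)))"
      by (rule mod_hom_finsum[OF M N h]) (use fc xc in auto)
    also have "\<dots> = (\<Oplus>\<^bsub>N\<^esub>j\<in>{..<length xs} - J. ?s j \<odot>\<^bsub>N\<^esub> h (f (insert j J)))"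
      by (rule N.M.finsum_cong'[OF refl]) (use fc xc in \<open>auto simp: mod_hom_smult[OF h] mod_hom_closed[OF h]\<close>)
    finally show "h (diff (koszul R xs M) i f J) = diff (koszul R xs N) i (\<lambda>J. h (f J)) J"
      by (simp add: koszul_diff mod_hom_zero[OF M N h])
  qed
qed


section \<open>The approximating complex\<close>

text \<open>The fibre product is characterized rather than constructed, so that \<open>N\<close> may
  be a copy of it with elements in \<open>nat => 'a\<close>.\<close>

definition pullback ::
  "('a, 'r) ring_scheme \<Rightarrow> ('a, 'm, 'c) module_scheme \<Rightarrow> ('a, 'f, 'd) module_scheme \<Rightarrow> ('f \<Rightarrow> 'm) \<Rightarrow> 'a \<Rightarrow>
    ('a, 'n, 'e) module_scheme \<Rightarrow> ('n \<Rightarrow> 'm) \<Rightarrow> ('n \<Rightarrow> 'f) \<Rightarrow> bool"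
  where "pullback R M F \<pi> a N pr ph \<longleftrightarrow> pr \<in> mod_hom R N M \<and> ph \<in> mod_hom R N F \<and>
    (\<forall>y \<in> carrier N. \<pi> (ph y) = a \<odot>\<^bsub>M\<^esub> pr y) \<and>
    (\<forall>q \<in> carrier M. \<forall>b \<in> carrier F. \<pi> b = a \<odot>\<^bsub>M\<^esub> q \<longrightarrow> (\<exists>y \<in> carrier N. pr y = q \<and> ph y = b)) \<and>
    (\<forall>y \<in> carrier N. \<forall>y' \<in> carrier N. pr y = pr y' \<longrightarrow> ph y = ph y' \<longrightarrow> y = y')"

text \<open>The fibre product is a submodule \<open>D\<close> of a noetherian product. It is
  therefore finitely generated, which is what permits renaming its elements into
  \<open>nat => 'a\<close>.\<close>

lemma ex_pullback:
  fixes M :: "('a, 'm, 'c) module_scheme" and F :: "('a, 'f, 'd) module_scheme"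
  assumes M: "noeth R M" and F: "noeth R F" and \<pi>: "\<pi> \<in> mod_hom R F M" and a: "a \<in> carrier R"
  shows "\<exists>(N :: ('a, nat \<Rightarrow> 'a) module) pr ph. noeth R N \<and> pullback R M F \<pi> a N pr ph"
proof -
  note m = noeth_module[OF M] noeth_module[OF F]
  interpret M: module R M by (rule m)
  let ?P = "prod_mod M F"
  define D where "D = {x \<in> carrier ?P. \<pi> (snd x) \<ominus>\<^bsub>M\<^esub> a \<odot>\<^bsub>M\<^esub> fst x \<in> {\<zero>\<^bsub>M\<^esub>}}"
  have D: "submodule D R ?P"
    unfolding D_def
    by (intro submodule_preimage[OF module_prod[OF m] m(1) _ submodule_zero[OF m(1)]]
      mod_hom_minus_fun[OF m(1)] mod_hom_comp[OF mod_hom_snd \<pi>] mod_hom_comp[OF mod_hom_fst mod_hom_scale[OF m(1) a]])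
  have inD: "(q, b) \<in> D \<longleftrightarrow> q \<in> carrier M \<and> b \<in> carrier F \<and> \<pi> b = a \<odot>\<^bsub>M\<^esub> q" for q b
  proof -
    have "\<pi> b \<ominus>\<^bsub>M\<^esub> a \<odot>\<^bsub>M\<^esub> q = \<zero>\<^bsub>M\<^esub> \<longleftrightarrow> \<pi> b = a \<odot>\<^bsub>M\<^esub> q" if "q \<in> carrier M" "b \<in> carrier F"
      using that a mod_hom_closed[OF \<pi>] by (simp add: M.minus_eq_zero_iff)
    then show ?thesis by (auto simp: D_def)
  qed
  let ?D = "?P\<lparr>carrier := D\<rparr>"
  have mD: "module R ?D" by (rule module_restrict[OF module_prod[OF m] D])
  have nD: "noeth R ?D"
    by (rule noeth_inj[OF mD noeth_prod[OF M F], of "\<lambda>x. x"])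
      (auto intro!: mod_homI simp: D_def)
  obtain \<phi> :: "'m \<times> 'f \<Rightarrow> nat \<Rightarrow> 'a" where \<phi>: "inj_on \<phi> (carrier ?D)"
    using fg_embeds[OF mD noeth_fg[OF nD]] by blast
  let ?N = "img_mod ?D \<phi>" and ?i = "inv_into (carrier ?D) \<phi>"
  have N: "module R ?N" and h: "\<phi> \<in> mod_hom R ?D ?N" and h': "?i \<in> mod_hom R ?N ?D"
    using ex_transport[OF mD \<phi>] by auto
  have cN: "carrier ?N = \<phi> ` D" by (simp add: img_mod_def)
  have i: "?i (\<phi> x) = x" if "x \<in> D" for x using \<phi> that by simp
  have hf: "fst \<in> mod_hom R ?D M" and hs: "snd \<in> mod_hom R ?D F"
    by (auto intro!: mod_homI simp: inD)
  have "noeth R ?N" by (rule noeth_surj[OF nD N h]) (simp add: cN)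
  moreover have "\<pi> (snd (?i y)) = a \<odot>\<^bsub>M\<^esub> fst (?i y)" if "y \<in> carrier ?N" for y
    using that i inD by (auto simp: cN)
  moreover have "\<exists>y \<in> carrier ?N. fst (?i y) = q \<and> snd (?i y) = b"
    if "q \<in> carrier M" "b \<in> carrier F" "\<pi> b = a \<odot>\<^bsub>M\<^esub> q" for q b
    using that i[of "(q, b)"] inD[of q b] unfolding cN by force
  moreover have "y = y'" if "y \<in> carrier ?N" "y' \<in> carrier ?N" "fst (?i y) = fst (?i y')" "snd (?i y) = snd (?i y')" for y y'
    using that i unfolding cN by (auto simp del: inv_into_f_f)
  ultimately have "noeth R ?N \<and> pullback R M F \<pi> a ?N (\<lambda>y. fst (?i y)) (\<lambda>y. snd (?i y))"
    unfolding pullback_def using mod_hom_comp[OF h' hf] mod_hom_comp[OF h' hs] by blast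
  then show ?thesis by blast
qed

text \<open>All terms are renamed degree by degree and the differential is conjugated. The maps
  \<open>j\<close> and \<open>k\<close> are recorded because finiteness, factorization and retracts
  travel along them.\<close>

lemma transport_cplx:
  fixes X :: "('a, 'v) mod_cplx"
  assumes X: "is_cplx R X" and noe: "\<And>i. noeth R (obj X i)"
  shows "\<exists>(C :: ('a, nat \<Rightarrow> 'a) mod_cplx) j k. qis_elem R C X k \<and>
    (\<forall>i. j i \<in> mod_hom R (obj X i) (obj C i) \<and> k i \<in> mod_hom R (obj C i) (obj X i) \<and>
      (\<forall>x \<in> carrier (obj X i). k i (j i x) = x) \<and> (\<forall>y \<in> carrier (obj C i). j i (k i y) = y))"
proof -
  have "\<exists>\<phi> :: 'v \<Rightarrow> nat \<Rightarrow> 'a. inj_on \<phi> (carrier (obj X i))" for i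
    using fg_embeds[OF noeth_module[OF noe] noeth_fg[OF noe]] .
  then obtain \<phi> :: "int \<Rightarrow> 'v \<Rightarrow> nat \<Rightarrow> 'a" where \<phi>: "\<And>i. inj_on (\<phi> i) (carrier (obj X i))" by metis
  define k where "k i = inv_into (carrier (obj X i)) (\<phi> i)" for i
  define C :: "('a, nat \<Rightarrow> 'a) mod_cplx"
    where "C = \<lparr>obj = \<lambda>i. img_mod (obj X i) (\<phi> i), diff = \<lambda>i y. \<phi> (i - 1) (diff X i (k i y))\<rparr>"
  note t = ex_transport[OF cplx_module[OF X] \<phi>]
  have mC: "module R (obj C i)" and j: "\<phi> i \<in> mod_hom R (obj X i) (obj C i)" and k: "k i \<in> mod_hom R (obj C i) (obj X i)" for i
    using t[of i] by (simp_all add: C_def k_def)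
  have kj: "k i (\<phi> i x) = x" if "x \<in> carrier (obj X i)" for i x using \<phi> that by (simp add: k_def)
  have cC: "carrier (obj C i) = \<phi> i ` carrier (obj X i)" for i by (simp add: C_def img_mod_def)
  have jk: "\<phi> i (k i y) = y" if "y \<in> carrier (obj C i)" for i y using kj that by (auto simp: cC)
  have d: "\<phi> (i - 1) (diff X i x) = diff C i (\<phi> i x)" if "x \<in> carrier (obj X i)" for i x
    using kj[OF that] by (simp add: C_def)
  have bij: "bij_betw (\<phi> i) (carrier (obj X i)) (carrier (obj C i))" for i
    using \<phi> by (simp add: bij_betw_def cC)
  have C: "is_cplx R C" by (rule iso_cplx(1)[OF X mC j bij d])
  have "qis_elem R C X k"
  proof (rule iso_cplx(2)[OF C cplx_module[OF X] k])
    show "bij_betw (k i) (carrier (obj C i)) (carrier (obj X i))" for i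
      by (rule bij_betw_byWitness[where f' = "\<phi> i"])
        (use jk kj mod_hom_closed[OF j] mod_hom_closed[OF k] in auto)
    fix i y assume y: "y \<in> carrier (obj C i)"
    show "k (i - 1) (diff C i y) = diff X i (k i y)"
      using kj mod_hom_closed[OF cplx_hom[OF X] mod_hom_closed[OF k y]] by (simp add: C_def)
  qed
  then show ?thesis using j k kj jk by (intro exI[of _ C] exI[of _ \<phi>] exI[of _ k]) blast
qed

text \<open>The complex sought by the theorem in a form suited to induction: \<open>noeth\<close>
  stands for finite generation, \<open>fac\<close> of the identity for projectivity,
  \<open>retract\<close> for being a direct summand.\<close>

definition approx ::
  "('a, 'r) ring_scheme \<Rightarrow> 'a list \<Rightarrow> ('a, 'm, 'c) module_scheme \<Rightarrow> ('a, 'v) mod_cplx \<Rightarrow>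
    (int \<Rightarrow> 'v \<Rightarrow> nat set \<Rightarrow> 'm) \<Rightarrow> bool"
  where "approx R xs M C f \<longleftrightarrow> qis_elem R C (koszul R xs M) f \<and> (\<forall>i. noeth R (obj C i)) \<and>
    (\<forall>i. i < 0 \<or> i > int (length xs) \<longrightarrow> carrier (obj C i) = {\<zero>\<^bsub>obj C i\<^esub>}) \<and>
    (\<forall>i. 0 \<le> i \<and> i < int (length xs) \<longrightarrow> fac R (obj C i) (obj C i) (\<lambda>x. x)) \<and>
    retract R M (obj C (int (length xs)))"

text \<open>A cone has pairs as elements, so its type would grow with every step. Returning to
  \<open>nat => 'a\<close> makes the conclusion of a step fit the hypothesis of the next.\<close>

lemma approx_transport:
  fixes X :: "('a, 'v) mod_cplx" and f :: "int \<Rightarrow> 'v \<Rightarrow> nat set \<Rightarrow> 'm"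
  assumes ap: "approx R xs M X f"
  shows "\<exists>(C :: ('a, nat \<Rightarrow> 'a) mod_cplx) g. approx R xs M C g"
proof -
  have X: "is_cplx R X" and q: "qis_elem R X (koszul R xs M) f" and noe: "\<And>i. noeth R (obj X i)"
    and z: "\<And>i. i < 0 \<or> i > int (length xs) \<Longrightarrow> carrier (obj X i) = {\<zero>\<^bsub>obj X i\<^esub>}"
    and fc: "\<And>i. 0 \<le> i \<Longrightarrow> i < int (length xs) \<Longrightarrow> fac R (obj X i) (obj X i) (\<lambda>x. x)"
    and re: "retract R M (obj X (int (length xs)))"
    using ap by (auto simp: approx_def qis_elem_def)
  obtain C :: "('a, nat \<Rightarrow> 'a) mod_cplx" and j k where C: "qis_elem R C X k"
    and "\<forall>i. j i \<in> mod_hom R (obj X i) (obj C i) \<and> k i \<in> mod_hom R (obj C i) (obj X i) \<and>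
      (\<forall>x \<in> carrier (obj X i). k i (j i x) = x) \<and> (\<forall>y \<in> carrier (obj C i). j i (k i y) = y)"
    using transport_cplx[OF X noe] by blast
  then have j: "\<And>i. j i \<in> mod_hom R (obj X i) (obj C i)" and k: "\<And>i. k i \<in> mod_hom R (obj C i) (obj X i)"
    and kj: "\<And>i x. x \<in> carrier (obj X i) \<Longrightarrow> k i (j i x) = x" and jk: "\<And>i y. y \<in> carrier (obj C i) \<Longrightarrow> j i (k i y) = y"
    by blast+
  have Cc: "is_cplx R C" using C by (simp add: qis_elem_def)
  note mC = cplx_module[OF Cc] and mX = cplx_module[OF X]
  have "noeth R (obj C i)" for i
    by (rule noeth_inj[OF mC noe k]) (metis inj_on_inverseI jk)
  moreover have "carrier (obj C i) = {\<zero>\<^bsub>obj C i\<^esub>}" if "i < 0 \<or> i > int (length xs)" for i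
  proof -
    interpret module R "obj C i" by (rule mC)
    have "y = \<zero>\<^bsub>obj C i\<^esub>" if y: "y \<in> carrier (obj C i)" for y
      using jk[OF y] mod_hom_closed[OF k y] z[OF \<open>i < 0 \<or> i > int (length xs)\<close>] mod_hom_zero[OF mX mC j, of i] by auto
    then show ?thesis by auto
  qed
  moreover have "fac R (obj C i) (obj C i) (\<lambda>x. x)" if "0 \<le> i" "i < int (length xs)" for i
    by (rule fac_iso[OF mC mX k j jk fc[OF that]])
  moreover have "retract R M (obj C (int (length xs)))"
    by (rule retract_trans[OF re retractI[where i = "j (int (length xs))" and p = "k (int (length xs))", OF mX mC j k kj]])
  ultimately show ?thesis unfolding approx_def using qis_elem_comp[OF C q] by blast
qed

text \<open>Without elements the Koszul complex is a copy of \<open>M\<close> in degree 0, which is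
  already the top degree, and no term has to be projective.\<close>

lemma approx_nil:
  fixes M :: "('a, 'm, 'c) module_scheme"
  assumes M: "noeth R M"
  shows "\<exists>(C :: ('a, nat \<Rightarrow> 'a) mod_cplx) g. approx R [] M C g"
proof (rule approx_transport)
  note m = noeth_module[OF M]
  interpret module R M by (rule m)
  note K = koszul_nil_cplx[OF m]
  have "qis_elem R (koszul R [] M) (koszul R [] M) (\<lambda>i x. x)"
    by (rule iso_cplx(2)[OF K cplx_module[OF K] mod_hom_id]) (auto simp: bij_betw_def)
  moreover have "noeth R (obj (koszul R [] M) i)" for i
    unfolding koszul_obj by (rule noeth_dsum[OF M finite_index_sets])
  moreover have "carrier (obj (koszul R [] M) i) = {\<zero>\<^bsub>obj (koszul R [] M) i\<^esub>}" if "i < 0 \<or> i > int (length [])" for i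
    using index_sets_empty[OF that] by (auto simp: koszul_obj)
  moreover have "retract R M (obj (koszul R [] M) (int (length [])))"
  proof -
    have i: "{} \<in> index_sets 0 0" by (simp add: index_sets_def)
    show ?thesis unfolding koszul_obj
      by (rule retractI[OF m module_dsum[OF m] mod_hom_inject[OF m] mod_hom_coord]) (use i in auto)
  qed
  ultimately show "approx R [] M (koszul R [] M) (\<lambda>i x. x)" unfolding approx_def by auto
qed

text \<open>Multiplication by \<open>a\<close> on \<open>M\<close> lifts to \<open>f : M \<rightarrow> F\<close> along a free cover \<open>\<pi> : F \<rightarrow> M\<close>, and the pullback \<open>N\<close>
  of \<open>\<pi>\<close> along \<open>a\<close> is then \<open>M \<oplus> ker \<pi>\<close>.  The elements \<open>b\<close> keep factoring through free modules on \<open>N\<close>, as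
  \<open>b (m, u) = (\<pi> f\<^sub>b m, f \<pi> f\<^sub>b m) + (0, b v - f\<^sub>b \<pi> v)\<close> for \<open>v = u - f m\<close>.\<close>

lemma approx_snoc:
  fixes M :: "('a, 'm, 'c) module_scheme"
  assumes R: "cring R" "noetherian_ring R" and xs: "set xs \<subseteq> carrier R" and a: "a \<in> carrier R"
    and M: "noeth R M" and facM: "\<And>b. b \<in> insert a (set xs) \<Longrightarrow> fac R M M (\<lambda>x. b \<odot>\<^bsub>M\<^esub> x)"
    and IH: "\<And>N :: ('a, nat \<Rightarrow> 'a) module. noeth R N \<Longrightarrow>
      (\<And>b. b \<in> set xs \<Longrightarrow> fac R N N (\<lambda>x. b \<odot>\<^bsub>N\<^esub> x)) \<Longrightarrow>
      \<exists>(C :: ('a, nat \<Rightarrow> 'a) mod_cplx) g. approx R xs N C g"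
  shows "\<exists>(C :: ('a, nat \<Rightarrow> 'a) mod_cplx) g. approx R (xs @ [a]) M C g"
proof -
  note m = noeth_module[OF M]
  interpret M: module R M by (rule m)
  obtain S :: "'m set" and \<pi> where S: "finite S" and \<pi>: "\<pi> \<in> mod_hom R (dsum (self_module R) S) M"
    and \<pi>s: "\<pi> ` carrier (dsum (self_module R) S) = carrier M"
    using ex_free_cover[OF R(1) m noeth_fg[OF M]] by blast
  define F where "F = dsum (self_module R) S"
  have F: "noeth R F" unfolding F_def by (rule noeth_dsum[OF noeth_self[OF R] S])
  note mF = noeth_module[OF F]
  interpret F: module R F by (rule mF)
  have facF: "fac R F F (\<lambda>x. x)" unfolding F_def by (rule fac_dsum[OF module_self[OF R(1)] fac_self[OF R(1)] S])
  note \<pi> = \<pi>[folded F_def] and \<pi>s = \<pi>s[folded F_def]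
  have lift: "\<exists>f. fac R M F f \<and> (\<forall>x \<in> carrier M. \<pi> (f x) = b \<odot>\<^bsub>M\<^esub> x)" if "b \<in> insert a (set xs)" for b
    by (rule fac_lift[OF m m mF \<pi> \<pi>s facM[OF that]])
  obtain f where f: "fac R M F f" "\<And>x. x \<in> carrier M \<Longrightarrow> \<pi> (f x) = a \<odot>\<^bsub>M\<^esub> x" using lift[of a] by auto
  note hf = fac_hom[OF m mF f(1)]
  obtain N :: "('a, nat \<Rightarrow> 'a) module" and pr ph where N: "noeth R N" and pb: "pullback R M F \<pi> a N pr ph"
    using ex_pullback[OF M F \<pi> a] by blast
  have pr: "pr \<in> mod_hom R N M" and ph: "ph \<in> mod_hom R N F"
    and comm: "\<And>y. y \<in> carrier N \<Longrightarrow> \<pi> (ph y) = a \<odot>\<^bsub>M\<^esub> pr y"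
    and pull: "\<And>q b. q \<in> carrier M \<Longrightarrow> b \<in> carrier F \<Longrightarrow> \<pi> b = a \<odot>\<^bsub>M\<^esub> q \<Longrightarrow> \<exists>y \<in> carrier N. pr y = q \<and> ph y = b"
    and uniq: "\<And>y y'. y \<in> carrier N \<Longrightarrow> y' \<in> carrier N \<Longrightarrow> pr y = pr y' \<Longrightarrow> ph y = ph y' \<Longrightarrow> y = y'"
    using pb unfolding pullback_def by simp_all
  note mN = noeth_module[OF N]
  interpret N: module R N by (rule mN)
  \<comment> \<open>The universal property of the pullback; it produces the section of
    \<open>pr\<close> and the two maps \<open>p1\<close> and \<open>p2\<close> below.\<close>
  have univ: "\<exists>h. h \<in> mod_hom R L N \<and> (\<forall>x \<in> carrier L. pr (h x) = g1 x \<and> ph (h x) = g2 x)"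
    if L: "module R L" and g1: "g1 \<in> mod_hom R L M" and g2: "g2 \<in> mod_hom R L F"
      and eq: "\<And>x. x \<in> carrier L \<Longrightarrow> \<pi> (g2 x) = a \<odot>\<^bsub>M\<^esub> g1 x"
    for L :: "('a, 'l, 'e) module_scheme" and g1 g2
  proof -
    interpret L: module R L by (rule L)
    have "\<forall>x \<in> carrier L. \<exists>y \<in> carrier N. pr y = g1 x \<and> ph y = g2 x"
      using pull[OF mod_hom_closed[OF g1] mod_hom_closed[OF g2] eq] by blast
    then obtain h where h: "\<And>x. x \<in> carrier L \<Longrightarrow> h x \<in> carrier N \<and> pr (h x) = g1 x \<and> ph (h x) = g2 x" by metis
    have "h \<in> mod_hom R L N"
    proof (rule mod_homI)
      fix x y c assume x: "x \<in> carrier L"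
      then show "h x \<in> carrier N" using h by blast
      {
        assume y: "y \<in> carrier L"
        show "h (x \<oplus>\<^bsub>L\<^esub> y) = h x \<oplus>\<^bsub>N\<^esub> h y"
          by (rule uniq) (use x y h in \<open>auto simp: mod_hom_add[OF pr] mod_hom_add[OF ph] mod_hom_add[OF g1] mod_hom_add[OF g2]\<close>)
      }
      assume c: "c \<in> carrier R"
      show "h (c \<odot>\<^bsub>L\<^esub> x) = c \<odot>\<^bsub>N\<^esub> h x"
        by (rule uniq) (use x c h in \<open>auto simp: mod_hom_smult[OF pr] mod_hom_smult[OF ph] mod_hom_smult[OF g1] mod_hom_smult[OF g2]\<close>)
    qed
    then show ?thesis using h by blast
  qed
  have re: "retract R M N"
  proof -
    \<comment> \<open>Since \<open>f\<close> lifts multiplication by \<open>a\<close>, the pair of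
      \<open>x\<close> and \<open>f x\<close> lies in the pullback, which splits
      \<open>pr\<close>.\<close>
    obtain h where "h \<in> mod_hom R M N" "\<forall>x \<in> carrier M. pr (h x) = x \<and> ph (h x) = f x"
      using univ[OF m mod_hom_id hf f(2)] by blast
    then show ?thesis using pr by (intro retractI[OF m mN]) auto
  qed
  have facN: "fac R N N (\<lambda>x. b \<odot>\<^bsub>N\<^esub> x)" if b: "b \<in> set xs" for b
  proof -
    have bR: "b \<in> carrier R" using b xs by auto
    obtain fb where fb: "fac R M F fb" "\<And>x. x \<in> carrier M \<Longrightarrow> \<pi> (fb x) = b \<odot>\<^bsub>M\<^esub> x" using lift[of b] b by auto
    note hfb = fac_hom[OF m mF fb(1)]
    note cl = mod_hom_closed[OF hf] mod_hom_closed[OF hfb] mod_hom_closed[OF \<pi>] mod_hom_closed[OF pr] mod_hom_closed[OF ph]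
    \<comment> \<open>This is \<open>\<pi>\<close> followed by the section of \<open>pr\<close>;
      composed with \<open>fb\<close> it gives the part of multiplication by \<open>b\<close> that
      comes from \<open>M\<close>.\<close>
    obtain p1 where p1: "p1 \<in> mod_hom R F N" "\<And>x. x \<in> carrier F \<Longrightarrow> pr (p1 x) = \<pi> x \<and> ph (p1 x) = f (\<pi> x)"
      using univ[OF mF \<pi> mod_hom_comp[OF \<pi> hf]] f(2) cl(3) by blast
    have "\<pi> (b \<odot>\<^bsub>F\<^esub> v \<ominus>\<^bsub>F\<^esub> fb (\<pi> v)) = a \<odot>\<^bsub>M\<^esub> \<zero>\<^bsub>M\<^esub>" if "v \<in> carrier F" for v
      using that cl bR a
      by (simp add: mod_hom_diff[OF mF m \<pi>] mod_hom_smult[OF \<pi>] fb(2) M.minus_self)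
    \<comment> \<open>On the kernel of \<open>\<pi>\<close> this is multiplication by
      \<open>b\<close>. The correction by \<open>fb (\<pi> v)\<close> extends it to all of
      \<open>F\<close>, whose identity is in \<open>fac\<close>.\<close>
    then obtain p2 where p2: "p2 \<in> mod_hom R F N"
      "\<And>v. v \<in> carrier F \<Longrightarrow> pr (p2 v) = \<zero>\<^bsub>M\<^esub> \<and> ph (p2 v) = b \<odot>\<^bsub>F\<^esub> v \<ominus>\<^bsub>F\<^esub> fb (\<pi> v)"
      using univ[OF mF mod_hom_const_zero[OF m] mod_hom_minus_fun[OF mF mod_hom_scale[OF mF bR] mod_hom_comp[OF \<pi> hfb]]] by blast
    let ?v = "\<lambda>y. ph y \<ominus>\<^bsub>F\<^esub> f (pr y)"
    have hv: "?v \<in> mod_hom R N F" by (rule mod_hom_minus_fun[OF mF ph mod_hom_comp[OF pr hf]])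
    have "fac R N N (\<lambda>y. p1 (fb (pr y)) \<oplus>\<^bsub>N\<^esub> p2 (?v y))"
      by (rule fac_add[OF mN mN fac_post[OF mN mF mN fac_pre[OF fb(1) pr] p1(1)] fac_post[OF mN mF mN fac_pre[OF facF hv] p2(1)]])
    then show ?thesis
    proof (rule fac_cong[OF mN])
      fix y assume y: "y \<in> carrier N"
      have c: "pr y \<in> carrier M" "ph y \<in> carrier F" "f (pr y) \<in> carrier F" "?v y \<in> carrier F" "fb (pr y) \<in> carrier F"
        using y cl by auto
      have pc: "p1 (fb (pr y)) \<in> carrier N" "p2 (?v y) \<in> carrier N" using c mod_hom_closed[OF p1(1)] mod_hom_closed[OF p2(1)] by auto
      \<comment> \<open>\<open>?v y\<close> is in the kernel of \<open>\<pi>\<close>, where the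
        correction built into \<open>p2\<close> disappears.\<close>
      have "\<pi> (?v y) = \<zero>\<^bsub>M\<^esub>" using c y a by (simp add: mod_hom_diff[OF mF m \<pi>] comm f(2) M.minus_self)
      then have fv: "fb (\<pi> (?v y)) = \<zero>\<^bsub>F\<^esub>" using mod_hom_zero[OF m mF hfb] by simp
      show "b \<odot>\<^bsub>N\<^esub> y = p1 (fb (pr y)) \<oplus>\<^bsub>N\<^esub> p2 (?v y)"
      proof (rule uniq)
        show "pr (b \<odot>\<^bsub>N\<^esub> y) = pr (p1 (fb (pr y)) \<oplus>\<^bsub>N\<^esub> p2 (?v y))"
          using c pc y bR by (simp add: mod_hom_add[OF pr] mod_hom_smult[OF pr] p1(2) p2(2) fb(2))
        have "b \<odot>\<^bsub>F\<^esub> ph y = b \<odot>\<^bsub>F\<^esub> f (pr y) \<oplus>\<^bsub>F\<^esub> (b \<odot>\<^bsub>F\<^esub> ?v y)" using c(2,3) bR by algebra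
        then show "ph (b \<odot>\<^bsub>N\<^esub> y) = ph (p1 (fb (pr y)) \<oplus>\<^bsub>N\<^esub> p2 (?v y))"
          using c pc y bR by (simp add: mod_hom_add[OF ph] mod_hom_smult[OF ph] p1(2) p2(2) fb(2) fv mod_hom_smult[OF hf] F.minus_zero_right)
      qed (use y bR pc in auto)
    qed
  qed
  obtain C :: "('a, nat \<Rightarrow> 'a) mod_cplx" and g where ap: "approx R xs N C g" using IH[OF N facN] by blast
  have q: "qis_elem R C (koszul R xs N) g" and C: "is_cplx R C" and noeC: "\<And>i. noeth R (obj C i)"
    and zC: "\<And>i. i < 0 \<or> i > int (length xs) \<Longrightarrow> carrier (obj C i) = {\<zero>\<^bsub>obj C i\<^esub>}"
    and fcC: "\<And>i. 0 \<le> i \<Longrightarrow> i < int (length xs) \<Longrightarrow> fac R (obj C i) (obj C i) (\<lambda>x. x)"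
    and reC: "retract R N (obj C (int (length xs)))"
    using ap by (auto simp: approx_def qis_elem_def)
  let ?K = "koszul R xs M" and ?KF = "koszul R xs F" and ?KN = "koszul R xs N"
  note KM = koszul_cplx[OF m xs] and KF = koszul_cplx[OF mF xs] and KN = koszul_cplx[OF mN xs]
  \<comment> \<open>In degree \<open>i\<close> this is a finite sum of copies of \<open>F\<close>
    plus the term of \<open>C\<close> in degree \<open>i - 1\<close>; the top term of
    \<open>C\<close> thus moves to the new top degree.\<close>
  let ?X = "cone R (\<lambda>i c J. ph (g i c J)) C ?KF"
  have pex: "\<exists>b \<in> carrier F. \<pi> b = x" if "x \<in> carrier M" for x using that unfolding \<pi>s[symmetric] by auto
  have "qis_elem R ?X (cone R (\<lambda>i x. a \<odot>\<^bsub>obj ?K i\<^esub> x) ?K ?K)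
    (\<lambda>i x. (\<lambda>J. \<pi> (fst x J), \<lambda>J. pr (g (i - 1) (snd x) J)))"
  proof (rule cone_pullback_qis[where pr = "\<lambda>i f J. pr (f J)" and ph = "\<lambda>i f J. ph (f J)" and \<pi> = "\<lambda>i f J. \<pi> (f J)",
        OF KM KF KN a koszul_map[OF mF m \<pi> xs] _ koszul_map[OF mN m pr xs] koszul_map[OF mN mF ph xs] _ _ _ q])
    fix i
    show "(\<lambda>f J. \<pi> (f J)) ` carrier (obj ?KF i) = carrier (obj ?K i)"
    proof safe
      fix f assume "f \<in> carrier (obj ?KF i)"
      then show "(\<lambda>J. \<pi> (f J)) \<in> carrier (obj ?K i)"
        by (simp add: koszul_carrier mod_hom_closed[OF \<pi>] mod_hom_zero[OF mF m \<pi>])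
    next
      fix f assume f: "f \<in> carrier (obj ?K i)"
      obtain s where s: "\<And>x. x \<in> carrier M \<Longrightarrow> s x \<in> carrier F \<and> \<pi> (s x) = x" using pex by metis
      let ?f = "\<lambda>J. if J \<in> index_sets (length xs) i then s (f J) else \<zero>\<^bsub>F\<^esub>"
      have "?f \<in> carrier (obj ?KF i)" "f = (\<lambda>J. \<pi> (?f J))"
        using f s by (auto simp: koszul_carrier mod_hom_zero[OF mF m \<pi>] fun_eq_iff)
      then show "f \<in> (\<lambda>f J. \<pi> (f J)) ` carrier (obj ?KF i)" by (rule image_eqI[where x = ?f, rotated])
    qed
  next
    fix i y assume "y \<in> carrier (obj ?KN i)"
    then show "(\<lambda>J. \<pi> (ph (y J))) = a \<odot>\<^bsub>obj ?K i\<^esub> (\<lambda>J. pr (y J))"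
      using comm koszul_closed[OF mN] by (auto simp: koszul_obj simp del: dsum_simps(1))
  next
    fix i q b assume q: "q \<in> carrier (obj ?K i)" and b: "b \<in> carrier (obj ?KF i)"
      and eq: "(\<lambda>J. \<pi> (b J)) = a \<odot>\<^bsub>obj ?K i\<^esub> q"
    have "\<exists>y. y \<in> carrier N \<and> pr y = q J \<and> ph y = b J" for J
      using pull[OF koszul_closed[OF m q] koszul_closed[OF mF b], of J J] fun_cong[OF eq, of J]
      by (auto simp: koszul_obj)
    then obtain y where y: "\<And>J. y J \<in> carrier N \<and> pr (y J) = q J \<and> ph (y J) = b J" by metis
    \<comment> \<open>\<open>y J\<close> was chosen freely, but outside the index sets both
      projections are zero, and uniqueness leaves no other value.\<close>
    have "y J = \<zero>\<^bsub>N\<^esub>" if "J \<notin> index_sets (length xs) i" for J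
      using that y[of J] q b by (intro uniq) (auto simp: koszul_carrier mod_hom_zero[OF mN m pr] mod_hom_zero[OF mN mF ph])
    then have "y \<in> carrier (obj ?KN i)" using y by (auto simp: koszul_carrier)
    then show "\<exists>y \<in> carrier (obj ?KN i). (\<lambda>J. pr (y J)) = q \<and> (\<lambda>J. ph (y J)) = b"
      using y by (intro bexI[of _ y]) auto
  next
    fix i y y' assume y: "y \<in> carrier (obj ?KN i)" "y' \<in> carrier (obj ?KN i)"
      and eq: "(\<lambda>J. pr (y J)) = (\<lambda>J. pr (y' J))" "(\<lambda>J. ph (y J)) = (\<lambda>J. ph (y' J))"
    have "y J = y' J" for J
      by (rule uniq[OF koszul_closed[OF mN y(1)] koszul_closed[OF mN y(2)] fun_cong[OF eq(1)] fun_cong[OF eq(2)]])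
    then show "y = y'" by (rule ext)
  qed
  note qX = qis_elem_comp[OF this koszul_snoc(2)[OF m xs a KM]]
  have "noeth R (obj ?X i)" for i
    by (simp add: koszul_obj noeth_prod[OF noeth_dsum[OF F finite_index_sets] noeC])
  moreover have "carrier (obj ?X i) = {\<zero>\<^bsub>obj ?X i\<^esub>}" if "i < 0 \<or> i > int (length (xs @ [a]))" for i
  proof -
    have "carrier (obj ?KF i) = {\<zero>\<^bsub>obj ?KF i\<^esub>}"
      using index_sets_empty[of i "length xs"] that by (auto simp: koszul_obj)
    moreover have "carrier (obj C (i - 1)) = {\<zero>\<^bsub>obj C (i - 1)\<^esub>}" using that by (intro zC) auto
    ultimately show ?thesis by simp
  qed
  moreover have "fac R (obj ?X i) (obj ?X i) (\<lambda>x. x)" if "0 \<le> i" "i < int (length (xs @ [a]))" for i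
  proof -
    have "fac R (obj C (i - 1)) (obj C (i - 1)) (\<lambda>x. x)"
    proof (cases "i = 0")
      case True
      \<comment> \<open>Here the term of \<open>C\<close> is in degree -1, so its identity is the
        zero map.\<close>
      then show ?thesis using zC[of "i - 1"] by (intro fac.zero) auto
    next
      case False
      then show ?thesis using that by (intro fcC) auto
    qed
    then show ?thesis
      by (simp add: koszul_obj fac_prod[OF module_dsum[OF mF] cplx_module[OF C] fac_dsum[OF mF facF finite_index_sets]])
  qed
  moreover have "retract R M (obj ?X (int (length (xs @ [a]))))"
  \<comment> \<open>\<open>M\<close> is a retract of \<open>N\<close>, \<open>N\<close> of the top
    term of \<open>C\<close>, and that term of the cone, as its second factor.\<close>
  proof (rule retract_trans[OF retract_trans[OF re reC]])
    let ?n = "int (length xs)"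
    interpret K: module R "obj ?KF (?n + 1)" by (rule cplx_module[OF KF])
    have i: "(\<lambda>c. (\<zero>\<^bsub>obj ?KF (?n + 1)\<^esub>, c)) \<in> mod_hom R (obj C ?n) (prod_mod (obj ?KF (?n + 1)) (obj C ?n))"
      by (rule mod_homI) auto
    have "retract R (obj C ?n) (prod_mod (obj ?KF (?n + 1)) (obj C ?n))"
      by (rule retractI[OF cplx_module[OF C] module_prod[OF cplx_module[OF KF] cplx_module[OF C]] i mod_hom_snd]) simp
    then show "retract R (obj C ?n) (obj ?X (int (length (xs @ [a]))))" by (simp add: algebra_simps)
  qed
  ultimately have "approx R (xs @ [a]) M ?X
      (\<lambda>i x. kjoin (length xs) (\<lambda>J. \<pi> (fst x J), \<lambda>J. pr (g (i - 1) (snd x) J)))"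
    unfolding approx_def using qX by blast
  then show ?thesis by (rule approx_transport)
qed

text \<open>The induction is confined to modules with elements in \<open>nat => 'a\<close>, where
  all pullbacks live. The given \<open>M\<close>, of arbitrary type, is treated by one separate step
  for the last element of \<open>xs\<close>.\<close>

lemma ex_approx:
  fixes M :: "('a, 'm, 'c) module_scheme"
  assumes R: "cring R" "noetherian_ring R" and xs: "set xs \<subseteq> carrier R"
    and M: "noeth R M" "\<And>b. b \<in> set xs \<Longrightarrow> fac R M M (\<lambda>x. b \<odot>\<^bsub>M\<^esub> x)"
  shows "\<exists>(C :: ('a, nat \<Rightarrow> 'a) mod_cplx) g. approx R xs M C g"
proof -
  have *: "\<exists>(C :: ('a, nat \<Rightarrow> 'a) mod_cplx) g. approx R ys N C g"
    if "set ys \<subseteq> carrier R" "noeth R N" "\<And>b. b \<in> set ys \<Longrightarrow> fac R N N (\<lambda>x. b \<odot>\<^bsub>N\<^esub> x)"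
    for ys and N :: "('a, nat \<Rightarrow> 'a) module"
    using that
  proof (induct ys arbitrary: N rule: rev_induct)
    case Nil then show ?case using approx_nil by blast
  next
    case (snoc a ys)
    show ?case by (rule approx_snoc[OF R]) (use snoc in auto)
  qed
  show ?thesis
  proof (cases xs rule: rev_cases)
    case Nil then show ?thesis using approx_nil[OF M(1)] by simp
  next
    case (snoc ys a)
    show ?thesis unfolding snoc
      by (rule approx_snoc[OF R]) (use xs M snoc * in auto)
  qed
qed


section \<open>Localization\<close>

locale mult_subset = module +
  fixes S
  assumes S_sub: "S \<subseteq> carrier R" and S_one: "\<one> \<in> S"
    and S_mult: "s \<in> S \<Longrightarrow> t \<in> S \<Longrightarrow> s \<otimes> t \<in> S"
begin

lemma S_carrier [simp]: "s \<in> S \<Longrightarrow> s \<in> carrier R"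
  using S_sub by auto

lemma loc_rel_iff:
  "((m, s), (m', s')) \<in> loc_rel M S \<longleftrightarrow> m \<in> carrier M \<and> m' \<in> carrier M \<and> s \<in> S \<and> s' \<in> S \<and>
    (\<exists>t \<in> S. t \<odot>\<^bsub>M\<^esub> (s' \<odot>\<^bsub>M\<^esub> m) = t \<odot>\<^bsub>M\<^esub> (s \<odot>\<^bsub>M\<^esub> m'))"
  by (simp add: loc_rel_def)

lemma equiv_loc_rel: "equiv (carrier M \<times> S) (loc_rel M S)"
proof (rule equivI)
  show "loc_rel M S \<subseteq> (carrier M \<times> S) \<times> (carrier M \<times> S)" by (auto simp: loc_rel_def)
  show "refl_on (carrier M \<times> S) (loc_rel M S)" by (rule refl_onI) (use S_one in \<open>auto simp: loc_rel_def\<close>)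
  show "sym (loc_rel M S)" by (rule symI) (auto simp: loc_rel_def, metis)
  show "trans (loc_rel M S)"
  proof (rule transI)
    fix x y z assume "(x, y) \<in> loc_rel M S" "(y, z) \<in> loc_rel M S"
    moreover obtain m s m1 s1 m2 s2 where xyz: "x = (m, s)" "y = (m1, s1)" "z = (m2, s2)" by (metis surj_pair)
    ultimately obtain t t' where c: "m \<in> carrier M" "m1 \<in> carrier M" "m2 \<in> carrier M" "s \<in> S" "s1 \<in> S" "s2 \<in> S" "t \<in> S" "t' \<in> S"
      and 1: "t \<odot>\<^bsub>M\<^esub> (s1 \<odot>\<^bsub>M\<^esub> m) = t \<odot>\<^bsub>M\<^esub> (s \<odot>\<^bsub>M\<^esub> m1)" and 2: "t' \<odot>\<^bsub>M\<^esub> (s2 \<odot>\<^bsub>M\<^esub> m1) = t' \<odot>\<^bsub>M\<^esub> (s1 \<odot>\<^bsub>M\<^esub> m2)"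
      by (auto simp: loc_rel_iff)
    \<comment> \<open>The witness for transitivity also contains the middle denominator
      \<open>s1\<close>, since the two given equations are joined by multiplying with it.\<close>
    have "(t \<otimes> t' \<otimes> s1) \<odot>\<^bsub>M\<^esub> (s2 \<odot>\<^bsub>M\<^esub> m) = (t' \<otimes> s2) \<odot>\<^bsub>M\<^esub> (t \<odot>\<^bsub>M\<^esub> (s1 \<odot>\<^bsub>M\<^esub> m))"
      using c by (simp add: smult_assoc1[symmetric] R.m_ac)
    also have "\<dots> = (t \<otimes> s) \<odot>\<^bsub>M\<^esub> (t' \<odot>\<^bsub>M\<^esub> (s2 \<odot>\<^bsub>M\<^esub> m1))"
      unfolding 1 using c by (simp add: smult_assoc1[symmetric] R.m_ac)
    also have "\<dots> = (t \<otimes> t' \<otimes> s1) \<odot>\<^bsub>M\<^esub> (s \<odot>\<^bsub>M\<^esub> m2)"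
      unfolding 2 using c by (simp add: smult_assoc1[symmetric] R.m_ac)
    finally show "(x, z) \<in> loc_rel M S" unfolding xyz loc_rel_iff using c S_mult by blast
  qed
qed

lemma frac_eq:
  assumes "m \<in> carrier M" "s \<in> S" "m' \<in> carrier M" "s' \<in> S"
  shows "mod_frac M S m s = mod_frac M S m' s' \<longleftrightarrow> (\<exists>t \<in> S. t \<odot>\<^bsub>M\<^esub> (s' \<odot>\<^bsub>M\<^esub> m) = t \<odot>\<^bsub>M\<^esub> (s \<odot>\<^bsub>M\<^esub> m'))"
  using eq_equiv_class_iff[OF equiv_loc_rel, of "(m, s)" "(m', s')"] assms by (simp add: mod_frac_def loc_rel_iff)

lemma frac_mem:
  assumes "m \<in> carrier M" "s \<in> S" shows "(m, s) \<in> mod_frac M S m s"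
  unfolding mod_frac_def using equiv_class_self[OF equiv_loc_rel] assms by auto

lemma frac_memD:
  assumes "(m', s') \<in> mod_frac M S m s"
  shows "m' \<in> carrier M" "s' \<in> S" "\<exists>t \<in> S. t \<odot>\<^bsub>M\<^esub> (s' \<odot>\<^bsub>M\<^esub> m) = t \<odot>\<^bsub>M\<^esub> (s \<odot>\<^bsub>M\<^esub> m')"
  using assms by (auto simp: mod_frac_def loc_rel_iff)

text \<open>\<open>loc_add\<close> is a union over all representatives. It collapses to one class
  because every choice of representatives gives the same fraction, the witness being the product of
  the two given witnesses.\<close>

lemma loc_add_frac:
  assumes "m \<in> carrier M" "s \<in> S" "n \<in> carrier M" "t \<in> S"
  shows "loc_add R M S (mod_frac M S m s) (mod_frac M S n t) =
    mod_frac M S ((t \<odot>\<^bsub>M\<^esub> m) \<oplus>\<^bsub>M\<^esub> (s \<odot>\<^bsub>M\<^esub> n)) (s \<otimes> t)"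
proof -
  have *: "mod_frac M S ((t' \<odot>\<^bsub>M\<^esub> m') \<oplus>\<^bsub>M\<^esub> (s' \<odot>\<^bsub>M\<^esub> n')) (s' \<otimes> t') = mod_frac M S ((t \<odot>\<^bsub>M\<^esub> m) \<oplus>\<^bsub>M\<^esub> (s \<odot>\<^bsub>M\<^esub> n)) (s \<otimes> t)"
    if ms: "(m', s') \<in> mod_frac M S m s" and nt: "(n', t') \<in> mod_frac M S n t" for m' s' n' t'
  proof -
    note c = frac_memD(1,2)[OF ms] frac_memD(1,2)[OF nt] assms
    obtain u v where u: "u \<in> S" "u \<odot>\<^bsub>M\<^esub> (s' \<odot>\<^bsub>M\<^esub> m) = u \<odot>\<^bsub>M\<^esub> (s \<odot>\<^bsub>M\<^esub> m')"
      and v: "v \<in> S" "v \<odot>\<^bsub>M\<^esub> (t' \<odot>\<^bsub>M\<^esub> n) = v \<odot>\<^bsub>M\<^esub> (t \<odot>\<^bsub>M\<^esub> n')"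
      using frac_memD(3)[OF ms] frac_memD(3)[OF nt] by blast
    have "(u \<otimes> v) \<odot>\<^bsub>M\<^esub> ((s \<otimes> t) \<odot>\<^bsub>M\<^esub> ((t' \<odot>\<^bsub>M\<^esub> m') \<oplus>\<^bsub>M\<^esub> (s' \<odot>\<^bsub>M\<^esub> n'))) =
      (v \<otimes> t \<otimes> t') \<odot>\<^bsub>M\<^esub> (u \<odot>\<^bsub>M\<^esub> (s \<odot>\<^bsub>M\<^esub> m')) \<oplus>\<^bsub>M\<^esub> (u \<otimes> s \<otimes> s') \<odot>\<^bsub>M\<^esub> (v \<odot>\<^bsub>M\<^esub> (t \<odot>\<^bsub>M\<^esub> n'))"
      using c u(1) v(1) by (simp add: smult_r_distr smult_assoc1[symmetric] R.m_ac)
    also have "\<dots> = (u \<otimes> v) \<odot>\<^bsub>M\<^esub> ((s' \<otimes> t') \<odot>\<^bsub>M\<^esub> ((t \<odot>\<^bsub>M\<^esub> m) \<oplus>\<^bsub>M\<^esub> (s \<odot>\<^bsub>M\<^esub> n)))"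
      unfolding u(2)[symmetric] v(2)[symmetric]
      using c u(1) v(1) by (simp add: smult_r_distr smult_assoc1[symmetric] R.m_ac)
    finally show ?thesis using c u(1) v(1) S_mult by (subst frac_eq) auto
  qed
  show ?thesis
  proof
    show "loc_add R M S (mod_frac M S m s) (mod_frac M S n t) \<subseteq> mod_frac M S ((t \<odot>\<^bsub>M\<^esub> m) \<oplus>\<^bsub>M\<^esub> (s \<odot>\<^bsub>M\<^esub> n)) (s \<otimes> t)"
      unfolding loc_add_def using * by auto
    show "mod_frac M S ((t \<odot>\<^bsub>M\<^esub> m) \<oplus>\<^bsub>M\<^esub> (s \<odot>\<^bsub>M\<^esub> n)) (s \<otimes> t) \<subseteq> loc_add R M S (mod_frac M S m s) (mod_frac M S n t)"
      unfolding loc_add_def using frac_mem[OF assms(1,2)] frac_mem[OF assms(3,4)] by blast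
  qed
qed

text \<open>The localized ring is the localization of \<open>self_module R\<close>, so the facts
  about fractions apply to scalars as well.\<close>

lemma mult_subset_self: "mult_subset R (self_module R) S"
  by (intro mult_subset.intro module_self mult_subset_axioms.intro R.is_cring) (use S_sub S_one S_mult in auto)

lemma loc_smult_frac:
  assumes "a \<in> carrier R" "s \<in> S" "m \<in> carrier M" "t \<in> S"
  shows "loc_smult R M S (mod_frac (self_module R) S a s) (mod_frac M S m t) =
    mod_frac M S (a \<odot>\<^bsub>M\<^esub> m) (s \<otimes> t)"
proof -
  interpret self: mult_subset R "self_module R" S by (rule mult_subset_self)
  have *: "mod_frac M S (a' \<odot>\<^bsub>M\<^esub> m') (s' \<otimes> t') = mod_frac M S (a \<odot>\<^bsub>M\<^esub> m) (s \<otimes> t)"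
    if as: "(a', s') \<in> mod_frac (self_module R) S a s" and mt: "(m', t') \<in> mod_frac M S m t" for a' s' m' t'
  proof -
    note c = self.frac_memD(1,2)[OF as] frac_memD(1,2)[OF mt] assms
    obtain u v where u: "u \<in> S" "u \<otimes> (s' \<otimes> a) = u \<otimes> (s \<otimes> a')"
      and v: "v \<in> S" "v \<odot>\<^bsub>M\<^esub> (t' \<odot>\<^bsub>M\<^esub> m) = v \<odot>\<^bsub>M\<^esub> (t \<odot>\<^bsub>M\<^esub> m')"
      using self.frac_memD(3)[OF as] frac_memD(3)[OF mt] by auto
    have "(u \<otimes> v) \<odot>\<^bsub>M\<^esub> ((s \<otimes> t) \<odot>\<^bsub>M\<^esub> (a' \<odot>\<^bsub>M\<^esub> m')) = (u \<otimes> (s \<otimes> a')) \<odot>\<^bsub>M\<^esub> (v \<odot>\<^bsub>M\<^esub> (t \<odot>\<^bsub>M\<^esub> m'))"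
      using c u(1) v(1) by (simp add: smult_assoc1[symmetric] R.m_ac)
    also have "\<dots> = (u \<otimes> v) \<odot>\<^bsub>M\<^esub> ((s' \<otimes> t') \<odot>\<^bsub>M\<^esub> (a \<odot>\<^bsub>M\<^esub> m))"
      unfolding u(2)[symmetric] v(2)[symmetric] using c u(1) v(1) by (simp add: smult_assoc1[symmetric] R.m_ac)
    finally show ?thesis using c u(1) v(1) S_mult by (subst frac_eq) auto
  qed
  show ?thesis
  proof
    show "loc_smult R M S (mod_frac (self_module R) S a s) (mod_frac M S m t) \<subseteq> mod_frac M S (a \<odot>\<^bsub>M\<^esub> m) (s \<otimes> t)"
      unfolding loc_smult_def using * by auto
    show "mod_frac M S (a \<odot>\<^bsub>M\<^esub> m) (s \<otimes> t) \<subseteq> loc_smult R M S (mod_frac (self_module R) S a s) (mod_frac M S m t)"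
      unfolding loc_smult_def using self.frac_mem[of a s] frac_mem[OF assms(3,4)] assms by force
  qed
qed

abbreviation "RS \<equiv> loc_ring R S"
abbreviation "MS \<equiv> loc_module R M S"
abbreviation "\<iota> m \<equiv> mod_frac M S m \<one>"
abbreviation "\<rho> r \<equiv> mod_frac (self_module R) S r \<one>"

lemma loc_simps:
  "carrier MS = (carrier M \<times> S) // loc_rel M S" "add MS = loc_add R M S" "smult MS = loc_smult R M S"
  "carrier RS = (carrier R \<times> S) // loc_rel (self_module R) S" "add RS = loc_add R (self_module R) S"
  "mult RS = loc_smult R (self_module R) S" "\<zero>\<^bsub>MS\<^esub> = \<iota> \<zero>\<^bsub>M\<^esub>" "\<zero>\<^bsub>RS\<^esub> = \<rho> \<zero>"
  by (simp_all add: loc_module_def loc_ring_def)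

lemma \<iota>_closed: "m \<in> carrier M \<Longrightarrow> \<iota> m \<in> carrier MS"
  by (auto simp: loc_simps mod_frac_def S_one intro!: quotientI)

lemma \<rho>_closed: "r \<in> carrier R \<Longrightarrow> \<rho> r \<in> carrier RS"
  by (auto simp: loc_simps mod_frac_def S_one intro!: quotientI)

lemma \<iota>_add: "m \<in> carrier M \<Longrightarrow> n \<in> carrier M \<Longrightarrow> \<iota> (m \<oplus>\<^bsub>M\<^esub> n) = \<iota> m \<oplus>\<^bsub>MS\<^esub> \<iota> n"
  by (simp add: loc_simps loc_add_frac S_one)

lemma \<rho>_add: "r \<in> carrier R \<Longrightarrow> s \<in> carrier R \<Longrightarrow> \<rho> (r \<oplus> s) = \<rho> r \<oplus>\<^bsub>RS\<^esub> \<rho> s"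
  using mult_subset.loc_add_frac[OF mult_subset_self, of r \<one> s \<one>] by (simp add: loc_simps S_one)

lemma \<iota>_smult: "r \<in> carrier R \<Longrightarrow> m \<in> carrier M \<Longrightarrow> \<iota> (r \<odot>\<^bsub>M\<^esub> m) = \<rho> r \<odot>\<^bsub>MS\<^esub> \<iota> m"
  by (simp add: loc_simps loc_smult_frac S_one)

lemma \<rho>_mult: "r \<in> carrier R \<Longrightarrow> s \<in> carrier R \<Longrightarrow> \<rho> (r \<otimes> s) = \<rho> r \<otimes>\<^bsub>RS\<^esub> \<rho> s"
  using mult_subset.loc_smult_frac[OF mult_subset_self, of r \<one> s \<one>] by (simp add: loc_simps S_one)

lemma \<iota>_eq: "m \<in> carrier M \<Longrightarrow> n \<in> carrier M \<Longrightarrow> \<iota> m = \<iota> n \<Longrightarrow> \<exists>t \<in> S. t \<odot>\<^bsub>M\<^esub> m = t \<odot>\<^bsub>M\<^esub> n"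
  using frac_eq[of m \<one> n \<one>] by (simp add: S_one)

lemma \<rho>_eq: "r \<in> carrier R \<Longrightarrow> s \<in> carrier R \<Longrightarrow> \<rho> r = \<rho> s \<Longrightarrow> \<exists>t \<in> S. t \<otimes> r = t \<otimes> s"
  using mult_subset.\<iota>_eq[OF mult_subset_self, of r s] by simp

lemma clear_denominator:
  assumes "y \<in> carrier MS" shows "\<exists>s \<in> S. \<exists>m \<in> carrier M. \<rho> s \<odot>\<^bsub>MS\<^esub> y = \<iota> m"
proof -
  obtain m s where ms: "m \<in> carrier M" "s \<in> S" "y = mod_frac M S m s"
    using assms by (auto simp: loc_simps mod_frac_def elim!: quotientE)
  have "\<rho> s \<odot>\<^bsub>MS\<^esub> y = mod_frac M S (s \<odot>\<^bsub>M\<^esub> m) (\<one> \<otimes> s)"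
    unfolding ms(3) using ms by (simp only: loc_simps loc_smult_frac S_one S_carrier)
  also have "\<dots> = \<iota> m" using ms S_one by (subst frac_eq) (auto intro!: bexI[of _ \<one>])
  finally show ?thesis using ms by blast
qed

lemma clear_denominator_ring:
  assumes "y \<in> carrier RS" shows "\<exists>s \<in> S. \<exists>r \<in> carrier R. \<rho> s \<otimes>\<^bsub>RS\<^esub> y = \<rho> r"
proof -
  have "carrier RS = carrier (loc_module R (self_module R) S)" "mult RS = smult (loc_module R (self_module R) S)"
    by (simp_all add: loc_ring_def loc_module_def)
  then show ?thesis using mult_subset.clear_denominator[OF mult_subset_self, of y] assms by simp
qed

end

section \<open>From a free localization to a factorization over the ring\<close>

lemma fg_induct:
  assumes "module R M" "G \<subseteq> carrier M" "carrier M \<subseteq> mspan R M G" "submodule H R M" "G \<subseteq> H"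
  shows "H = carrier M"
  using mspan_least[OF assms(1,4,5)] assms(3) module.submoduleE(1)[OF assms(1,4)] by blast

lemma mod_hom_inv:
  assumes "module R M" "f \<in> mod_hom R M N" "bij_betw f (carrier M) (carrier N)"
  shows "inv_into (carrier M) f \<in> mod_hom R N M"
proof -
  interpret module R M by fact
  let ?g = "inv_into (carrier M) f"
  have g: "?g y \<in> carrier M" "f (?g y) = y" if "y \<in> carrier N" for y
    using assms(3) that by (auto simp: bij_betw_def inv_into_into f_inv_into_f)
  have gf: "?g (f x) = x" if "x \<in> carrier M" for x using assms(3) that by (simp add: bij_betw_def)
  show ?thesis
  proof (rule mod_homI)
    fix x y a assume x: "x \<in> carrier N"
    show "?g x \<in> carrier M" using g x by blast
    {
      assume y: "y \<in> carrier N"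
      have "x \<oplus>\<^bsub>N\<^esub> y = f (?g x \<oplus>\<^bsub>M\<^esub> ?g y)" using g x y by (simp add: mod_hom_add[OF assms(2)])
      then show "?g (x \<oplus>\<^bsub>N\<^esub> y) = ?g x \<oplus>\<^bsub>M\<^esub> ?g y" using gf g x y by simp
    }
    assume a: "a \<in> carrier R"
    have "a \<odot>\<^bsub>N\<^esub> x = f (a \<odot>\<^bsub>M\<^esub> ?g x)" using g x a by (simp add: mod_hom_smult[OF assms(2)])
    then show "?g (a \<odot>\<^bsub>N\<^esub> x) = a \<odot>\<^bsub>M\<^esub> ?g x" using gf g x a by simp
  qed
qed

text \<open>The basis may be infinite, but the expansions of the elements of \<open>Y\<close>
  involve only a finite part \<open>T\<close> of it. \<open>\<theta>\<close> is the projection onto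
  the span of \<open>T\<close>, a finite sum of coordinate functionals times basis elements.\<close>

lemma free_fac:
  assumes M: "module R M" and B: "is_basis R M B" and Y: "finite Y" "Y \<subseteq> carrier M"
  shows "\<exists>\<theta>. fac R M M \<theta> \<and> (\<forall>y \<in> Y. \<theta> y = y)"
proof -
  interpret module R M by fact
  let ?D = "dsum (self_module R) B" and ?L = "\<lambda>f. \<Oplus>\<^bsub>M\<^esub>b\<in>{b \<in> B. f b \<noteq> \<zero>\<^bsub>R\<^esub>}. f b \<odot>\<^bsub>M\<^esub> b"
  note S = module_self[OF R.is_cring]
  have BM: "B \<subseteq> carrier M" and bij: "bij_betw ?L (carrier ?D) (carrier M)"
    using B by (auto simp: is_basis_def)
  have dc: "f b \<in> carrier R" if "f \<in> carrier ?D" for f b using dsum_closed[OF S that] by simp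
  \<comment> \<open>The sum in \<open>is_basis\<close> runs over the support of \<open>f\<close>,
    which varies with \<open>f\<close>; two vectors can be added once both are summed over a common
    finite set.\<close>
  have L: "?L f = (\<Oplus>\<^bsub>M\<^esub>b\<in>T. f b \<odot>\<^bsub>M\<^esub> b)"
    if f: "f \<in> carrier ?D" and T: "finite T" "T \<subseteq> B" "{b \<in> B. f b \<noteq> \<zero>\<^bsub>R\<^esub>} \<subseteq> T" for f T
    using T BM dc[OF f] by (intro M.add.finprod_mono_neutral_cong_left) auto
  have fs: "finite {b \<in> B. f b \<noteq> \<zero>\<^bsub>R\<^esub>}" if "f \<in> carrier ?D" for f
    using that by (auto intro: rev_finite_subset)
  have hL: "?L \<in> mod_hom R ?D M"
  proof (rule mod_homI)
    fix f g a assume f: "f \<in> carrier ?D"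
    interpret D: module R ?D by (rule module_dsum[OF S])
    show "?L f \<in> carrier M" using BM dc[OF f] by (intro M.finsum_closed) auto
    {
      assume g: "g \<in> carrier ?D"
      let ?T = "{b \<in> B. f b \<noteq> \<zero>\<^bsub>R\<^esub>} \<union> {b \<in> B. g b \<noteq> \<zero>\<^bsub>R\<^esub>}"
      have T: "finite ?T" "?T \<subseteq> B" using fs f g by auto
      have "?L (f \<oplus>\<^bsub>?D\<^esub> g) = (\<Oplus>\<^bsub>M\<^esub>b\<in>?T. (f \<oplus>\<^bsub>?D\<^esub> g) b \<odot>\<^bsub>M\<^esub> b)"
        by (rule L[OF D.M.a_closed[OF f g] T]) auto
      also have "\<dots> = (\<Oplus>\<^bsub>M\<^esub>b\<in>?T. f b \<odot>\<^bsub>M\<^esub> b \<oplus>\<^bsub>M\<^esub> g b \<odot>\<^bsub>M\<^esub> b)"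
        using BM dc[OF f] dc[OF g] by (intro M.finsum_cong'[OF refl]) (auto simp: smult_l_distr)
      also have "\<dots> = (\<Oplus>\<^bsub>M\<^esub>b\<in>?T. f b \<odot>\<^bsub>M\<^esub> b) \<oplus>\<^bsub>M\<^esub> (\<Oplus>\<^bsub>M\<^esub>b\<in>?T. g b \<odot>\<^bsub>M\<^esub> b)"
        using BM dc[OF f] dc[OF g] by (intro M.finsum_addf) auto
      also have "\<dots> = ?L f \<oplus>\<^bsub>M\<^esub> ?L g" using L[OF f T] L[OF g T] by simp
      finally show "?L (f \<oplus>\<^bsub>?D\<^esub> g) = ?L f \<oplus>\<^bsub>M\<^esub> ?L g" .
    }
    assume a: "a \<in> carrier R"
    let ?T = "{b \<in> B. f b \<noteq> \<zero>\<^bsub>R\<^esub>}"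
    have "?L (a \<odot>\<^bsub>?D\<^esub> f) = (\<Oplus>\<^bsub>M\<^esub>b\<in>?T. (a \<odot>\<^bsub>?D\<^esub> f) b \<odot>\<^bsub>M\<^esub> b)"
      by (rule L[OF D.smult_closed[OF a f] fs[OF f]]) (use a in auto)
    also have "\<dots> = (\<Oplus>\<^bsub>M\<^esub>b\<in>?T. a \<odot>\<^bsub>M\<^esub> (f b \<odot>\<^bsub>M\<^esub> b))"
      using BM dc[OF f] a by (intro M.finsum_cong'[OF refl]) (auto simp: smult_assoc1)
    also have "\<dots> = a \<odot>\<^bsub>M\<^esub> ?L f"
      using BM dc[OF f] a fs[OF f] by (intro finsum_smult_ldistr[symmetric]) auto
    finally show "?L (a \<odot>\<^bsub>?D\<^esub> f) = a \<odot>\<^bsub>M\<^esub> ?L f" .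
  qed
  define c where "c = inv_into (carrier ?D) ?L"
  have hc: "c \<in> mod_hom R M ?D" unfolding c_def by (rule mod_hom_inv[OF module_dsum[OF S] hL bij])
  have Lc: "?L (c y) = y" if "y \<in> carrier M" for y
    unfolding c_def by (rule bij_betw_inv_into_right[OF bij that])
  define T where "T = (\<Union>y\<in>Y. {b \<in> B. c y b \<noteq> \<zero>\<^bsub>R\<^esub>})"
  have T: "finite T" "T \<subseteq> B" unfolding T_def using Y fs[OF mod_hom_closed[OF hc]] by auto
  have "fac R M M (\<lambda>y. \<Oplus>\<^bsub>M\<^esub>b\<in>T. c y b \<odot>\<^bsub>M\<^esub> b)"
    using T
  proof induct
    case empty then show ?case by (intro fac.zero) simp
  next
    case (insert b T)
    have b: "b \<in> B" "b \<in> carrier M" using insert(4) BM by auto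
    show ?case
    proof (rule fac.step[OF insert(3) mod_hom_comp[OF hc mod_hom_coord[OF b(1)]] b(2)])
      fix y assume y: "y \<in> carrier M"
      show "(\<Oplus>\<^bsub>M\<^esub>b\<in>insert b T. c y b \<odot>\<^bsub>M\<^esub> b) = c y b \<odot>\<^bsub>M\<^esub> b \<oplus>\<^bsub>M\<^esub> (\<Oplus>\<^bsub>M\<^esub>b\<in>T. c y b \<odot>\<^bsub>M\<^esub> b)"
        using insert(1,2,4) BM dc[OF mod_hom_closed[OF hc y]] by (intro M.finsum_insert) auto
    qed (use insert(4) in auto)
  qed
  moreover have "(\<Oplus>\<^bsub>M\<^esub>b\<in>T. c y b \<odot>\<^bsub>M\<^esub> b) = y" if y: "y \<in> Y" for y
  proof -
    have yM: "y \<in> carrier M" using y Y by auto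
    have "?L (c y) = (\<Oplus>\<^bsub>M\<^esub>b\<in>T. c y b \<odot>\<^bsub>M\<^esub> b)"
      by (rule L[OF mod_hom_closed[OF hc yM] T]) (use y in \<open>auto simp: T_def\<close>)
    then show ?thesis using Lc[OF yM] by simp
  qed
  ultimately show ?thesis by blast
qed

context mult_subset
begin

text \<open>Finitely many conditions, each stable under passing to multiples of its denominator,
  hold together for the product of the denominators.\<close>

lemma common_multiple:
  assumes "finite G" "\<And>g. g \<in> G \<Longrightarrow> \<exists>u \<in> S. P g u"
    and "\<And>g u v. g \<in> G \<Longrightarrow> P g u \<Longrightarrow> u \<in> S \<Longrightarrow> v \<in> S \<Longrightarrow> P g (v \<otimes> u)"
  shows "\<exists>u \<in> S. \<forall>g \<in> G. P g u"
  using assms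
proof (induct G rule: finite_induct)
  case empty then show ?case using S_one by blast
next
  case (insert g G)
  have "\<exists>u \<in> S. \<forall>g \<in> G. P g u" using insert by (intro insert(3)) auto
  then obtain u where u: "u \<in> S" "\<forall>g \<in> G. P g u" by blast
  obtain v where v: "v \<in> S" "P g v" using insert(4) by blast
  have "P h (v \<otimes> u)" if "h \<in> insert g G" for h
  proof (cases "h = g")
    case True
    have "P g (u \<otimes> v)" using insert(5) v u(1) by blast
    moreover have "u \<otimes> v = v \<otimes> u" using u v by (simp add: R.m_comm)
    ultimately show ?thesis using True by simp
  next
    case False
    then show ?thesis using that u v(1) insert(5)[of h u v] by blast
  qed
  then show ?case using u(1) v(1) S_mult by blast
qed

text \<open>The kernel of \<open>R \<rightarrow> S\<inverse>R\<close> is finitely generated, so a single denominator kills it.\<close>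

lemma annihilate_kernel:
  assumes noe: "noetherian_ring R"
  shows "\<exists>u \<in> S. \<forall>r \<in> carrier R. (\<exists>t \<in> S. t \<otimes> r = \<zero>) \<longrightarrow> u \<otimes> r = \<zero>"
proof -
  let ?J = "{r \<in> carrier R. \<exists>t \<in> S. t \<otimes> r = \<zero>}" and ?M = "self_module R"
  note sm = module_self[OF R.is_cring]
  interpret self: module R ?M by (rule sm)
  have J: "submodule ?J R ?M"
  proof (rule self.submoduleI)
    show "\<zero>\<^bsub>?M\<^esub> \<in> ?J" using S_one by force
    fix r assume r: "r \<in> ?J"
    then obtain t where t: "t \<in> S" "t \<otimes> r = \<zero>" "r \<in> carrier R" by auto
    have "\<ominus>\<^bsub>?M\<^esub> r = \<ominus> r" by (simp add: a_inv_def m_inv_def)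
    moreover have "t \<otimes> \<ominus> r = \<zero>" using t by (simp add: R.r_minus)
    ultimately show "\<ominus>\<^bsub>?M\<^esub> r \<in> ?J" using t by auto
    {
      fix r' assume "r' \<in> ?J"
      then obtain t' where t': "t' \<in> S" "t' \<otimes> r' = \<zero>" "r' \<in> carrier R" by auto
      have "(t \<otimes> t') \<otimes> r = t' \<otimes> (t \<otimes> r)" "(t \<otimes> t') \<otimes> r' = t \<otimes> (t' \<otimes> r')"
        using t(1,3) t'(1,3) by (simp_all add: R.m_ac)
      then have "(t \<otimes> t') \<otimes> (r \<oplus> r') = \<zero>" using t t' by (simp add: R.r_distr)
      then show "r \<oplus>\<^bsub>?M\<^esub> r' \<in> ?J" using t t' S_mult by auto
    next
      fix a assume a: "a \<in> carrier R"
      have "t \<otimes> (a \<otimes> r) = a \<otimes> (t \<otimes> r)" using t a by (simp add: R.m_ac)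
      then show "a \<odot>\<^bsub>?M\<^esub> r \<in> ?J" using t a by auto
    }
  qed auto
  obtain A where A: "finite A" "A \<subseteq> ?J" "?J \<subseteq> mspan R ?M A"
    using noeth_self[OF R.is_cring noe] J unfolding noeth_def by blast
  have "\<exists>u \<in> S. \<forall>r \<in> A. u \<otimes> r = \<zero>"
    using A(1)
  proof (rule common_multiple)
    show "\<exists>u\<in>S. u \<otimes> r = \<zero>" if "r \<in> A" for r using that A(2) by auto
    fix r u v assume *: "r \<in> A" "u \<otimes> r = \<zero>" "u \<in> S" "v \<in> S"
    then have "r \<in> carrier R" using A(2) by auto
    then show "v \<otimes> u \<otimes> r = \<zero>" using * by (simp add: R.m_assoc)
  qed
  then obtain u where u: "u \<in> S" "\<forall>r \<in> A. u \<otimes> r = \<zero>" by blast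
  have "(\<lambda>r. u \<otimes> r) \<in> mod_hom R ?M ?M" using mod_hom_scale[OF sm, of u] u(1) by simp
  note ker = submodule_ker[OF sm sm this]
  have "u \<otimes> r = \<zero>" if "r \<in> ?J" for r
    using mspan_least[OF sm ker, of A r] A(2,3) u(2) that by auto
  then show ?thesis using u(1) by blast
qed

text \<open>If \<open>t \<psi>\<close> takes values in the image of \<open>R\<close> and \<open>u\<close> kills the kernel of \<open>\<rho>\<close>, then \<open>u w\<close> does not depend
  on the choice of a preimage \<open>w\<close> of \<open>t \<psi>(m)\<close>.\<close>

lemma descend_functional:
  assumes noe: "noetherian_ring R" and G: "finite G" "G \<subseteq> carrier M" "carrier M \<subseteq> mspan R M G"
    and loc: "module RS MS" and \<psi>: "\<And>m. m \<in> carrier M \<Longrightarrow> \<psi> m \<in> carrier RS"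
    and \<psi>_add: "\<And>m n. m \<in> carrier M \<Longrightarrow> n \<in> carrier M \<Longrightarrow> \<psi> (m \<oplus>\<^bsub>M\<^esub> n) = \<psi> m \<oplus>\<^bsub>RS\<^esub> \<psi> n"
    and \<psi>_smult: "\<And>r m. r \<in> carrier R \<Longrightarrow> m \<in> carrier M \<Longrightarrow> \<psi> (r \<odot>\<^bsub>M\<^esub> m) = \<rho> r \<otimes>\<^bsub>RS\<^esub> \<psi> m"
  shows "\<exists>t \<in> S. \<exists>f \<in> mod_hom R M (self_module R). \<forall>m \<in> carrier M. \<rho> (f m) = \<rho> t \<otimes>\<^bsub>RS\<^esub> \<psi> m"
proof -
  interpret L: module RS MS by (rule loc)
  note \<rho>c = \<rho>_closed
  have "\<exists>t \<in> S. \<forall>g \<in> G. \<exists>r \<in> carrier R. \<rho> t \<otimes>\<^bsub>RS\<^esub> \<psi> g = \<rho> r"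
    using G(1)
  proof (rule common_multiple)
    show "\<exists>t \<in> S. \<exists>r \<in> carrier R. \<rho> t \<otimes>\<^bsub>RS\<^esub> \<psi> g = \<rho> r" if "g \<in> G" for g
      using clear_denominator_ring[OF \<psi>, of g] that G(2) by blast
    fix g u v assume g: "g \<in> G" and "\<exists>r \<in> carrier R. \<rho> u \<otimes>\<^bsub>RS\<^esub> \<psi> g = \<rho> r" and uv: "u \<in> S" "v \<in> S"
    then obtain r where r: "r \<in> carrier R" "\<rho> u \<otimes>\<^bsub>RS\<^esub> \<psi> g = \<rho> r" by blast
    have "\<rho> (v \<otimes> u) \<otimes>\<^bsub>RS\<^esub> \<psi> g = \<rho> (v \<otimes> r)"
      using g uv r G(2) \<psi>[of g] by (auto simp: \<rho>_mult \<rho>c L.R.m_assoc)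
    then show "\<exists>r \<in> carrier R. \<rho> (v \<otimes> u) \<otimes>\<^bsub>RS\<^esub> \<psi> g = \<rho> r"
      using uv r(1) by (intro bexI[of _ "v \<otimes> r"]) simp_all
  qed
  then obtain t where t: "t \<in> S" "\<And>g. g \<in> G \<Longrightarrow> \<exists>r \<in> carrier R. \<rho> t \<otimes>\<^bsub>RS\<^esub> \<psi> g = \<rho> r" by blast
  \<comment> \<open>The elements whose value under \<open>\<psi>\<close> becomes a fraction with
    denominator 1 after multiplication by \<open>t\<close>. They form a submodule containing the
    generators, hence everything.\<close>
  let ?H = "{m \<in> carrier M. \<exists>r \<in> carrier R. \<rho> t \<otimes>\<^bsub>RS\<^esub> \<psi> m = \<rho> r}"
  have add: "\<rho> t \<otimes>\<^bsub>RS\<^esub> \<psi> (m \<oplus>\<^bsub>M\<^esub> n) = \<rho> (r \<oplus> s)"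
    if "m \<in> carrier M" "n \<in> carrier M" "r \<in> carrier R" "s \<in> carrier R"
      "\<rho> t \<otimes>\<^bsub>RS\<^esub> \<psi> m = \<rho> r" "\<rho> t \<otimes>\<^bsub>RS\<^esub> \<psi> n = \<rho> s" for m n r s
    using that t(1) by (simp add: \<psi>_add \<rho>_add \<psi> \<rho>c L.R.r_distr)
  have smult: "\<rho> t \<otimes>\<^bsub>RS\<^esub> \<psi> (a \<odot>\<^bsub>M\<^esub> m) = \<rho> (a \<otimes> r)"
    if "m \<in> carrier M" "a \<in> carrier R" "r \<in> carrier R" "\<rho> t \<otimes>\<^bsub>RS\<^esub> \<psi> m = \<rho> r" for m a r
  proof -
    have "\<rho> t \<otimes>\<^bsub>RS\<^esub> \<psi> (a \<odot>\<^bsub>M\<^esub> m) = \<rho> a \<otimes>\<^bsub>RS\<^esub> (\<rho> t \<otimes>\<^bsub>RS\<^esub> \<psi> m)"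
      using that(1,2) t(1) by (simp add: \<psi>_smult \<psi> \<rho>c L.R.m_lcomm)
    then show ?thesis using that by (simp add: \<rho>_mult)
  qed
  have "submodule ?H R M"
  proof (rule submoduleI)
    have "\<zero> \<odot>\<^bsub>M\<^esub> \<zero>\<^bsub>M\<^esub> = \<zero>\<^bsub>M\<^esub>" by simp
    then have "\<psi> \<zero>\<^bsub>M\<^esub> = \<rho> \<zero> \<otimes>\<^bsub>RS\<^esub> \<psi> \<zero>\<^bsub>M\<^esub>" using \<psi>_smult[of \<zero> "\<zero>\<^bsub>M\<^esub>"] by simp
    then have "\<psi> \<zero>\<^bsub>M\<^esub> = \<rho> \<zero>" using \<psi>[of "\<zero>\<^bsub>M\<^esub>"] by (simp add: loc_simps(8)[symmetric])
    then have "\<rho> t \<otimes>\<^bsub>RS\<^esub> \<psi> \<zero>\<^bsub>M\<^esub> = \<rho> \<zero>" using t(1) \<rho>c[of t] by (simp add: loc_simps(8)[symmetric])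
    then show "\<zero>\<^bsub>M\<^esub> \<in> ?H" by auto
    fix m assume m: "m \<in> ?H"
    then obtain r where r: "r \<in> carrier R" "\<rho> t \<otimes>\<^bsub>RS\<^esub> \<psi> m = \<rho> r" "m \<in> carrier M" by auto
    have "(\<ominus> \<one>) \<odot>\<^bsub>M\<^esub> m = \<ominus>\<^bsub>M\<^esub> m" using r by (simp add: smult_l_minus)
    then show "\<ominus>\<^bsub>M\<^esub> m \<in> ?H" using smult[OF r(3) _ r(1,2), of "\<ominus> \<one>"] r by auto
    {
      fix n assume "n \<in> ?H"
      then obtain s where s: "s \<in> carrier R" "\<rho> t \<otimes>\<^bsub>RS\<^esub> \<psi> n = \<rho> s" "n \<in> carrier M" by auto
      show "m \<oplus>\<^bsub>M\<^esub> n \<in> ?H" using add[OF r(3) s(3) r(1) s(1) r(2) s(2)] r s by auto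
    next
      fix a assume a: "a \<in> carrier R"
      show "a \<odot>\<^bsub>M\<^esub> m \<in> ?H" using smult[OF r(3) a r(1,2)] r a by auto
    }
  qed auto
  from fg_induct[OF module_axioms G(2,3) this] t(2) G(2) have H: "?H = carrier M" by blast
  obtain u where u: "u \<in> S" "\<And>r t. r \<in> carrier R \<Longrightarrow> t \<in> S \<Longrightarrow> t \<otimes> r = \<zero> \<Longrightarrow> u \<otimes> r = \<zero>"
    using annihilate_kernel[OF noe] by blast
  define w where "w m = (SOME r. r \<in> carrier R \<and> \<rho> t \<otimes>\<^bsub>RS\<^esub> \<psi> m = \<rho> r)" for m
  have w: "w m \<in> carrier R" "\<rho> t \<otimes>\<^bsub>RS\<^esub> \<psi> m = \<rho> (w m)" if "m \<in> carrier M" for m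
  proof -
    have "\<exists>r. r \<in> carrier R \<and> \<rho> t \<otimes>\<^bsub>RS\<^esub> \<psi> m = \<rho> r" using H that by blast
    from someI_ex[OF this] show "w m \<in> carrier R" "\<rho> t \<otimes>\<^bsub>RS\<^esub> \<psi> m = \<rho> (w m)" unfolding w_def by auto
  qed
  have uw: "u \<otimes> w m = u \<otimes> r" if m: "m \<in> carrier M" and r: "r \<in> carrier R" "\<rho> t \<otimes>\<^bsub>RS\<^esub> \<psi> m = \<rho> r" for m r
  proof -
    obtain v where v: "v \<in> S" "v \<otimes> w m = v \<otimes> r" using \<rho>_eq[OF w(1)[OF m] r(1)] w(2)[OF m] r(2) by auto
    have "v \<otimes> (w m \<ominus> r) = v \<otimes> w m \<ominus> v \<otimes> r" using v(1) w(1)[OF m] r(1) by (simp add: a_minus_def R.r_distr R.r_minus)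
    then have "v \<otimes> (w m \<ominus> r) = \<zero>" using v r(1) by (simp add: a_minus_def R.r_neg)
    then have "u \<otimes> (w m \<ominus> r) = \<zero>" using u(2) v(1) w(1)[OF m] r(1) by blast
    moreover have "u \<otimes> w m = u \<otimes> (w m \<ominus> r) \<oplus> u \<otimes> r"
      using u(1) w(1)[OF m] r(1) by (simp add: a_minus_def R.r_distr[symmetric] R.a_assoc R.l_neg)
    ultimately show ?thesis using u(1) r(1) by simp
  qed
  have "(\<lambda>m. u \<otimes> w m) \<in> mod_hom R M (self_module R)"
  proof (rule mod_homI)
    fix m n a assume m: "m \<in> carrier M"
    show "u \<otimes> w m \<in> carrier (self_module R)" using u(1) w(1)[OF m] by simp
    {
      assume n: "n \<in> carrier M"
      have "u \<otimes> w (m \<oplus>\<^bsub>M\<^esub> n) = u \<otimes> (w m \<oplus> w n)"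
        by (rule uw) (use m n w add[OF m n w(1)[OF m] w(1)[OF n] w(2)[OF m] w(2)[OF n]] in auto)
      then show "u \<otimes> w (m \<oplus>\<^bsub>M\<^esub> n) = u \<otimes> w m \<oplus>\<^bsub>self_module R\<^esub> u \<otimes> w n"
        using u(1) w m n by (simp add: R.r_distr)
    }
    assume a: "a \<in> carrier R"
    have "u \<otimes> w (a \<odot>\<^bsub>M\<^esub> m) = u \<otimes> (a \<otimes> w m)"
      by (rule uw) (use m a w smult[OF m a w(1)[OF m] w(2)[OF m]] in auto)
    then show "u \<otimes> w (a \<odot>\<^bsub>M\<^esub> m) = a \<odot>\<^bsub>self_module R\<^esub> (u \<otimes> w m)"
      using u(1) w(1)[OF m] a by (simp add: R.m_lcomm)
  qed
  moreover have "\<rho> (u \<otimes> w m) = \<rho> (u \<otimes> t) \<otimes>\<^bsub>RS\<^esub> \<psi> m" if m: "m \<in> carrier M" for m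
    using w[OF m] u(1) t(1) m by (simp add: \<rho>_mult \<rho>c \<psi> L.R.m_assoc)
  ultimately show ?thesis
    by (intro bexI[of _ "u \<otimes> t"] bexI[of _ "\<lambda>m. u \<otimes> w m"] ballI S_mult[OF u(1) t(1)])
qed

text \<open>Induction over the terms of \<open>\<theta>\<close>: each functional comes from
  \<open>R\<close> after multiplication by some \<open>t1\<close>, each vector from \<open>M\<close>
  after multiplication by some \<open>s0\<close>, and the denominators multiply up.\<close>

lemma descend_fac:
  assumes noe: "noetherian_ring R" and G: "finite G" "G \<subseteq> carrier M" "carrier M \<subseteq> mspan R M G"
    and loc: "module RS MS" and \<theta>: "fac RS MS MS \<theta>"
  shows "\<exists>t \<in> S. \<exists>\<eta>. fac R M M \<eta> \<and> (\<forall>m \<in> carrier M. \<iota> (\<eta> m) = \<rho> t \<odot>\<^bsub>MS\<^esub> \<theta> (\<iota> m))"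
  using \<theta>
proof induct
  interpret L: module RS MS by (rule loc)
  case (zero \<theta>)
  have "fac R M M (\<lambda>_. \<zero>\<^bsub>M\<^esub>)" by (rule fac.zero) simp
  then show ?case using S_one
    by (intro bexI[of _ \<one>] exI[of _ "\<lambda>_. \<zero>\<^bsub>M\<^esub>"])
      (simp_all add: zero \<iota>_closed \<rho>_closed loc_simps(7)[symmetric])
next
  interpret L: module RS MS by (rule loc)
  case (step \<theta> \<alpha> s \<theta>')
  obtain t \<eta> where t: "t \<in> S" and \<eta>: "fac R M M \<eta>"
    and eq: "\<And>m. m \<in> carrier M \<Longrightarrow> \<iota> (\<eta> m) = \<rho> t \<odot>\<^bsub>MS\<^esub> \<theta> (\<iota> m)" using step(2) by blast
  obtain s0 m0 where s0: "s0 \<in> S" "m0 \<in> carrier M" "\<rho> s0 \<odot>\<^bsub>MS\<^esub> s = \<iota> m0"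
    using clear_denominator[OF step(4)] by blast
  have \<alpha>c: "\<alpha> (\<iota> m) \<in> carrier RS" if "m \<in> carrier M" for m
    using mod_hom_closed[OF step(3) \<iota>_closed[OF that]] by simp
  obtain t1 f where t1: "t1 \<in> S" and f: "f \<in> mod_hom R M (self_module R)"
    and feq: "\<And>m. m \<in> carrier M \<Longrightarrow> \<rho> (f m) = \<rho> t1 \<otimes>\<^bsub>RS\<^esub> \<alpha> (\<iota> m)"
    using descend_functional[OF noe G loc, of "\<lambda>m. \<alpha> (\<iota> m)"] \<alpha>c
      mod_hom_add[OF step(3)] mod_hom_smult[OF step(3)]
    by (auto simp: \<iota>_add \<iota>_smult \<iota>_closed \<rho>_closed)
  have tf: "(\<lambda>m. t \<otimes> f m) \<in> mod_hom R M (self_module R)"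
    using mod_hom_comp[OF f mod_hom_scale[OF module_self[OF R.is_cring], of t]] t by simp
  \<comment> \<open>The factors \<open>t\<close> and \<open>t1 \<otimes> s0\<close> bring the new
    term and the old sum to the common denominator
    \<open>t \<otimes> t1 \<otimes> s0\<close>.\<close>
  let ?\<eta> = "\<lambda>m. (t \<otimes> f m) \<odot>\<^bsub>M\<^esub> m0 \<oplus>\<^bsub>M\<^esub> (t1 \<otimes> s0) \<odot>\<^bsub>M\<^esub> \<eta> m"
  have "fac R M M (\<lambda>m. (t1 \<otimes> s0) \<odot>\<^bsub>M\<^esub> \<eta> m)"
    by (rule fac_post[OF module_axioms module_axioms module_axioms \<eta> mod_hom_scale[OF module_axioms]]) (use t1 s0 in simp)
  then have "fac R M M ?\<eta>" by (rule fac.step[OF _ tf s0(2)]) simp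
  moreover have "\<iota> (?\<eta> m) = \<rho> (t \<otimes> t1 \<otimes> s0) \<odot>\<^bsub>MS\<^esub> \<theta>' (\<iota> m)" if m: "m \<in> carrier M" for m
  proof -
    have c: "f m \<in> carrier R" "\<eta> m \<in> carrier M" "\<theta> (\<iota> m) \<in> carrier MS"
      using mod_hom_closed[OF f m] fac_closed[OF module_axioms module_axioms \<eta> m] fac_closed[OF loc loc step(1) \<iota>_closed[OF m]] by auto
    note r = \<rho>_closed[OF S_carrier[OF t]] \<rho>_closed[OF S_carrier[OF t1]] \<rho>_closed[OF S_carrier[OF s0(1)]]
    have "\<iota> (?\<eta> m) = (\<rho> t \<otimes>\<^bsub>RS\<^esub> (\<rho> t1 \<otimes>\<^bsub>RS\<^esub> \<alpha> (\<iota> m))) \<odot>\<^bsub>MS\<^esub> (\<rho> s0 \<odot>\<^bsub>MS\<^esub> s)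
      \<oplus>\<^bsub>MS\<^esub> (\<rho> t1 \<otimes>\<^bsub>RS\<^esub> \<rho> s0) \<odot>\<^bsub>MS\<^esub> (\<rho> t \<odot>\<^bsub>MS\<^esub> \<theta> (\<iota> m))"
      using c t t1 s0 m by (simp add: \<iota>_add \<iota>_smult \<rho>_mult eq feq)
    also have "\<dots> = (\<rho> t \<otimes>\<^bsub>RS\<^esub> \<rho> t1 \<otimes>\<^bsub>RS\<^esub> \<rho> s0) \<odot>\<^bsub>MS\<^esub> (\<alpha> (\<iota> m) \<odot>\<^bsub>MS\<^esub> s \<oplus>\<^bsub>MS\<^esub> \<theta> (\<iota> m))"
      using c r \<alpha>c[OF m] step(4) by (simp add: L.smult_r_distr L.smult_assoc1[symmetric] L.R.m_ac)
    also have "\<dots> = \<rho> (t \<otimes> t1 \<otimes> s0) \<odot>\<^bsub>MS\<^esub> \<theta>' (\<iota> m)"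
      using t t1 s0(1) step(5)[OF \<iota>_closed[OF m]] by (simp add: \<rho>_mult)
    finally show ?thesis .
  qed
  ultimately show ?case
    by (intro bexI[of _ "t \<otimes> t1 \<otimes> s0"] exI[of _ ?\<eta>] conjI ballI S_mult[OF S_mult[OF t t1] s0(1)])
qed

text \<open>A map in \<open>fac\<close> that fixes the images of the generators descends, up to a
  denominator \<open>t\<close>, to some \<open>\<eta>\<close> on \<open>M\<close>. On generators
  \<open>\<eta>\<close> and \<open>t\<close> agree after localization, so one \<open>u\<close> in
  \<open>S\<close> makes them agree there in \<open>M\<close>, and by linearity
  \<open>u \<otimes> t\<close> is multiplication by an element of \<open>S\<close> that lies in
  \<open>fac\<close>.\<close>

lemma free_localization_fac:
  assumes noe: "noetherian_ring R" and fg: "finitely_generated R M" and free: "free_module RS MS"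
  shows "\<exists>t \<in> S. fac R M M (\<lambda>x. t \<odot>\<^bsub>M\<^esub> x)"
proof -
  obtain G where G: "finite G" "G \<subseteq> carrier M" "carrier M \<subseteq> mspan R M G"
    using fg finitely_generated_iff[OF module_axioms] by blast
  obtain B where loc: "module RS MS" and B: "is_basis RS MS B" using free by (auto simp: free_module_def)
  obtain \<theta> where \<theta>: "fac RS MS MS \<theta>" "\<forall>y \<in> \<iota> ` G. \<theta> y = y"
    using free_fac[OF loc B, of "\<iota> ` G"] G(1,2) \<iota>_closed by blast
  obtain t \<eta> where t: "t \<in> S" and \<eta>: "fac R M M \<eta>"
    and eq: "\<And>m. m \<in> carrier M \<Longrightarrow> \<iota> (\<eta> m) = \<rho> t \<odot>\<^bsub>MS\<^esub> \<theta> (\<iota> m)"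
    using descend_fac[OF noe G loc \<theta>(1)] by blast
  note h\<eta> = fac_hom[OF module_axioms module_axioms \<eta>]
  have "\<exists>u \<in> S. \<forall>g \<in> G. u \<odot>\<^bsub>M\<^esub> \<eta> g = u \<odot>\<^bsub>M\<^esub> (t \<odot>\<^bsub>M\<^esub> g)"
    using G(1)
  proof (rule common_multiple)
    fix g assume g: "g \<in> G"
    then have "\<iota> (\<eta> g) = \<iota> (t \<odot>\<^bsub>M\<^esub> g)" using eq[of g] \<theta>(2) G(2) t by (auto simp: \<iota>_smult)
    then show "\<exists>u \<in> S. u \<odot>\<^bsub>M\<^esub> \<eta> g = u \<odot>\<^bsub>M\<^esub> (t \<odot>\<^bsub>M\<^esub> g)"
      using g G(2) t by (intro \<iota>_eq) (auto intro: mod_hom_closed[OF h\<eta>])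
  next
    fix g u v assume "g \<in> G" "u \<odot>\<^bsub>M\<^esub> \<eta> g = u \<odot>\<^bsub>M\<^esub> (t \<odot>\<^bsub>M\<^esub> g)" "u \<in> S" "v \<in> S"
    moreover from this have "\<eta> g \<in> carrier M" "g \<in> carrier M" using G(2) mod_hom_closed[OF h\<eta>] by auto
    ultimately show "(v \<otimes> u) \<odot>\<^bsub>M\<^esub> \<eta> g = (v \<otimes> u) \<odot>\<^bsub>M\<^esub> (t \<odot>\<^bsub>M\<^esub> g)" using t by (simp add: smult_assoc1)
  qed
  then obtain u where u: "u \<in> S" "\<forall>g \<in> G. u \<odot>\<^bsub>M\<^esub> \<eta> g = u \<odot>\<^bsub>M\<^esub> (t \<odot>\<^bsub>M\<^esub> g)" by blast
  have h1: "(\<lambda>m. u \<odot>\<^bsub>M\<^esub> \<eta> m) \<in> mod_hom R M M" and h2: "(\<lambda>m. u \<odot>\<^bsub>M\<^esub> (t \<odot>\<^bsub>M\<^esub> m)) \<in> mod_hom R M M"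
    using u(1) t by (auto intro!: mod_hom_comp[OF h\<eta>] mod_hom_comp[of "\<lambda>m. t \<odot>\<^bsub>M\<^esub> m" R M M] mod_hom_scale module_axioms)
  let ?H = "{m \<in> carrier M. u \<odot>\<^bsub>M\<^esub> \<eta> m \<ominus>\<^bsub>M\<^esub> u \<odot>\<^bsub>M\<^esub> (t \<odot>\<^bsub>M\<^esub> m) = \<zero>\<^bsub>M\<^esub>}"
  have "?H = carrier M"
    by (rule fg_induct[OF module_axioms G(2,3) submodule_ker[OF module_axioms module_axioms mod_hom_minus_fun[OF module_axioms h1 h2]]])
      (use u G(2) t in \<open>auto simp: minus_self subset_iff\<close>)
  then have uet: "u \<odot>\<^bsub>M\<^esub> \<eta> m = u \<odot>\<^bsub>M\<^esub> (t \<odot>\<^bsub>M\<^esub> m)" if "m \<in> carrier M" for m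
    using that minus_eq_zero_iff[OF mod_hom_closed[OF h1 that] mod_hom_closed[OF h2 that]] by blast
  have "fac R M M (\<lambda>m. u \<odot>\<^bsub>M\<^esub> \<eta> m)"
    by (rule fac_post[OF module_axioms module_axioms module_axioms \<eta> mod_hom_scale[OF module_axioms]]) (use u in simp)
  then have "fac R M M (\<lambda>m. (u \<otimes> t) \<odot>\<^bsub>M\<^esub> m)"
    by (rule fac_cong[OF module_axioms]) (use uet u t in \<open>simp add: smult_assoc1\<close>)
  then show ?thesis using S_mult[OF u(1) t] by blast
qed

end

section \<open>Powers in ideals and the locally free locus\<close>

text \<open>An ideal maximal among those that contain \<open>J\<close> and no power of \<open>x\<close> is prime.\<close>

lemma (in cring) ex_power_in_ideal:
  assumes noe: "noetherian_ring R" and J: "ideal J R" and x: "x \<in> carrier R"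
    and pr: "\<And>P. primeideal P R \<Longrightarrow> J \<subseteq> P \<Longrightarrow> x \<in> P"
  shows "\<exists>k::nat. x [^] k \<in> J"
proof (rule ccontr)
  assume no: "\<not> (\<exists>k::nat. x [^] k \<in> J)"
  define \<A> where "\<A> = {I. ideal I R \<and> J \<subseteq> I \<and> (\<forall>k::nat. x [^] k \<notin> I)}"
  have "J \<in> \<A>" using J no by (simp add: \<A>_def)
  then have "\<exists>P\<in>\<A>. \<forall>I\<in>\<A>. P \<subseteq> I \<longrightarrow> I = P"
  proof (intro subset_Zorn_nonempty)
    fix C assume C: "C \<noteq> {}" "subset.chain \<A> C"
    then have "subset.chain {I. ideal I R} C" by (auto simp: pred_on.chain_def \<A>_def)
    \<comment> \<open>In a noetherian ring a nonempty chain of ideals has a largest member, so its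
      union belongs to the family.\<close>
    then have "\<Union>C \<in> C" by (rule noetherian_ring.ideal_chain_is_trivial[OF noe C(1)])
    then show "\<Union>C \<in> \<A>" using C(2) by (auto simp: pred_on.chain_def)
  qed auto
  then obtain P where P: "P \<in> \<A>" and max: "\<And>I. I \<in> \<A> \<Longrightarrow> P \<subseteq> I \<Longrightarrow> I = P" by blast
  have iP: "ideal P R" and JP: "J \<subseteq> P" and nP: "\<And>k::nat. x [^] k \<notin> P" using P by (auto simp: \<A>_def)
  interpret P: ideal P R by (rule iP)
  have ex: "\<exists>(k::nat) i r. x [^] k = i \<oplus> r \<otimes> a \<and> i \<in> P \<and> r \<in> carrier R" if a: "a \<in> carrier R" "a \<notin> P" for a
  proof -
    let ?I = "P <+>\<^bsub>R\<^esub> PIdl a"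
    have I: "ideal ?I R" by (rule add_ideals[OF iP cgenideal_ideal[OF a(1)]])
    have zP: "\<zero> \<in> PIdl a" using a(1) by (auto simp: cgenideal_def intro!: exI[of _ \<zero>])
    have sub: "P \<subseteq> ?I"
    proof
      fix i assume i: "i \<in> P"
      then have "i = i \<oplus> \<zero>" using P.a_Hcarr by simp
      then show "i \<in> ?I" using i zP unfolding set_add_def' by blast
    qed
    have "a \<in> ?I"
    proof -
      have "a = \<zero> \<oplus> a" using a(1) by simp
      then show ?thesis using cgenideal_self[OF a(1)] additive_subgroup.zero_closed[OF ideal.axioms(1)[OF iP]] unfolding set_add_def' by blast
    qed
    then have "?I \<noteq> P" using a(2) by blast
    \<comment> \<open>\<open>?I\<close> is strictly larger than the maximal \<open>P\<close> and
      still contains \<open>J\<close>, so it can leave the family only by containing a power of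
      \<open>x\<close>.\<close>
    then have "?I \<notin> \<A>" using max sub by blast
    then obtain k :: nat where "x [^] k \<in> ?I" using I sub JP by (auto simp: \<A>_def)
    then show ?thesis unfolding set_add_def' cgenideal_def by blast
  qed
  have "primeideal P R"
  proof (rule primeidealI[OF iP is_cring])
    show "carrier R \<noteq> P" using nP[of 0] by auto
    fix a b assume ab: "a \<in> carrier R" "b \<in> carrier R" "a \<otimes> b \<in> P"
    show "a \<in> P \<or> b \<in> P"
    proof (rule ccontr)
      assume "\<not> (a \<in> P \<or> b \<in> P)"
      then obtain k l :: nat and i r j s where k: "x [^] k = i \<oplus> r \<otimes> a" "i \<in> P" "r \<in> carrier R"
        and l: "x [^] l = j \<oplus> s \<otimes> b" "j \<in> P" "s \<in> carrier R" using ex[of a] ex[of b] ab(1,2) by blast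
      have c: "i \<in> carrier R" "j \<in> carrier R" using k l P.a_Hcarr by auto
      \<comment> \<open>In the expanded product every term has \<open>i\<close>, \<open>j\<close> or
        \<open>a \<otimes> b\<close> as a factor, and these lie in \<open>P\<close>.\<close>
      have "x [^] (k + l) = i \<otimes> (j \<oplus> s \<otimes> b) \<oplus> (r \<otimes> a) \<otimes> j \<oplus> (r \<otimes> s) \<otimes> (a \<otimes> b)"
        using ab k l c x by (simp add: nat_pow_mult[symmetric] l_distr r_distr m_ac a_ac)
      also have "\<dots> \<in> P"
        using ab k(2,3) l(2,3) c
        by (intro P.a_closed P.I_r_closed[of i] P.I_l_closed[of j] P.I_l_closed[of "a \<otimes> b"]) auto
      finally show False using nP by blast
    qed
  qed
  from pr[OF this JP] show False using nP[of 1] x by simp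
qed

lemma locally_free_fac:
  fixes R :: "('a, 'r) ring_scheme"
  assumes R: "cring R" and noe: "noetherian_ring R" and M: "module R M" and fg: "finitely_generated R M"
    and xs: "set xs \<subseteq> carrier R" and lf: "locally_free_on R M (D_locus R xs)"
  shows "\<exists>k::nat. k > 0 \<and> (\<forall>x \<in> set xs. fac R M M (\<lambda>m. (x [^]\<^bsub>R\<^esub> k) \<odot>\<^bsub>M\<^esub> m))"
proof -
  interpret M: module R M by (rule M)
  have mul: "fac R M M (\<lambda>m. (b \<otimes>\<^bsub>R\<^esub> a) \<odot>\<^bsub>M\<^esub> m)"
    if "fac R M M (\<lambda>m. a \<odot>\<^bsub>M\<^esub> m)" "a \<in> carrier R" "b \<in> carrier R" for a b
    by (rule fac_cong[OF M fac_post[OF M M M that(1) mod_hom_scale[OF M that(3)]]])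
      (simp add: that(2,3) M.smult_assoc1)
  let ?J = "{a \<in> carrier R. fac R M M (\<lambda>m. a \<odot>\<^bsub>M\<^esub> m)}"
  have J: "ideal ?J R"
  proof (rule idealI[OF M.R.ring_axioms])
    show "subgroup ?J (add_monoid R)"
    proof (rule M.R.add.subgroupI)
      show "?J \<noteq> {}" using fac.zero[of M "\<lambda>m. \<zero>\<^bsub>R\<^esub> \<odot>\<^bsub>M\<^esub> m" M R] by auto
      fix a assume a: "a \<in> ?J"
      then show "\<ominus>\<^bsub>R\<^esub> a \<in> ?J" using mul[of a "\<ominus>\<^bsub>R\<^esub> \<one>\<^bsub>R\<^esub>"] by (auto simp: M.R.l_minus)
      fix b assume b: "b \<in> ?J"
      have "fac R M M (\<lambda>m. (a \<oplus>\<^bsub>R\<^esub> b) \<odot>\<^bsub>M\<^esub> m)"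
        by (rule fac_cong[OF M fac_add[OF M M]]) (use a b in \<open>auto simp: M.smult_l_distr\<close>)
      then show "a \<oplus>\<^bsub>R\<^esub> b \<in> ?J" using a b by simp
    qed auto
    fix a x assume a: "a \<in> ?J" and x: "x \<in> carrier R"
    then show "x \<otimes>\<^bsub>R\<^esub> a \<in> ?J" using mul by auto
    then show "a \<otimes>\<^bsub>R\<^esub> x \<in> ?J" using a x by (simp add: M.R.m_comm)
  qed
  have "\<exists>k::nat. x [^]\<^bsub>R\<^esub> k \<in> ?J" if x: "x \<in> set xs" for x
  proof (rule M.R.ex_power_in_ideal[OF noe J])
    show "x \<in> carrier R" using x xs by auto
    fix P assume P: "primeideal P R" and JP: "?J \<subseteq> P"
    interpret P: primeideal P R by (rule P)
    show "x \<in> P"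
    proof (rule ccontr)
      assume "x \<notin> P"
      then have "P \<in> D_locus R xs" using P x by (auto simp: D_locus_def Spec_def V_locus_def)
      then have free: "free_module (loc_ring R (carrier R - P)) (loc_module R M (carrier R - P))"
        using lf by (simp add: locally_free_on_def)
      have one: "\<one>\<^bsub>R\<^esub> \<notin> P" using P.I_notcarr P.one_imp_carrier by blast
      interpret S: mult_subset R M "carrier R - P"
        by (intro mult_subset.intro M mult_subset_axioms.intro) (use P.I_prime one in auto)
      obtain t where "t \<in> carrier R - P" "fac R M M (\<lambda>m. t \<odot>\<^bsub>M\<^esub> m)"
        using S.free_localization_fac[OF noe fg free] by blast
      then show False using JP by auto
    qed
  qed
  then obtain k :: "'a \<Rightarrow> nat" where k: "\<And>x. x \<in> set xs \<Longrightarrow> x [^]\<^bsub>R\<^esub> k x \<in> ?J" by metis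
  \<comment> \<open>A common exponent: the ideal contains all higher powers too, so the sum of the
    individual exponents suffices. The successor makes it positive, as every \<open>k x\<close> may
    be 0.\<close>
  define K where "K = Suc (\<Sum>x\<in>set xs. k x)"
  have "fac R M M (\<lambda>m. (x [^]\<^bsub>R\<^esub> K) \<odot>\<^bsub>M\<^esub> m)" if x: "x \<in> set xs" for x
  proof -
    have xR: "x \<in> carrier R" using x xs by auto
    have "k x \<le> (\<Sum>x\<in>set xs. k x)" by (rule member_le_sum[OF x]) auto
    then have "K = (K - k x) + k x" by (simp add: K_def)
    then have "x [^]\<^bsub>R\<^esub> K = x [^]\<^bsub>R\<^esub> (K - k x) \<otimes>\<^bsub>R\<^esub> x [^]\<^bsub>R\<^esub> k x"
      using xR by (metis M.R.nat_pow_mult)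
    then show ?thesis using mul[of "x [^]\<^bsub>R\<^esub> k x" "x [^]\<^bsub>R\<^esub> (K - k x)"] k[OF x] xR by simp
  qed
  then show ?thesis by (intro exI[of _ K]) (simp add: K_def)
qed


section \<open>Building the module from the homology\<close>

text \<open>A structure that receives a surjection compatible with the operations inherits the
  module laws; this verifies them for the operations on cosets.\<close>

lemma module_image:
  assumes L: "module R L" and p: "p \<in> mod_hom R L Q" and s: "p ` carrier L = carrier Q"
    and z: "p \<zero>\<^bsub>L\<^esub> = \<zero>\<^bsub>Q\<^esub>"
  shows "module R Q"
proof -
  interpret module R L by (rule L)
  have ex: "\<exists>x \<in> carrier L. y = p x" if "y \<in> carrier Q" for y using that s by auto
  note a = mod_hom_add[OF p, symmetric] and m = mod_hom_smult[OF p, symmetric] and c = mod_hom_closed[OF p]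
  show ?thesis
    by (rule module_fromI)
      (auto dest!: ex simp: R.is_cring a m c z[symmetric] smult_l_distr smult_r_distr smult_assoc1 M.a_ac)
qed

text \<open>\<open>g\<close> applies \<open>q\<close> to a chosen preimage under \<open>p\<close>.
  Two preimages differ by an element of the kernel of \<open>p\<close>, on which \<open>q\<close>
  vanishes.\<close>

lemma factor_hom:
  assumes L: "module R L" and X: "module R X" and Y: "module R Y"
    and p: "p \<in> mod_hom R L X" "p ` carrier L = carrier X" and q: "q \<in> mod_hom R L Y"
    and ker: "\<And>x. x \<in> carrier L \<Longrightarrow> p x = \<zero>\<^bsub>X\<^esub> \<Longrightarrow> q x = \<zero>\<^bsub>Y\<^esub>"
  shows "\<exists>g \<in> mod_hom R X Y. \<forall>x \<in> carrier L. g (p x) = q x"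
proof -
  interpret L: module R L by (rule L)
  interpret X: module R X by (rule X)
  interpret Y: module R Y by (rule Y)
  define g where "g y = q (inv_into (carrier L) p y)" for y
  have g: "g (p x) = q x" if x: "x \<in> carrier L" for x
  proof -
    let ?x = "inv_into (carrier L) p (p x)"
    have x': "?x \<in> carrier L" "p ?x = p x" using x by (auto intro: inv_into_into f_inv_into_f)
    have "p (?x \<ominus>\<^bsub>L\<^esub> x) = \<zero>\<^bsub>X\<^esub>"
      using x x' mod_hom_closed[OF p(1) x] by (simp add: mod_hom_diff[OF L X p(1)] X.minus_self)
    then have "q (?x \<ominus>\<^bsub>L\<^esub> x) = \<zero>\<^bsub>Y\<^esub>" using ker x x' by simp
    then show ?thesis using x x' mod_hom_closed[OF q] by (simp add: g_def mod_hom_diff[OF L Y q] Y.minus_eq_zero_iff)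
  qed
  have "g \<in> mod_hom R X Y"
  proof (rule mod_homI)
    fix y y' a assume "y \<in> carrier X"
    then obtain x where x: "x \<in> carrier L" "y = p x" unfolding p(2)[symmetric] by blast
    then show "g y \<in> carrier Y" using g mod_hom_closed[OF q] by simp
    {
      assume "y' \<in> carrier X"
      then obtain x' where x': "x' \<in> carrier L" "y' = p x'" unfolding p(2)[symmetric] by blast
      show "g (y \<oplus>\<^bsub>X\<^esub> y') = g y \<oplus>\<^bsub>Y\<^esub> g y'"
        using g[of "x \<oplus>\<^bsub>L\<^esub> x'"] g x x' by (simp add: mod_hom_add[OF p(1)] mod_hom_add[OF q])
    }
    assume a: "a \<in> carrier R"
    show "g (a \<odot>\<^bsub>X\<^esub> y) = a \<odot>\<^bsub>Y\<^esub> g y"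
      using g[of "a \<odot>\<^bsub>L\<^esub> x"] g x a by (simp add: mod_hom_smult[OF p(1)] mod_hom_smult[OF q])
  qed
  then show ?thesis using g by blast
qed

text \<open>Each of \<open>p\<close> and \<open>q\<close> factors through the other, and the two
  factors are mutually inverse.\<close>

lemma same_kernel_isomorphic:
  assumes L: "module R L" and X: "module R X" and Y: "module R Y"
    and p: "p \<in> mod_hom R L X" "p ` carrier L = carrier X"
    and q: "q \<in> mod_hom R L Y" "q ` carrier L = carrier Y"
    and ker: "\<And>x. x \<in> carrier L \<Longrightarrow> p x = \<zero>\<^bsub>X\<^esub> \<longleftrightarrow> q x = \<zero>\<^bsub>Y\<^esub>"
  shows "mod_isomorphic R X Y"
proof -
  obtain g where g: "g \<in> mod_hom R X Y" "\<And>x. x \<in> carrier L \<Longrightarrow> g (p x) = q x"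
    using factor_hom[OF L X Y p q(1)] ker by blast
  obtain h where h: "h \<in> mod_hom R Y X" "\<And>x. x \<in> carrier L \<Longrightarrow> h (q x) = p x"
    using factor_hom[OF L Y X q p(1)] ker by blast
  have ex: "\<exists>x \<in> carrier L. y = p x" if "y \<in> carrier X" for y using that p(2) by auto
  have ey: "\<exists>x \<in> carrier L. y = q x" if "y \<in> carrier Y" for y using that q(2) by auto
  have "bij_betw g (carrier X) (carrier Y)"
    by (rule bij_betw_byWitness[where f' = h])
      (use g h mod_hom_closed[OF p(1)] mod_hom_closed[OF q(1)] in \<open>auto dest!: ex ey\<close>)
  then show ?thesis by (rule mod_isomorphicI[OF X Y g(1)])
qed

text \<open>All that is used of the coset construction: homology is a module and the projection from
  the cycles is a surjective homomorphism with kernel the boundaries.\<close>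

lemma homology_quotient:
  assumes X: "is_cplx R X"
  shows "module R (homology X i)"
    and "(\<lambda>z. boundaries X i +>\<^bsub>obj X i\<^esub> z) \<in> mod_hom R ((obj X i)\<lparr>carrier := cycles X i\<rparr>) (homology X i)"
    and "(\<lambda>z. boundaries X i +>\<^bsub>obj X i\<^esub> z) ` cycles X i = carrier (homology X i)"
    and "z \<in> cycles X i \<Longrightarrow> boundaries X i +>\<^bsub>obj X i\<^esub> z = \<zero>\<^bsub>homology X i\<^esub> \<longleftrightarrow> z \<in> boundaries X i"
proof -
  let ?B = "boundaries X i" and ?Z = "cycles X i" and ?M = "obj X i" and ?H = "homology X i"
  let ?L = "?M\<lparr>carrier := ?Z\<rparr>" and ?p = "\<lambda>z. boundaries X i +>\<^bsub>obj X i\<^esub> z"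
  note mM = cplx_module[OF X, of i] and sB = submodule_boundaries[OF X, of i] and sZ = submodule_cycles[OF X, of i]
  interpret module R ?M by (rule mM)
  note EB = submoduleE[OF sB] and EZ = submoduleE[OF sZ]
  have L: "module R ?L" by (rule module_restrict[OF mM sZ])
  have zB: "\<zero>\<^bsub>?M\<^esub> \<in> ?B" using subgroup.one_closed[OF submodule.axioms(1)[OF sB]] by simp
  have bc: "b \<in> ?B \<Longrightarrow> b \<in> carrier ?M" and zc: "z \<in> ?Z \<Longrightarrow> z \<in> carrier ?M" for b z using EB(1) EZ(1) by auto
  have z0: "?B +>\<^bsub>?M\<^esub> \<zero>\<^bsub>?M\<^esub> = ?B" using bc by (auto simp: a_r_coset_def')
  have H: "\<zero>\<^bsub>?H\<^esub> = ?B" "C \<oplus>\<^bsub>?H\<^esub> D = C <+>\<^bsub>?M\<^esub> D" "a \<odot>\<^bsub>?H\<^esub> C = ?B <+>\<^bsub>?M\<^esub> ((\<lambda>x. a \<odot>\<^bsub>?M\<^esub> x) ` C)" for C D a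
    by (simp_all add: homology_def quot_mod_def set_add_def')
  show img: "?p ` ?Z = carrier ?H" by (auto simp: homology_carrier)
  show hom: "?p \<in> mod_hom R ?L ?H"
  proof (rule mod_homI)
    fix x y a assume x: "x \<in> carrier ?L"
    then show "?p x \<in> carrier ?H" using img by auto
    have xc: "x \<in> carrier ?M" using x zc by simp
    {
      assume y: "y \<in> carrier ?L"
      have yc: "y \<in> carrier ?M" using y zc by simp
      have "?p (x \<oplus>\<^bsub>?M\<^esub> y) = ?p x <+>\<^bsub>?M\<^esub> ?p y"
      proof safe
        fix w assume "w \<in> ?p (x \<oplus>\<^bsub>?M\<^esub> y)"
        then obtain b where b: "b \<in> ?B" "w = b \<oplus>\<^bsub>?M\<^esub> (x \<oplus>\<^bsub>?M\<^esub> y)" by (auto simp: a_r_coset_def')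
        then have "w = (b \<oplus>\<^bsub>?M\<^esub> x) \<oplus>\<^bsub>?M\<^esub> (\<zero>\<^bsub>?M\<^esub> \<oplus>\<^bsub>?M\<^esub> y)" using bc xc yc by (simp add: M.a_assoc)
        then show "w \<in> ?p x <+>\<^bsub>?M\<^esub> ?p y" using b(1) zB unfolding a_r_coset_def' set_add_def' by blast
      next
        fix w assume "w \<in> ?p x <+>\<^bsub>?M\<^esub> ?p y"
        then obtain b b' where b: "b \<in> ?B" "b' \<in> ?B" "w = (b \<oplus>\<^bsub>?M\<^esub> x) \<oplus>\<^bsub>?M\<^esub> (b' \<oplus>\<^bsub>?M\<^esub> y)"
          by (auto simp: a_r_coset_def' set_add_def')
        then have "w = (b \<oplus>\<^bsub>?M\<^esub> b') \<oplus>\<^bsub>?M\<^esub> (x \<oplus>\<^bsub>?M\<^esub> y)" using bc xc yc by (simp add: M.a_ac)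
        then show "w \<in> ?p (x \<oplus>\<^bsub>?M\<^esub> y)" using EB(5)[OF b(1,2)] by (auto simp: a_r_coset_def')
      qed
      then show "?p (x \<oplus>\<^bsub>?L\<^esub> y) = ?p x \<oplus>\<^bsub>?H\<^esub> ?p y" by (simp add: H)
    }
    assume a: "a \<in> carrier R"
    have "?p (a \<odot>\<^bsub>?M\<^esub> x) = ?B <+>\<^bsub>?M\<^esub> ((\<lambda>x. a \<odot>\<^bsub>?M\<^esub> x) ` ?p x)"
    proof safe
      fix w assume "w \<in> ?p (a \<odot>\<^bsub>?M\<^esub> x)"
      then obtain b where b: "b \<in> ?B" "w = b \<oplus>\<^bsub>?M\<^esub> a \<odot>\<^bsub>?M\<^esub> x" by (auto simp: a_r_coset_def')
      then have "w = b \<oplus>\<^bsub>?M\<^esub> a \<odot>\<^bsub>?M\<^esub> (\<zero>\<^bsub>?M\<^esub> \<oplus>\<^bsub>?M\<^esub> x)" using xc by simp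
      then show "w \<in> ?B <+>\<^bsub>?M\<^esub> ((\<lambda>x. a \<odot>\<^bsub>?M\<^esub> x) ` ?p x)" using b(1) zB unfolding a_r_coset_def' set_add_def' by blast
    next
      fix w assume "w \<in> ?B <+>\<^bsub>?M\<^esub> ((\<lambda>x. a \<odot>\<^bsub>?M\<^esub> x) ` ?p x)"
      then obtain b b' where b: "b \<in> ?B" "b' \<in> ?B" "w = b \<oplus>\<^bsub>?M\<^esub> a \<odot>\<^bsub>?M\<^esub> (b' \<oplus>\<^bsub>?M\<^esub> x)"
        by (auto simp: a_r_coset_def' set_add_def')
      then have "w = (b \<oplus>\<^bsub>?M\<^esub> a \<odot>\<^bsub>?M\<^esub> b') \<oplus>\<^bsub>?M\<^esub> a \<odot>\<^bsub>?M\<^esub> x" using bc xc a by (simp add: smult_r_distr M.a_assoc)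
      then show "w \<in> ?p (a \<odot>\<^bsub>?M\<^esub> x)" using EB(5)[OF b(1) EB(4)[OF a b(2)]] by (auto simp: a_r_coset_def')
    qed
    then show "?p (a \<odot>\<^bsub>?L\<^esub> x) = a \<odot>\<^bsub>?H\<^esub> ?p x" by (simp add: H)
  qed
  show "module R ?H" by (rule module_image[OF L hom]) (simp_all add: img H z0)
  have "?p z = ?p \<zero>\<^bsub>?M\<^esub> \<longleftrightarrow> z \<in> ?B" if "z \<in> ?Z"
    using coset_eq[OF mM sB zc[OF that] M.zero_closed] zc[OF that] by (simp add: minus_zero_right)
  then show "z \<in> ?Z \<Longrightarrow> ?p z = \<zero>\<^bsub>?H\<^esub> \<longleftrightarrow> z \<in> ?B" by (simp add: H z0)
qed

text \<open>A map \<open>p\<close> with kernel the boundaries turns the cycles into a copy of the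
  homology of \<open>C\<close> inside \<open>X\<close>, and \<open>f\<close> identifies that
  homology with the one of \<open>K\<close>. Both surjections from the cycles have the boundaries as
  kernel.\<close>

lemma qis_homology_isomorphic:
  assumes f: "qis_elem R C K f" and X: "module R X" and p: "p \<in> mod_hom R (obj C i) X"
    and ker: "\<And>x. x \<in> carrier (obj C i) \<Longrightarrow> p x = \<zero>\<^bsub>X\<^esub> \<longleftrightarrow> x \<in> boundaries C i"
  shows "submodule (p ` cycles C i) R X"
    and "mod_isomorphic R (X\<lparr>carrier := p ` cycles C i\<rparr>) (homology K i)"
proof -
  have C: "is_cplx R C" and K: "is_cplx R K" and cf: "chain_map R C K f" using f by (auto simp: qis_elem_def)
  note mC = cplx_module[OF C, of i] and sZ = submodule_cycles[OF C, of i]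
  show sub: "submodule (p ` cycles C i) R X" by (rule submodule_image[OF mC X p sZ])
  let ?L = "(obj C i)\<lparr>carrier := cycles C i\<rparr>" and ?q = "\<lambda>z. boundaries K i +>\<^bsub>obj K i\<^esub> f i z"
  note q = homology_quotient[OF K, where i = i]
  have zc: "z \<in> carrier (obj C i)" if "z \<in> cycles C i" for z using that by (simp add: cycles_def)
  have fL: "f i \<in> mod_hom R ?L ((obj K i)\<lparr>carrier := cycles K i\<rparr>)"
    using chain_cycles[OF C K cf] chain_hom[OF cf, of i] zc
    by (intro mod_homI) (auto simp: mod_hom_add mod_hom_smult)
  have hq: "?q \<in> mod_hom R ?L (homology K i)" by (rule mod_hom_comp[OF fL q(2)])
  show "mod_isomorphic R (X\<lparr>carrier := p ` cycles C i\<rparr>) (homology K i)"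
  proof (rule same_kernel_isomorphic[OF module_restrict[OF mC sZ] module_restrict[OF X sub] q(1) _ _ hq])
    show "p \<in> mod_hom R ?L (X\<lparr>carrier := p ` cycles C i\<rparr>)"
      using zc by (intro mod_homI) (auto simp: mod_hom_add[OF p] mod_hom_smult[OF p])
    show "?q ` carrier ?L = carrier (homology K i)"
    proof safe
      fix z assume "z \<in> carrier ?L"
      then show "?q z \<in> carrier (homology K i)" by (rule mod_hom_closed[OF hq])
    next
      fix D assume "D \<in> carrier (homology K i)"
      then obtain w where w: "w \<in> cycles K i" "D = boundaries K i +>\<^bsub>obj K i\<^esub> w" by (auto simp: homology_carrier)
      obtain z where z: "z \<in> cycles C i" "w \<ominus>\<^bsub>obj K i\<^esub> f i z \<in> boundaries K i"
        using f w(1) unfolding qis_elem_def by blast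
      have "w \<in> carrier (obj K i)" "f i z \<in> carrier (obj K i)"
        using w(1) chain_cycles[OF C K cf z(1)] by (auto simp: cycles_def)
      then have "D = ?q z" using z(2) w(2) coset_eq[OF cplx_module[OF K] submodule_boundaries[OF K]] by simp
      then show "D \<in> ?q ` carrier ?L" using z(1) by auto
    qed
    fix z assume "z \<in> carrier ?L"
    then have z: "z \<in> cycles C i" by simp
    have "f i z \<in> boundaries K i \<longleftrightarrow> z \<in> boundaries C i"
      using f z chain_boundaries[OF cf] unfolding qis_elem_def by blast
    then show "p z = \<zero>\<^bsub>X\<lparr>carrier := p ` cycles C i\<rparr>\<^esub> \<longleftrightarrow> ?q z = \<zero>\<^bsub>homology K i\<^esub>"
      using ker[OF zc[OF z]] q(4)[OF chain_cycles[OF C K cf z]] by simp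
  qed simp
qed

text \<open>With \<open>X\<^sub>i = C\<^sub>i / B\<^sub>i\<close> there are exact sequences \<open>0 \<rightarrow> H\<^sub>i \<rightarrow> X\<^sub>i \<rightarrow> B\<^bsub>i-1\<^esub> \<rightarrow> 0\<close> and
  \<open>0 \<rightarrow> B\<^sub>i \<rightarrow> C\<^sub>i \<rightarrow> X\<^sub>i \<rightarrow> 0\<close>; so each degree costs one syzygy and one extension.\<close>

lemma built_cokernel:
  fixes C :: "('a, nat \<Rightarrow> 'a) mod_cplx" and X :: "('a, nat \<Rightarrow> 'a) module"
  assumes f: "qis_elem R C K f" and neg: "carrier (obj C (- 1)) = {\<zero>\<^bsub>obj C (- 1)\<^esub>}"
    and fg: "\<And>i. finitely_generated R (obj C i)"
    and proj: "\<And>i. 0 \<le> i \<Longrightarrow> i < int n \<Longrightarrow> projective_module R (obj C i)"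
  shows "k \<le> n \<Longrightarrow> module R X \<Longrightarrow> p \<in> mod_hom R (obj C (int k)) X \<Longrightarrow> p ` carrier (obj C (int k)) = carrier X \<Longrightarrow>
    (\<And>x. x \<in> carrier (obj C (int k)) \<Longrightarrow> p x = \<zero>\<^bsub>X\<^esub> \<longleftrightarrow> x \<in> boundaries C (int k)) \<Longrightarrow>
    built R (homology K ` {0..int n}) k k 0 X"
proof (induction k arbitrary: X p)
  case 0
  have C: "is_cplx R C" using f by (simp add: qis_elem_def)
  \<comment> \<open>The term in degree -1 is zero, so every element is a cycle and the cokernel in
    degree 0 is the homology itself.\<close>
  have "cycles C 0 = carrier (obj C 0)"
    using mod_hom_closed[OF cplx_hom[OF C, of 0]] neg by (auto simp: cycles_def)
  then have "mod_isomorphic R X (homology K 0)"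
    using qis_homology_isomorphic(2)[OF f 0(2), of p 0] 0(3-5) by simp
  then show ?case by (intro built.start) auto
next
  case (Suc k)
  have C: "is_cplx R C" using f by (simp add: qis_elem_def)
  let ?i = "int k" and ?j = "int (Suc k)"
  have ij: "?i + 1 = ?j" "?j - 1 = ?i" by simp_all
  note mC = cplx_module[OF C]
  let ?A = "X\<lparr>carrier := p ` cycles C ?j\<rparr>" and ?B = "(obj C ?i)\<lparr>carrier := boundaries C ?i\<rparr>"
  note A = qis_homology_isomorphic[OF f Suc.prems(2,3,5)]
  have bA: "built R (homology K ` {0..int n}) 0 0 0 ?A"
    using Suc.prems(1) by (intro built.start[OF _ A(2)]) auto
  note sB = submodule_boundaries[OF C, of ?i]
  have mB: "module R ?B" by (rule module_restrict[OF mC sB])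
  have Bsub: "boundaries C ?i \<subseteq> carrier (obj C ?i)" by (rule module.submoduleE(1)[OF mC sB])
  \<comment> \<open>The induction hypothesis accepts any model of the cokernel in degree
    \<open>k\<close>; this one has its elements in \<open>nat => 'a\<close>, as \<open>built\<close>
    demands.\<close>
  obtain Y :: "('a, nat \<Rightarrow> 'a) module" and q where Y: "module R Y" "q \<in> mod_hom R (obj C ?i) Y"
    "q ` carrier (obj C ?i) = carrier Y" "\<And>x. x \<in> carrier (obj C ?i) \<Longrightarrow> q x = \<zero>\<^bsub>Y\<^esub> \<longleftrightarrow> x \<in> boundaries C ?i"
    using ex_quotient[OF mC sB] by blast
  have bY: "built R (homology K ` {0..int n}) k k 0 Y"
    by (rule Suc.IH[OF _ Y]) (use Suc.prems(1) in auto)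
  have "short_exact R ?B (obj C ?i) Y (\<lambda>x. x) q"
    unfolding short_exact_def using mB mC Y Bsub by (auto simp: a_kernel_def' intro!: mod_homI)
  \<comment> \<open>\<open>Suc k \<le> n\<close> keeps the covering term \<open>obj C ?i\<close>
    strictly below degree \<open>n\<close>, where the terms are projective.\<close>
  then have "is_syzygy R ?B Y"
    unfolding is_syzygy_def using fg proj[of ?i] Suc.prems(1) by (intro exI[of _ "obj C ?i"]) auto
  then have bB: "built R (homology K ` {0..int n}) (Suc k) k 0 ?B" by (rule built.syzygy[OF bY])
  have d: "diff C ?j \<in> mod_hom R (obj C ?j) ?B"
    using cplx_hom[OF C, of ?j] unfolding ij(2)
    by (intro mod_homI) (auto simp: boundaries_def ij(1) mod_hom_add mod_hom_smult add.commute)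
  obtain g where g: "g \<in> mod_hom R X ?B" "\<And>x. x \<in> carrier (obj C ?j) \<Longrightarrow> g (p x) = diff C ?j x"
  proof -
    \<comment> \<open>The differential kills boundaries, so it descends from the term of
      \<open>C\<close> to its cokernel \<open>X\<close>.\<close>
    have "diff C ?j x = \<zero>\<^bsub>?B\<^esub>" if "x \<in> carrier (obj C ?j)" "p x = \<zero>\<^bsub>X\<^esub>" for x
      using Suc.prems(5)[OF that(1)] that(2) boundaries_cycles[OF C, of ?j] by (auto simp: cycles_def)
    from factor_hom[OF mC Suc.prems(2) mB Suc.prems(3,4) d this] show ?thesis using that by blast
  qed
  have "short_exact R ?A X ?B (\<lambda>x. x) g"
    unfolding short_exact_def
  proof (intro conjI module_restrict[OF Suc.prems(2) A(1)] Suc.prems(2) mB g(1))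
    show "(\<lambda>x. x) \<in> mod_hom R ?A X"
      using module.submoduleE(1)[OF Suc.prems(2) A(1)] by (intro mod_homI) auto
    show "g ` carrier X = carrier ?B"
      unfolding Suc.prems(4)[symmetric] using g(2) by (auto simp: boundaries_def ij(1) image_image add.commute)
    show "(\<lambda>x. x) ` carrier ?A = a_kernel X ?B g"
    proof -
      have "g (p x) = \<zero>\<^bsub>?B\<^esub> \<longleftrightarrow> x \<in> cycles C ?j" if "x \<in> carrier (obj C ?j)" for x
        using g(2)[OF that] that by (simp add: cycles_def)
      moreover have "cycles C ?j \<subseteq> carrier (obj C ?j)" by (auto simp: cycles_def)
      ultimately show ?thesis unfolding a_kernel_def' Suc.prems(4)[symmetric] by auto
    qed
  qed (simp_all add: inj_on_def)
  then have "is_extension R X ?A ?B" unfolding is_extension_def by blast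
  \<comment> \<open>The homology \<open>?A\<close> costs nothing and \<open>?B\<close> costs
    \<open>k + 1\<close> syzygies and \<open>k\<close> extensions, so the extension brings both
    counts to \<open>k + 1\<close>.\<close>
  from built.extension[OF bA bB this] show ?case by simp
qed

theorem theorem1p1:
  fixes R :: "('a, 'r) ring_scheme" and M :: "('a, 'm, 'c) module_scheme" and xs :: "'a list"
  assumes "cring R" and "noetherian_ring R"
    and "module R M" and "finitely_generated R M"
    and "set xs \<subseteq> carrier R"
    and "locally_free_on R M (D_locus R xs)"
  shows "\<exists>k::nat. k > 0 \<and>
    (\<exists>C :: ('a, nat \<Rightarrow> 'a) mod_cplx.
      is_cplx R C \<and>
      (\<forall>i. finitely_generated R (obj C i)) \<and>
      (\<forall>i. i < 0 \<or> i > int (length xs) \<longrightarrow> carrier (obj C i) = {\<zero>\<^bsub>obj C i\<^esub>}) \<and>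
      (\<forall>i. 0 \<le> i \<and> i < int (length xs) \<longrightarrow> projective_module R (obj C i)) \<and>
      direct_summand R M (obj C (int (length xs))) \<and>
      equivalent_cplx R (koszul R (seq_pow R xs k) M) C) \<and>
    built_from R (koszul_homology R (seq_pow R xs k) M ` {0..int (length xs)})
      (length xs) (length xs) 1 M"
proof -
  interpret M: module R M by fact
  let ?n = "int (length xs)"
  obtain k :: nat where k: "k > 0" "\<And>x. x \<in> set xs \<Longrightarrow> fac R M M (\<lambda>m. (x [^]\<^bsub>R\<^esub> k) \<odot>\<^bsub>M\<^esub> m)"
    using locally_free_fac[OF assms] by blast
  let ?ys = "seq_pow R xs k"
  let ?K = "koszul R ?ys M"
  have ys: "set ?ys \<subseteq> carrier R" "length ?ys = length xs" using assms(5) by (auto simp: seq_pow_def)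
  have facM: "fac R M M (\<lambda>m. b \<odot>\<^bsub>M\<^esub> m)" if "b \<in> set ?ys" for b
    using that k(2) by (auto simp: seq_pow_def)
  obtain C :: "('a, nat \<Rightarrow> 'a) mod_cplx" and f where ap: "approx R ?ys M C f"
    using ex_approx[OF assms(1,2) ys(1) fg_noeth[OF assms(1-4)] facM] by blast
  have q: "qis_elem R C ?K f" and C: "is_cplx R C" and noe: "\<And>i. noeth R (obj C i)"
    and z: "\<And>i. i < 0 \<or> i > ?n \<Longrightarrow> carrier (obj C i) = {\<zero>\<^bsub>obj C i\<^esub>}"
    and fc: "\<And>i. 0 \<le> i \<Longrightarrow> i < ?n \<Longrightarrow> fac R (obj C i) (obj C i) (\<lambda>x. x)"
    and re: "retract R M (obj C ?n)"
    using ap by (auto simp: approx_def qis_elem_def ys(2))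
  note mC = cplx_module[OF C]
  have proj: "projective_module R (obj C i)" if "0 \<le> i" "i < ?n" for i
    by (rule fac_projective[OF mC fc[OF that]])
  \<comment> \<open>A single quasi-isomorphism links the two complexes; it points from
    \<open>C\<close> to the Koszul complex, a direction that \<open>qis_linked\<close>
    admits.\<close>
  have eqv: "equivalent_cplx R ?K C"
    unfolding equivalent_cplx_def qis_linked_def using qis_elem_quasi_iso[OF q] by blast
  have bf: "built_from R (koszul_homology R ?ys M ` {0..?n}) (length xs) (length xs) 1 M"
  proof -
    have KH: "koszul_homology R ?ys M ` {0..?n} = homology ?K ` {0..?n}"
      by (rule image_cong) (simp_all add: koszul_homology_def)
    obtain X :: "('a, nat \<Rightarrow> 'a) module" and p where X: "module R X" "p \<in> mod_hom R (obj C ?n) X"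
      "p ` carrier (obj C ?n) = carrier X" "\<And>x. x \<in> carrier (obj C ?n) \<Longrightarrow> p x = \<zero>\<^bsub>X\<^esub> \<longleftrightarrow> x \<in> boundaries C ?n"
      using ex_quotient[OF mC submodule_boundaries[OF C], of ?n] by blast
    have bX: "built R (homology ?K ` {0..?n}) (length xs) (length xs) 0 X"
      by (rule built_cokernel[OF q z noeth_fg[OF noe] proj _ X]) auto
    \<comment> \<open>The term in degree \<open>n + 1\<close> is zero. Hence \<open>p\<close> is
      injective in degree \<open>n\<close>, and the cokernel \<open>X\<close> contains the top term
      of \<open>C\<close> as a retract.\<close>
    have "boundaries C ?n = {\<zero>\<^bsub>obj C ?n\<^esub>}"
      using z[of "?n + 1"] mod_hom_zero[OF mC mC cplx_hom'[OF C, of ?n]] by (simp add: boundaries_def)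
    then have ker: "x = \<zero>\<^bsub>obj C ?n\<^esub>" if "x \<in> carrier (obj C ?n)" "p x = \<zero>\<^bsub>X\<^esub>" for x using X(4) that by auto
    obtain g where g: "g \<in> mod_hom R X (obj C ?n)" "\<And>x. x \<in> carrier (obj C ?n) \<Longrightarrow> g (p x) = x"
      using factor_hom[OF mC X(1) mC X(2,3) mod_hom_id ker] by blast
    have rX: "retract R (obj C ?n) X" by (rule retractI[where i = p and p = g, OF mC X(1,2) g])
    \<comment> \<open>\<open>built\<close> speaks only of modules with elements in
      \<open>nat => 'a\<close>, so \<open>M\<close> is replaced by a copy, as
      \<open>built_from\<close> allows.\<close>
    obtain \<phi> :: "'m \<Rightarrow> nat \<Rightarrow> 'a" where \<phi>: "inj_on \<phi> (carrier M)" using fg_embeds[OF assms(3,4)] by blast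
    let ?M = "img_mod M \<phi>" and ?i = "inv_into (carrier M) \<phi>"
    have M': "module R ?M" "\<phi> \<in> mod_hom R M ?M" "?i \<in> mod_hom R ?M M" using ex_transport[OF assms(3) \<phi>] by auto
    have cM: "carrier ?M = \<phi> ` carrier M" by (simp add: img_mod_def)
    have "mod_isomorphic R M ?M"
      by (rule mod_isomorphicI[OF assms(3) M'(1,2)]) (simp add: bij_betw_def \<phi> cM)
    moreover have "retract R ?M M"
      by (rule retractI[OF M'(1) assms(3) M'(3,2)]) (auto simp: cM \<phi>)
    \<comment> \<open>The retracts from the copy of \<open>M\<close> to \<open>M\<close>, to the top
      term and to \<open>X\<close> are composed before conversion, so that together they count as
      one passage to a summand.\<close>
    then have "direct_summand R ?M X"
      by (intro retract_direct_summand retract_trans[OF retract_trans[OF _ re] rX])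
    from built.summand[OF bX this] have "built R (homology ?K ` {0..?n}) (length xs) (length xs) 1 ?M" by simp
    ultimately show ?thesis unfolding built_from_def KH by blast
  qed
  show ?thesis
    by (intro exI[of _ k] conjI exI[of _ C] allI impI k(1) C noeth_fg[OF noe] z proj
      retract_direct_summand[OF re] eqv bf) auto
qed

end
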